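(* Let $(\pi,\mathcal H)$ be an admissible (continuous) Hilbert space representation of $G$ of finite length and let $\lambda\in \mathrm{Wh}_\chi(\mathcal H^\infty)$. Let $\Gamma$ be a closed cone in $\mathfrak a$ which is disjoint from $\mathrm{cl}(\mathfrak a^+)\setminus\{0\}$. Then for every $s>0$ there exists a continuous seminorm $n$ on $\mathcal H^\infty$ such that, for all $v\in \mathcal H^\infty$, $k\in K$ and $a\in\exp(\Gamma)$, $$|\mathrm{wh}_\lambda(v)(ka)|\le e^{-s|\log a|}\,n(v).$$
   Context: $G$ is a real reductive Lie group of the Harish-Chandra class, $K$ a maximal compact subgroup with Cartan involution $\theta$, and $G=KAN_0$ an Iwasawa decomposition; Lie algebras are denoted by fraktur lower case letters. $\Sigma$ is the root system of $\mathfrak a$ in $\mathfrak g$, $\Sigma^+$ the positive system of roots whose root spaces lie in $\mathfrak n_0$, and $\Delta\subset\Sigma^+$ the set of simple roots. $\mathfrak a^+=\{H\in\mathfrak a\mid \alpha(H)>0\ \forall\alpha\in\Delta\}$ and $\mathrm{cl}(\mathfrak a^+)$ is its closure. $\chi$ is a unitary character of $N_0$ which is regular: its derivative $d\chi(e)$ is non-zero on each root space $\mathfrak g_\alpha$, $\alpha\in\Delta$. $|\cdot|$ is the norm on $\mathfrak a$ coming from the inner product $\langle X,Y\rangle=-B(X,\theta Y)$, where $B$ is a fixed non-degenerate $\mathrm{Ad}(G)$-invariant symmetric bilinear form on $\mathfrak g$, negative definite on $\mathfrak k$, positive definite on $\mathfrak p$ (and equal to the Killing form on $[\mathfrak g,\mathfrak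 g]$). $\mathcal H^\infty$ is the Fréchet space of smooth vectors of $\pi$ and $\mathrm{Wh}_\chi(\mathcal H^\infty)$ is the space of continuous linear functionals $\lambda$ on $\mathcal H^\infty$ with $\lambda\circ\pi(n)=\chi(n)\lambda$ for all $n\in N_0$. The Whittaker coefficient is $\mathrm{wh}_\lambda(v)(x)=\lambda(\pi(x)^{-1}v)$ for $v\in\mathcal H^\infty$, $x\in G$. *)

theory Defs
  imports "HOL-Analysis.Analysis" "HOL-Algebra.Generated_Groups"
begin

section \<open>Smooth maps in charts\<close>

text \<open>A chart is a pair of its domain and its coordinate map. The model space
  \<open>'e\<close> is a finite-dimensional real normed vector space rather than a
  \<open>euclidean_space\<close>, so that dimension zero is not excluded.\<close>

type_synonym ('a, 'e) chart = "'a set \<times> ('a \<Rightarrow> 'e)"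

text \<open>The quantification over directions \<open>v\<close> gives the usual notion of
  \<open>C\<^sup>k\<close> because it is only used for finite-dimensional domains.\<close>

primrec Ck_on :: "nat \<Rightarrow> ('e::real_normed_vector \<Rightarrow> 'f::real_normed_vector) \<Rightarrow> 'e set \<Rightarrow> bool" where
  "Ck_on 0 f S \<longleftrightarrow> continuous_on S f"
| "Ck_on (Suc k) f S \<longleftrightarrow>
     (\<forall>x\<in>S. f differentiable (at x)) \<and> (\<forall>v. Ck_on k (\<lambda>x. frechet_derivative f (at x) v) S)"

definition smooth_on_open ::
  "('e::real_normed_vector \<Rightarrow> 'f::real_normed_vector) \<Rightarrow> 'e set \<Rightarrow> bool" where
  "smooth_on_open f S \<longleftrightarrow> open S \<and> (\<forall>k. Ck_on k f S)"

text \<open>Continuity need not be demanded separately below: it follows from the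
  openness requirement in \<^const>\<open>smooth_on_open\<close>.\<close>

definition smooth_map :: "('a, 'e::real_normed_vector) chart set \<Rightarrow>
    ('b, 'f::real_normed_vector) chart set \<Rightarrow> ('a \<Rightarrow> 'b) \<Rightarrow> bool" where
  "smooth_map A A' f \<longleftrightarrow>
     (\<forall>(U, \<phi>)\<in>A. \<forall>(V, \<psi>)\<in>A'. smooth_on_open (\<psi> \<circ> f \<circ> inv_into U \<phi>) (\<phi> ` (U \<inter> f -` V)))"

text \<open>Smoothness of the identity of the atlas to itself is the compatibility of charts.\<close>

definition smooth_atlas :: "'a topology \<Rightarrow> ('a, 'e::real_normed_vector) chart set \<Rightarrow> bool" where
  "smooth_atlas T A \<longleftrightarrow>
     (\<forall>(U, \<phi>)\<in>A. openin T U \<and> open (\<phi> ` U) \<and>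
        homeomorphic_map (subtopology T U) (top_of_set (\<phi> ` U)) \<phi>) \<and>
     (\<Union>(fst ` A)) = topspace T \<and>
     smooth_map A A (\<lambda>x. x)"

definition prod_atlas ::
  "('a, 'e) chart set \<Rightarrow> ('b, 'f) chart set \<Rightarrow> ('a \<times> 'b, 'e \<times> 'f) chart set" where
  "prod_atlas A A' = {(U \<times> V, map_prod \<phi> \<psi>) | U \<phi> V \<psi>. (U, \<phi>) \<in> A \<and> (V, \<psi>) \<in> A'}"

section \<open>Lie groups\<close>

text \<open>The base chart is a chart around the identity. Its differential identifies the
  tangent space at the identity, i.e. the Lie algebra, with the model space \<open>'e\<close>;
  a different base chart only changes this linear identification.\<close>

record ('a, 'e) lie_group = "'a monoid" +
  lie_topology :: "'a topology"
  atlas :: "('a, 'e) chart set"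
  base_chart :: "('a, 'e) chart"

locale lie_group = group G
  for G :: "('a, 'e::real_normed_vector, 'm) lie_group_scheme" (structure) +
  assumes finite_dimensional: "\<exists>S. finite S \<and> span S = (UNIV :: 'e set)"
    and topspace_eq: "topspace (lie_topology G) = carrier G"
    and Hausdorff: "Hausdorff_space (lie_topology G)"
    and second_countable: "second_countable (lie_topology G)"
    and atlas: "smooth_atlas (lie_topology G) (atlas G)"
    and smooth_mult: "smooth_map (prod_atlas (atlas G) (atlas G)) (atlas G) (\<lambda>(x, y). x \<otimes> y)"
    and smooth_inverse: "smooth_map (atlas G) (atlas G) (\<lambda>x. inv x)"
    and base_chart_in_atlas: "base_chart G \<in> atlas G"
    and one_in_base_chart: "\<one> \<in> fst (base_chart G)"

definition coords :: "('a, 'e, 'm) lie_group_scheme \<Rightarrow> 'a \<Rightarrow> 'e" where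
  "coords G = snd (base_chart G)"

definition uncoords :: "('a, 'e, 'm) lie_group_scheme \<Rightarrow> 'e \<Rightarrow> 'a" where
  "uncoords G = inv_into (fst (base_chart G)) (snd (base_chart G))"

text \<open>The differential at the identity of a smooth map \<open>f\<close> fixing the identity.\<close>

definition diff_one ::
  "('a, 'e::real_normed_vector, 'm) lie_group_scheme \<Rightarrow> ('a \<Rightarrow> 'a) \<Rightarrow> 'e \<Rightarrow> 'e" where
  "diff_one G f =
     frechet_derivative (coords G \<circ> f \<circ> uncoords G) (at (coords G \<one>\<^bsub>G\<^esub>))"

definition Ad :: "('a, 'e::real_normed_vector, 'm) lie_group_scheme \<Rightarrow> 'a \<Rightarrow> 'e \<Rightarrow> 'e" where
  "Ad G g = diff_one G (\<lambda>x. g \<otimes>\<^bsub>G\<^esub> x \<otimes>\<^bsub>G\<^esub> inv\<^bsub>G\<^esub> g)"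

text \<open>The map \<open>ad\<close> is the differential of \<open>Ad\<close> at the identity.\<close>

definition bracket :: "('a, 'e::real_normed_vector, 'm) lie_group_scheme \<Rightarrow> 'e \<Rightarrow> 'e \<Rightarrow> 'e" where
  "bracket G X Y =
     frechet_derivative (\<lambda>x. Ad G (uncoords G x) Y) (at (coords G \<one>\<^bsub>G\<^esub>)) X"

definition one_parameter_subgroup ::
  "('a, 'e::real_normed_vector, 'm) lie_group_scheme \<Rightarrow> 'e \<Rightarrow> (real \<Rightarrow> 'a) \<Rightarrow> bool" where
  "one_parameter_subgroup G X \<gamma> \<longleftrightarrow>
     continuous_map euclideanreal (lie_topology G) \<gamma> \<and>
     (\<forall>s t. \<gamma> (s + t) = \<gamma> s \<otimes>\<^bsub>G\<^esub> \<gamma> t) \<and>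
     ((coords G \<circ> \<gamma>) has_vector_derivative X) (at 0)"

definition lie_exp :: "('a, 'e::real_normed_vector, 'm) lie_group_scheme \<Rightarrow> 'e \<Rightarrow> 'a" where
  "lie_exp G X = (THE \<gamma>. one_parameter_subgroup G X \<gamma>) 1"

text \<open>The connected Lie subgroup with Lie algebra \<open>V\<close> (for a subalgebra \<open>V\<close>).\<close>

definition analytic_subgroup ::
  "('a, 'e::real_normed_vector, 'm) lie_group_scheme \<Rightarrow> 'e set \<Rightarrow> 'a set" where
  "analytic_subgroup G V = generate G (lie_exp G ` V)"

definition derived_algebra ::
  "('a, 'e::real_normed_vector, 'm) lie_group_scheme \<Rightarrow> 'e set" where
  "derived_algebra G = span {bracket G X Y | X Y. True}"

definition lie_ideal ::
  "('a, 'e::real_normed_vector, 'm) lie_group_scheme \<Rightarrow> 'e set \<Rightarrow> bool" where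
  "lie_ideal G I \<longleftrightarrow> subspace I \<and> (\<forall>X. \<forall>Y\<in>I. bracket G X Y \<in> I)"

definition reductive_lie_algebra ::
  "('a, 'e::real_normed_vector, 'm) lie_group_scheme \<Rightarrow> bool" where
  "reductive_lie_algebra G \<longleftrightarrow>
     (\<forall>I. lie_ideal G I \<longrightarrow>
        (\<exists>J. lie_ideal G J \<and> I \<inter> J = {0} \<and> {X + Y | X Y. X \<in> I \<and> Y \<in> J} = UNIV))"

definition linear_trace :: "('e::real_vector \<Rightarrow> 'e) \<Rightarrow> real" where
  "linear_trace f =
     (let S = (SOME S. independent S \<and> span S = UNIV) in \<Sum>b\<in>S. representation S (f b) b)"

definition killing_form ::
  "('a, 'e::real_normed_vector, 'm) lie_group_scheme \<Rightarrow> 'e \<Rightarrow> 'e \<Rightarrow> real" where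
  "killing_form G X Y = linear_trace (\<lambda>Z. bracket G X (bracket G Y Z))"

section \<open>Groups of the Harish-Chandra class\<close>

text \<open>The complexified Lie algebra: the pair \<open>(X, Y)\<close> stands for \<open>X + iY\<close>.\<close>

definition complexified_bracket ::
  "('a, 'e::real_normed_vector, 'm) lie_group_scheme \<Rightarrow> 'e \<times> 'e \<Rightarrow> 'e \<times> 'e \<Rightarrow> 'e \<times> 'e" where
  "complexified_bracket G Z W =
     (bracket G (fst Z) (fst W) - bracket G (snd Z) (snd W),
      bracket G (fst Z) (snd W) + bracket G (snd Z) (fst W))"

definition operator_exp :: "('v::real_normed_vector \<Rightarrow> 'v) \<Rightarrow> 'v \<Rightarrow> 'v" where
  "operator_exp T v = (\<Sum>n. (T ^^ n) v /\<^sub>R fact n)"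

text \<open>The group of inner automorphisms of the complexified Lie algebra, i.e. the group
  generated by all \<open>exp (ad Z)\<close>; the inverse of a generator is the generator for \<open>-Z\<close>.\<close>

inductive_set complex_Int :: "('a, 'e::real_normed_vector, 'm) lie_group_scheme \<Rightarrow>
    ('e \<times> 'e \<Rightarrow> 'e \<times> 'e) set"
  for G :: "('a, 'e::real_normed_vector, 'm) lie_group_scheme" where
  "id \<in> complex_Int G"
| "\<sigma> \<in> complex_Int G \<Longrightarrow> operator_exp (complexified_bracket G Z) \<circ> \<sigma> \<in> complex_Int G"

definition group_center :: "('a, 'm) monoid_scheme \<Rightarrow> 'a set \<Rightarrow> 'a set" where
  "group_center G H = {z \<in> H. \<forall>x\<in>H. z \<otimes>\<^bsub>G\<^esub> x = x \<otimes>\<^bsub>G\<^esub> z}"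

locale harish_chandra_class = lie_group G
  for G :: "('a, 'e::real_normed_vector, 'm) lie_group_scheme" (structure) +
  assumes reductive: "reductive_lie_algebra G"
    and finitely_many_components: "finite (connected_components_of (lie_topology G))"
    and Ad_inner: "x \<in> carrier G \<Longrightarrow> map_prod (Ad G x) (Ad G x) \<in> complex_Int G"
    and finite_center:
      "finite (group_center G (analytic_subgroup G (derived_algebra G)))"

section \<open>Cartan involution, invariant form and Iwasawa decomposition\<close>

definition maximal_compact_subgroup ::
  "('a, 'e, 'm) lie_group_scheme \<Rightarrow> 'a set \<Rightarrow> bool" where
  "maximal_compact_subgroup G K \<longleftrightarrow>
     subgroup K G \<and> compactin (lie_topology G) K \<and>
     (\<forall>L. subgroup L G \<and> compactin (lie_topology G) L \<and> K \<subseteq> L \<longrightarrow> L = K)"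

definition cartan_k ::
  "('a, 'e::real_normed_vector, 'm) lie_group_scheme \<Rightarrow> ('a \<Rightarrow> 'a) \<Rightarrow> 'e set" where
  "cartan_k G \<theta> = {X. diff_one G \<theta> X = X}"

definition cartan_p ::
  "('a, 'e::real_normed_vector, 'm) lie_group_scheme \<Rightarrow> ('a \<Rightarrow> 'a) \<Rightarrow> 'e set" where
  "cartan_p G \<theta> = {X. diff_one G \<theta> X = - X}"

text \<open>A Cartan involution of \<open>G\<close> is an involutive automorphism of the Lie group \<open>G\<close> whose
  group of fixed points is the maximal compact subgroup \<open>K\<close> (Harish-Chandra's definition).
  The assumption \<open>form_theta\<close> expresses that \<open>-B(X, \<theta>Y)\<close> is symmetric,
  hence an inner product.\<close>

locale reductive_group_with_cartan = harish_chandra_class G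
  for G :: "('a, 'e::real_normed_vector, 'm) lie_group_scheme" (structure) +
  fixes K :: "'a set" and \<theta> :: "'a \<Rightarrow> 'a" and B :: "'e \<Rightarrow> 'e \<Rightarrow> real"
  assumes K: "maximal_compact_subgroup G K"
    and theta_hom: "\<theta> \<in> hom G G"
    and theta_smooth: "smooth_map (atlas G) (atlas G) \<theta>"
    and theta_involutive: "x \<in> carrier G \<Longrightarrow> \<theta> (\<theta> x) = x"
    and theta_fixed: "{x \<in> carrier G. \<theta> x = x} = K"
    and form_bilinear: "bilinear B"
    and form_symmetric: "B X Y = B Y X"
    and form_nondegenerate: "(\<And>Y. B X Y = 0) \<Longrightarrow> X = 0"
    and form_Ad: "x \<in> carrier G \<Longrightarrow> B (Ad G x X) (Ad G x Y) = B X Y"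
    and form_theta: "B (diff_one G \<theta> X) (diff_one G \<theta> Y) = B X Y"
    and form_negative: "X \<in> cartan_k G \<theta> \<Longrightarrow> X \<noteq> 0 \<Longrightarrow> B X X < 0"
    and form_positive: "X \<in> cartan_p G \<theta> \<Longrightarrow> X \<noteq> 0 \<Longrightarrow> B X X > 0"
    and form_killing: "X \<in> derived_algebra G \<Longrightarrow> Y \<in> derived_algebra G \<Longrightarrow>
      B X Y = killing_form G X Y"

definition cartan_norm ::
  "('a, 'e::real_normed_vector, 'm) lie_group_scheme \<Rightarrow> ('a \<Rightarrow> 'a) \<Rightarrow> ('e \<Rightarrow> 'e \<Rightarrow> real) \<Rightarrow>
    'e \<Rightarrow> real" where
  "cartan_norm G \<theta> B X = sqrt (- B X (diff_one G \<theta> X))"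

definition maximal_abelian_in ::
  "('a, 'e::real_normed_vector, 'm) lie_group_scheme \<Rightarrow> 'e set \<Rightarrow> 'e set \<Rightarrow> bool" where
  "maximal_abelian_in G p a \<longleftrightarrow>
     (let abelian = (\<lambda>b. subspace b \<and> (\<forall>X\<in>b. \<forall>Y\<in>b. bracket G X Y = 0)) in
        abelian a \<and> a \<subseteq> p \<and> (\<forall>b. abelian b \<and> a \<subseteq> b \<and> b \<subseteq> p \<longrightarrow> b = a))"

text \<open>Elements of the dual of a subspace are encoded as extensional functions on it.\<close>

definition dual_on :: "'e::real_vector set \<Rightarrow> ('e \<Rightarrow> real) set" where
  "dual_on a = {restrict f a | f. linear f}"

definition root_space ::
  "('a, 'e::real_normed_vector, 'm) lie_group_scheme \<Rightarrow> 'e set \<Rightarrow> ('e \<Rightarrow> real) \<Rightarrow> 'e set" where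
  "root_space G a \<alpha> = {X. \<forall>H\<in>a. bracket G H X = \<alpha> H *\<^sub>R X}"

definition restricted_roots ::
  "('a, 'e::real_normed_vector, 'm) lie_group_scheme \<Rightarrow> 'e set \<Rightarrow> ('e \<Rightarrow> real) set" where
  "restricted_roots G a =
     {\<alpha> \<in> dual_on a. (\<exists>H\<in>a. \<alpha> H \<noteq> 0) \<and> root_space G a \<alpha> \<noteq> {0}}"

definition positive_system :: "'e set \<Rightarrow> ('e \<Rightarrow> real) set \<Rightarrow> ('e \<Rightarrow> real) set \<Rightarrow> bool" where
  "positive_system a R P \<longleftrightarrow>
     (\<exists>H\<in>a. (\<forall>\<alpha>\<in>R. \<alpha> H \<noteq> 0) \<and> P = {\<alpha> \<in> R. \<alpha> H > 0})"

definition simple_roots :: "'e set \<Rightarrow> ('e \<Rightarrow> real) set \<Rightarrow> ('e \<Rightarrow> real) set" where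
  "simple_roots a P = {\<alpha> \<in> P. \<not> (\<exists>\<beta>\<in>P. \<exists>\<gamma>\<in>P. \<forall>H\<in>a. \<alpha> H = \<beta> H + \<gamma> H)}"

definition positive_chamber :: "'e set \<Rightarrow> ('e \<Rightarrow> real) set \<Rightarrow> 'e set" where
  "positive_chamber a P = {H \<in> a. \<forall>\<alpha>\<in>simple_roots a P. \<alpha> H > 0}"

definition iwasawa_n ::
  "('a, 'e::real_normed_vector, 'm) lie_group_scheme \<Rightarrow> 'e set \<Rightarrow> ('e \<Rightarrow> real) set \<Rightarrow> 'e set" where
  "iwasawa_n G a P = span (\<Union>\<alpha>\<in>P. root_space G a \<alpha>)"

text \<open>An Iwasawa decomposition \<open>G = K A N\<^sub>0\<close> amounts to the choice of \<open>a\<close> and of the positive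
  system \<open>P\<close>; then \<open>A = exp a\<close> and \<open>N\<^sub>0\<close> is the following group.\<close>

locale iwasawa = reductive_group_with_cartan G K \<theta> B
  for G :: "('a, 'e::real_normed_vector, 'm) lie_group_scheme" (structure)
    and K :: "'a set" and \<theta> :: "'a \<Rightarrow> 'a" and B :: "'e \<Rightarrow> 'e \<Rightarrow> real" +
  fixes a :: "'e set" and P :: "('e \<Rightarrow> real) set"
  assumes a: "maximal_abelian_in G (cartan_p G \<theta>) a"
    and P: "positive_system a (restricted_roots G a) P"

definition iwasawa_N ::
  "('a, 'e::real_normed_vector, 'm) lie_group_scheme \<Rightarrow> 'e set \<Rightarrow> ('e \<Rightarrow> real) set \<Rightarrow> 'a set" where
  "iwasawa_N G a P = analytic_subgroup G (iwasawa_n G a P)"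

definition lie_log ::
  "('a, 'e::real_normed_vector, 'm) lie_group_scheme \<Rightarrow> 'e set \<Rightarrow> 'a \<Rightarrow> 'e" where
  "lie_log G a = inv_into a (lie_exp G)"

definition unitary_character ::
  "('a, 'e, 'm) lie_group_scheme \<Rightarrow> 'a set \<Rightarrow> ('a \<Rightarrow> complex) \<Rightarrow> bool" where
  "unitary_character G N \<psi> \<longleftrightarrow>
     (\<forall>x\<in>N. norm (\<psi> x) = 1) \<and> (\<forall>x\<in>N. \<forall>y\<in>N. \<psi> (x \<otimes>\<^bsub>G\<^esub> y) = \<psi> x * \<psi> y) \<and>
     continuous_map (subtopology (lie_topology G) N) euclidean \<psi>"

definition character_derivative ::
  "('a, 'e::real_normed_vector, 'm) lie_group_scheme \<Rightarrow> ('a \<Rightarrow> complex) \<Rightarrow> 'e \<Rightarrow> complex" where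
  "character_derivative G \<psi> X = vector_derivative (\<lambda>t. \<psi> (lie_exp G (t *\<^sub>R X))) (at 0)"

definition regular_character :: "('a, 'e::real_normed_vector, 'm) lie_group_scheme \<Rightarrow>
    'e set \<Rightarrow> ('e \<Rightarrow> real) set \<Rightarrow> ('a \<Rightarrow> complex) \<Rightarrow> bool" where
  "regular_character G a P \<psi> \<longleftrightarrow>
     (\<forall>\<alpha>\<in>simple_roots a P. \<exists>X\<in>root_space G a \<alpha>. character_derivative G \<psi> X \<noteq> 0)"

section \<open>Hilbert space representations\<close>

text \<open>The inner product is linear in the first argument.\<close>

class complex_hilbert_space = banach +
  fixes scaleC :: "complex \<Rightarrow> 'a \<Rightarrow> 'a" (infixr "*\<^sub>C" 75)
    and cinner :: "'a \<Rightarrow> 'a \<Rightarrow> complex"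
  assumes scaleC_add_right: "c *\<^sub>C (x + y) = c *\<^sub>C x + c *\<^sub>C y"
    and scaleC_add_left: "(c + d) *\<^sub>C x = c *\<^sub>C x + d *\<^sub>C x"
    and scaleC_scaleC: "c *\<^sub>C (d *\<^sub>C x) = (c * d) *\<^sub>C x"
    and scaleR_scaleC: "r *\<^sub>R x = of_real r *\<^sub>C x"
    and cinner_commute: "cinner x y = cnj (cinner y x)"
    and cinner_add_left: "cinner (x + y) z = cinner x z + cinner y z"
    and cinner_scaleC_left: "cinner (c *\<^sub>C x) y = c * cinner x y"
    and norm_eq_sqrt_cinner: "norm x = sqrt (Re (cinner x x))"

definition complex_subspace :: "'h::complex_hilbert_space set \<Rightarrow> bool" where
  "complex_subspace W \<longleftrightarrow>
     0 \<in> W \<and> (\<forall>x\<in>W. \<forall>y\<in>W. x + y \<in> W) \<and> (\<forall>c. \<forall>x\<in>W. c *\<^sub>C x \<in> W)"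

text \<open>For complex subspaces, being finite-dimensional over the reals and over the complex
  numbers is the same.\<close>

definition finite_dimensional_set :: "'h::real_vector set \<Rightarrow> bool" where
  "finite_dimensional_set W \<longleftrightarrow> (\<exists>S. finite S \<and> W \<subseteq> span S)"

definition continuous_rep ::
  "('a, 'e, 'm) lie_group_scheme \<Rightarrow> ('a \<Rightarrow> 'h::complex_hilbert_space \<Rightarrow> 'h) \<Rightarrow> bool" where
  "continuous_rep G \<pi> \<longleftrightarrow>
     (\<forall>x\<in>carrier G. (\<forall>v w. \<pi> x (v + w) = \<pi> x v + \<pi> x w) \<and> (\<forall>c v. \<pi> x (c *\<^sub>C v) = c *\<^sub>C \<pi> x v)) \<and>
     (\<forall>v. \<pi> \<one>\<^bsub>G\<^esub> v = v) \<and>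
     (\<forall>x\<in>carrier G. \<forall>y\<in>carrier G. \<forall>v. \<pi> (x \<otimes>\<^bsub>G\<^esub> y) v = \<pi> x (\<pi> y v)) \<and>
     continuous_map (prod_topology (lie_topology G) euclidean) euclidean (\<lambda>(x, v). \<pi> x v)"

definition invariant_subspace ::
  "'a set \<Rightarrow> ('a \<Rightarrow> 'h::complex_hilbert_space \<Rightarrow> 'h) \<Rightarrow> 'h set \<Rightarrow> bool" where
  "invariant_subspace L \<pi> W \<longleftrightarrow> complex_subspace W \<and> (\<forall>x\<in>L. \<pi> x ` W \<subseteq> W)"

definition irreducible_finite_dimensional ::
  "'a set \<Rightarrow> ('a \<Rightarrow> 'h::complex_hilbert_space \<Rightarrow> 'h) \<Rightarrow> 'h set \<Rightarrow> bool" where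
  "irreducible_finite_dimensional K \<pi> V \<longleftrightarrow>
     invariant_subspace K \<pi> V \<and> finite_dimensional_set V \<and> V \<noteq> {0} \<and>
     (\<forall>W. invariant_subspace K \<pi> W \<and> W \<subseteq> V \<longrightarrow> W = {0} \<or> W = V)"

definition equivalent_subreps ::
  "'a set \<Rightarrow> ('a \<Rightarrow> 'h::complex_hilbert_space \<Rightarrow> 'h) \<Rightarrow> 'h set \<Rightarrow> 'h set \<Rightarrow> bool" where
  "equivalent_subreps K \<pi> V W \<longleftrightarrow>
     (\<exists>f. bij_betw f V W \<and> (\<forall>v\<in>V. \<forall>w\<in>V. f (v + w) = f v + f w) \<and>
        (\<forall>c. \<forall>v\<in>V. f (c *\<^sub>C v) = c *\<^sub>C f v) \<and> (\<forall>k\<in>K. \<forall>v\<in>V. f (\<pi> k v) = \<pi> k (f v)))"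

definition isotypic_component ::
  "'a set \<Rightarrow> ('a \<Rightarrow> 'h::complex_hilbert_space \<Rightarrow> 'h) \<Rightarrow> 'h set \<Rightarrow> 'h set" where
  "isotypic_component K \<pi> V =
     span (\<Union>{W. irreducible_finite_dimensional K \<pi> W \<and> equivalent_subreps K \<pi> V W})"

text \<open>Every \<open>K\<close>-type has finite multiplicity. It suffices to consider the \<open>K\<close>-types that
  occur, and these are represented by subspaces \<open>V\<close>.\<close>

definition admissible :: "'a set \<Rightarrow> ('a \<Rightarrow> 'h::complex_hilbert_space \<Rightarrow> 'h) \<Rightarrow> bool" where
  "admissible K \<pi> \<longleftrightarrow>
     (\<forall>V. irreducible_finite_dimensional K \<pi> V \<longrightarrow>
        finite_dimensional_set (isotypic_component K \<pi> V))"

text \<open>A finite chain of closed invariant subspaces with topologically irreducible quotients.\<close>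

definition finite_length ::
  "('a, 'm) monoid_scheme \<Rightarrow> ('a \<Rightarrow> 'h::complex_hilbert_space \<Rightarrow> 'h) \<Rightarrow> bool" where
  "finite_length G \<pi> \<longleftrightarrow>
     (let closed_invariant = (\<lambda>W. closed W \<and> invariant_subspace (carrier G) \<pi> W) in
        \<exists>l (F :: nat \<Rightarrow> 'h set). F 0 = {0} \<and> F l = UNIV \<and> (\<forall>i\<le>l. closed_invariant (F i)) \<and>
          (\<forall>i<l. F i \<subset> F (Suc i) \<and>
             \<not> (\<exists>W. closed_invariant W \<and> F i \<subset> W \<and> W \<subset> F (Suc i))))"

section \<open>Smooth vectors and Whittaker functionals\<close>

definition smooth_vectors :: "('a, 'e::real_normed_vector, 'm) lie_group_scheme \<Rightarrow>
    ('a \<Rightarrow> 'h::complex_hilbert_space \<Rightarrow> 'h) \<Rightarrow> 'h set" where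
  "smooth_vectors G \<pi> = {v. smooth_map (atlas G) {(UNIV, \<lambda>w. w)} (\<lambda>x. \<pi> x v)}"

definition derived_rep :: "('a, 'e::real_normed_vector, 'm) lie_group_scheme \<Rightarrow>
    ('a \<Rightarrow> 'h::complex_hilbert_space \<Rightarrow> 'h) \<Rightarrow> 'e \<Rightarrow> 'h \<Rightarrow> 'h" where
  "derived_rep G \<pi> X v = vector_derivative (\<lambda>t. \<pi> (lie_exp G (t *\<^sub>R X)) v) (at 0)"

text \<open>The Frechet topology of the space of smooth vectors, defined by the seminorms
  \<open>v \<mapsto> \<parallel>d\<pi>(X\<^sub>1) \<dots> d\<pi>(X\<^sub>k) v\<parallel>\<close>; its underlying set is \<open>smooth_vectors G \<pi>\<close>.\<close>

definition smooth_topology :: "('a, 'e::real_normed_vector, 'm) lie_group_scheme \<Rightarrow>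
    ('a \<Rightarrow> 'h::complex_hilbert_space \<Rightarrow> 'h) \<Rightarrow> 'h topology" where
  "smooth_topology G \<pi> = topology_generated_by
     {{w \<in> smooth_vectors G \<pi>. norm (foldr (derived_rep G \<pi>) Xs (w - v)) < \<epsilon>} | Xs v \<epsilon>.
        v \<in> smooth_vectors G \<pi> \<and> \<epsilon> > 0}"

definition continuous_seminorm :: "('a, 'e::real_normed_vector, 'm) lie_group_scheme \<Rightarrow>
    ('a \<Rightarrow> 'h::complex_hilbert_space \<Rightarrow> 'h) \<Rightarrow> ('h \<Rightarrow> real) \<Rightarrow> bool" where
  "continuous_seminorm G \<pi> q \<longleftrightarrow>
     (\<forall>v\<in>smooth_vectors G \<pi>. q v \<ge> 0 \<and> (\<forall>c. q (c *\<^sub>C v) = norm c * q v) \<and>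
        (\<forall>w\<in>smooth_vectors G \<pi>. q (v + w) \<le> q v + q w)) \<and>
     continuous_map (smooth_topology G \<pi>) euclideanreal q"

text \<open>Functionals on smooth vectors are functions on \<open>'h\<close> of which only the
  restriction to \<open>smooth_vectors G \<pi>\<close> matters.\<close>

definition whittaker_functionals :: "('a, 'e::real_normed_vector, 'm) lie_group_scheme \<Rightarrow>
    'a set \<Rightarrow> ('a \<Rightarrow> complex) \<Rightarrow> ('a \<Rightarrow> 'h::complex_hilbert_space \<Rightarrow> 'h) \<Rightarrow> ('h \<Rightarrow> complex) set" where
  "whittaker_functionals G N \<psi> \<pi> =
     {l. (\<forall>v\<in>smooth_vectors G \<pi>. (\<forall>w\<in>smooth_vectors G \<pi>. l (v + w) = l v + l w) \<and>
            (\<forall>c. l (c *\<^sub>C v) = c * l v) \<and> (\<forall>x\<in>N. l (\<pi> x v) = \<psi> x * l v)) \<and>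
          continuous_map (smooth_topology G \<pi>) euclidean l}"

definition whittaker_coefficient :: "('a, 'm) monoid_scheme \<Rightarrow>
    ('a \<Rightarrow> 'h::complex_hilbert_space \<Rightarrow> 'h) \<Rightarrow> ('h \<Rightarrow> complex) \<Rightarrow> 'h \<Rightarrow> 'a \<Rightarrow> complex" where
  "whittaker_coefficient G \<pi> l v x = l (\<pi> (inv\<^bsub>G\<^esub> x) v)"

end

theory Submission
  imports Defs
begin

text \<open>
Let \<open>X\<close> be a root vector for a simple root \<open>\<alpha>\<close> on which the derivative \<open>d\<psi>\<close> of the character is not
zero, and let \<open>g = exp H\<close> with \<open>H \<in> a\<close>. A Whittaker functional \<open>l\<close> turns \<open>d\<pi>(X)\<close> into multiplication
by \<open>d\<psi>(X)\<close> (\<open>whittaker_functional_derived_rep\<close>). On the other hand \<open>X\<close> is an eigenvector of \<open>Ad(g)\<close>,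
so that \<open>d\<pi>(X) \<pi>(g)\<inverse> = e\<^bsup>\<alpha>(H)\<^esup> \<pi>(g)\<inverse> d\<pi>(X)\<close>. Comparing the two and iterating gives
\<open>l(\<pi>(g)\<inverse>u) = (e\<^bsup>\<alpha>(H)\<^esup> / d\<psi>(X))\<^sup>m l(\<pi>(g)\<inverse> d\<pi>(X)\<^sup>m u)\<close> for all \<open>m\<close> (\<open>whittaker_root_iteration\<close>).

The functional \<open>l\<close> is bounded by a seminorm of some order \<open>N\<close>, and the operators \<open>\<pi>(g)\<close> and \<open>Ad(g)\<close>
grow at most exponentially in \<open>H\<close>. Hence \<open>l(\<pi>(g)\<inverse>w)\<close> is bounded by \<open>e\<^bsup>\<kappa>|H|\<^esup>\<close> times a seminorm of
\<open>w\<close>, with a rate \<open>\<kappa>\<close> that depends on \<open>N\<close> but not on \<open>w\<close> (\<open>seminorm_a_growth\<close>). An element of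
\<open>\<Gamma>\<close> other than \<open>0\<close> lies outside the closed chamber, so that some simple root is negative on it, and
by compactness of the unit sphere of \<open>\<Gamma>\<close> one of finitely many simple roots satisfies
\<open>\<alpha>(H) \<le> -\<delta>|H|\<close> (\<open>cone_negative_roots\<close>). With \<open>m\<delta> \<ge> \<kappa> + s\<close>, up to the comparison of norms, the
factor \<open>e\<^bsup>m\<alpha>(H)\<^esup>\<close> absorbs the growth and leaves the decay \<open>e\<^bsup>-s|H|\<^esup>\<close>. The elements of \<open>K\<close> only
change the seminorm by a constant, since \<open>K\<close> is compact.

Three things underlie this argument. First, one-parameter subgroups exist and are unique, which
is the content of the ordinary differential equation for left-invariant vector fields
(\<open>one_parameter_subgroup_exists\<close>, \<open>one_parameter_subgroup_unique\<close>). Second,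
\<open>t \<mapsto> l(\<pi>(exp tX)w)\<close> has the derivative \<open>l(d\<pi>(X)w)\<close> at \<open>0\<close>, where \<open>l\<close> is continuous only for the
topology of the smooth vectors; this rests on the closedness of the operators \<open>d\<pi>(Y)\<close>
(\<open>has_vector_derivative_foldr_rep\<close>). Third, the logarithm on \<open>A\<close> is well defined: an
element \<open>Z\<close> of \<open>\<pp>\<close> with \<open>exp Z = 1\<close> would generate a compact torus that enlarges \<open>K\<close>, unless \<open>Z = 0\<close>
(\<open>exp_p_trivial\<close>).
\<close>

section \<open>Finite-dimensional normed spaces\<close>

text \<open>The type of the model space is not an instance of \<open>euclidean_space\<close>. The facts about
  finite-dimensional spaces are therefore derived from coordinates in a chosen basis.\<close>

definition fin_basis :: "'e::real_vector set" where
  "fin_basis = (SOME S. finite S \<and> independent S \<and> span S = UNIV)"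

definition coord :: "'e::real_vector \<Rightarrow> 'e \<Rightarrow> real" where
  "coord b x = representation fin_basis x b"

lemma fin_basis:
  assumes "finite_dimensional_set (UNIV :: 'e::real_vector set)"
  shows "finite (fin_basis :: 'e set)" "independent (fin_basis :: 'e set)"
    "span (fin_basis :: 'e set) = UNIV"
proof -
  obtain S :: "'e set" where S: "finite S" "span S = UNIV"
    using assms by (auto simp: finite_dimensional_set_def)
  obtain B :: "'e set" where B: "B \<subseteq> S" "independent B" "S \<subseteq> span B"
    using maximal_independent_subset[of S] by blast
  have "finite B \<and> independent B \<and> span B = UNIV"
    using S B by (metis finite_subset span_mono span_span top.extremum_uniqueI)
  from someI[of "\<lambda>S. finite S \<and> independent S \<and> span S = UNIV", OF this]
  show "finite (fin_basis :: 'e set)" "independent (fin_basis :: 'e set)"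
    "span (fin_basis :: 'e set) = UNIV"
    by (auto simp: fin_basis_def)
qed

lemma linear_coord:
  assumes "finite_dimensional_set (UNIV :: 'e::real_vector set)"
  shows "linear (coord (b :: 'e))"
  using fin_basis[OF assms]
  by (intro linearI) (simp_all add: coord_def representation_add representation_scale)

lemma sum_coord:
  assumes "finite_dimensional_set (UNIV :: 'e::real_vector set)"
  shows "(\<Sum>b\<in>fin_basis. coord b x *\<^sub>R b) = (x :: 'e)"
  using fin_basis[OF assms] by (simp add: coord_def sum_representation_eq)

text \<open>The distance of a new basis vector to the span of the previous ones is positive
  because that span is closed, and it is closed because the bound for the previous ones
  makes the coefficients of a convergent sequence Cauchy.\<close>

lemma independent_coefficients_bounded:
  fixes S :: "'e::real_normed_vector set"
  assumes "finite S" "independent S"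
  shows "\<exists>C>0. \<forall>c. \<forall>b\<in>S. \<bar>c b\<bar> \<le> C * norm (\<Sum>d\<in>S. c d *\<^sub>R d)"
  using assms
proof (induction S rule: finite_induct)
  case empty
  show ?case by (intro exI[of _ 1]) auto
next
  case (insert b S)
  then have ind: "independent S" and b: "b \<notin> span S"
    by (auto simp: independent_insert)
  from insert.IH[OF ind] obtain C where C: "C > 0"
    "\<And>c d. d \<in> S \<Longrightarrow> \<bar>c d\<bar> \<le> C * norm (\<Sum>d\<in>S. c d *\<^sub>R d)" by blast
  have fin: "finite S" by fact
  have "closed (span S)"
  proof (rule closed_sequential_limits[THEN iffD2], intro allI impI, elim conjE)
    fix x l assume x: "\<forall>n. x n \<in> span S" and l: "x \<longlonglongrightarrow> l"
    have "\<exists>c. (\<Sum>d\<in>S. c d *\<^sub>R d) = x n" for n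
    proof -
      have "x n \<in> range (\<lambda>u. \<Sum>v\<in>S. u v *\<^sub>R v)" using x span_finite[OF fin] by auto
      then obtain c where "x n = (\<Sum>v\<in>S. c v *\<^sub>R v)" by blast
      then show ?thesis by (intro exI[of _ c]) simp
    qed
    then obtain c where c: "\<And>n. (\<Sum>d\<in>S. c n d *\<^sub>R d) = x n" by metis
    have cauchy: "Cauchy (\<lambda>n. c n d)" if d: "d \<in> S" for d
    proof (rule metric_CauchyI)
      fix e :: real assume "e > 0"
      then have "e / C > 0" using C by simp
      then obtain M where M: "\<And>m n. m \<ge> M \<Longrightarrow> n \<ge> M \<Longrightarrow> dist (x m) (x n) < e / C"
        using LIMSEQ_imp_Cauchy[OF l] unfolding Cauchy_def by metis
      have "dist (c m d) (c n d) < e" if "m \<ge> M" "n \<ge> M" for m n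
      proof -
        have "\<bar>c m d - c n d\<bar> \<le> C * norm (\<Sum>d\<in>S. (c m d - c n d) *\<^sub>R d)"
          using C(2)[OF d, of "\<lambda>d. c m d - c n d"] .
        also have "(\<Sum>d\<in>S. (c m d - c n d) *\<^sub>R d) = x m - x n"
          by (simp add: c[symmetric] scaleR_left_diff_distrib sum_subtractf)
        also have "C * norm (x m - x n) < e"
          using M[OF that] C(1) by (simp add: dist_norm field_simps)
        finally show ?thesis by (simp add: dist_real_def)
      qed
      then show "\<exists>M. \<forall>m\<ge>M. \<forall>n\<ge>M. dist (c m d) (c n d) < e" by blast
    qed
    define L where "L d = lim (\<lambda>n. c n d)" for d
    have "(\<lambda>n. c n d) \<longlonglongrightarrow> L d" if "d \<in> S" for d
      unfolding L_def using Cauchy_convergent[OF cauchy[OF that]] by (simp add: convergent_LIMSEQ_iff)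
    then have "(\<lambda>n. \<Sum>d\<in>S. c n d *\<^sub>R d) \<longlonglongrightarrow> (\<Sum>d\<in>S. L d *\<^sub>R d)"
      by (intro tendsto_sum tendsto_scaleR tendsto_const)
    then have "l = (\<Sum>d\<in>S. L d *\<^sub>R d)"
      using LIMSEQ_unique[OF l] c by simp
    then show "l \<in> span S"
      by (simp add: span_sum span_scale span_base)
  qed
  then have "open (- span S)" by (simp add: closed_def)
  with b obtain r where r: "r > 0" "\<And>y. dist b y < r \<Longrightarrow> y \<notin> span S"
    by (metis ComplD ComplI open_contains_ball mem_ball subset_iff)
  have head: "\<bar>c b\<bar> * r \<le> norm (\<Sum>d\<in>insert b S. c d *\<^sub>R d)" for c
  proof (cases "c b = 0")
    case False
    define y where "y = (\<Sum>d\<in>S. c d *\<^sub>R d)"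
    have "y \<in> span S" unfolding y_def by (simp add: span_sum span_scale span_base)
    then have "(- inverse (c b)) *\<^sub>R y \<in> span S" by (simp add: span_scale span_neg)
    then have "r \<le> dist b ((- inverse (c b)) *\<^sub>R y)" using r by force
    then have "\<bar>c b\<bar> * r \<le> \<bar>c b\<bar> * norm (b + inverse (c b) *\<^sub>R y)"
      by (simp add: dist_norm mult_left_mono)
    also have "\<dots> = norm (c b *\<^sub>R (b + inverse (c b) *\<^sub>R y))" by simp
    also have "c b *\<^sub>R (b + inverse (c b) *\<^sub>R y) = c b *\<^sub>R b + y"
      using False by (simp add: scaleR_right_distrib)
    finally show ?thesis
      using insert.hyps by (simp add: y_def)
  qed (simp add: \<open>r > 0\<close>)
  define D where "D = max (1 / r) (C * (1 + norm b / r))"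
  have "D > 0" using r by (simp add: D_def less_max_iff_disj)
  moreover have "\<bar>c d\<bar> \<le> D * norm (\<Sum>d\<in>insert b S. c d *\<^sub>R d)" if "d \<in> insert b S" for c d
  proof -
    let ?N = "norm (\<Sum>d\<in>insert b S. c d *\<^sub>R d)"
    have hb: "\<bar>c b\<bar> \<le> ?N / r" using head[of c] r by (simp add: field_simps)
    show ?thesis
    proof (cases "d = b")
      case True
      have "?N / r = 1 / r * ?N" by simp
      also have "\<dots> \<le> D * ?N" unfolding D_def by (intro mult_right_mono) auto
      finally show ?thesis using True hb by simp
    next
      case False
      then have "\<bar>c d\<bar> \<le> C * norm (\<Sum>d\<in>S. c d *\<^sub>R d)" using that C by auto
      also have "(\<Sum>d\<in>S. c d *\<^sub>R d) = (\<Sum>d\<in>insert b S. c d *\<^sub>R d) - c b *\<^sub>R b"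
        using insert.hyps by simp
      also have "norm \<dots> \<le> ?N + \<bar>c b\<bar> * norm b"
        using norm_triangle_ineq4[of _ "c b *\<^sub>R b"] by simp
      also have "\<dots> \<le> ?N + ?N / r * norm b"
        using hb by (intro add_left_mono mult_right_mono) auto
      also have "C * \<dots> = C * (1 + norm b / r) * ?N" by (simp add: field_simps)
      also have "\<dots> \<le> D * ?N" unfolding D_def by (intro mult_right_mono) auto
      finally show ?thesis using C by (simp add: mult_left_mono)
    qed
  qed
  ultimately show ?case by blast
qed

lemma coord_le:
  assumes "finite_dimensional_set (UNIV :: 'e::real_normed_vector set)"
  obtains C where "C > 0" "\<And>b x. b \<in> fin_basis \<Longrightarrow> \<bar>coord b (x :: 'e)\<bar> \<le> C * norm x"
proof -
  obtain C where C: "C > 0"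
    "\<And>c b. b \<in> (fin_basis :: 'e set) \<Longrightarrow> \<bar>c b\<bar> \<le> C * norm (\<Sum>d\<in>fin_basis. c d *\<^sub>R d)"
    using independent_coefficients_bounded[OF fin_basis(1,2)[OF assms]] by blast
  have "\<bar>coord b x\<bar> \<le> C * norm x" if "b \<in> fin_basis" for b x :: 'e
    using C(2)[OF that, of "\<lambda>b. coord b x"] by (simp add: sum_coord[OF assms])
  with C(1) show ?thesis using that by blast
qed

lemma linear_eq_sum_coord:
  assumes "finite_dimensional_set (UNIV :: 'e::real_vector set)" and "linear f"
  shows "f (x :: 'e) = (\<Sum>b\<in>fin_basis. coord b x *\<^sub>R f b)"
proof -
  have "f x = f (\<Sum>b\<in>fin_basis. coord b x *\<^sub>R b)" by (simp add: sum_coord[OF assms(1)])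
  then show ?thesis by (simp add: linear_sum[OF assms(2)] linear_scale[OF assms(2)])
qed

lemma bounded_linear_fin_dim:
  fixes f :: "'e::real_normed_vector \<Rightarrow> 'f::real_normed_vector"
  assumes "finite_dimensional_set (UNIV :: 'e set)" and "linear f"
  shows "bounded_linear f"
proof -
  obtain C where C: "C > 0" "\<And>b x. b \<in> fin_basis \<Longrightarrow> \<bar>coord b (x :: 'e)\<bar> \<le> C * norm x"
    using coord_le[OF assms(1)] by blast
  have "norm (f x) \<le> norm x * (C * (\<Sum>b\<in>fin_basis. norm (f b)))" for x
  proof -
    have "norm (f x) \<le> (\<Sum>b\<in>fin_basis. norm (coord b x *\<^sub>R f b))"
      unfolding linear_eq_sum_coord[OF assms, of x] by (rule norm_sum)
    also have "\<dots> \<le> (\<Sum>b\<in>fin_basis. C * norm x * norm (f b))"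
      by (intro sum_mono) (simp add: C(2) mult_right_mono)
    finally show ?thesis by (simp add: sum_distrib_left algebra_simps)
  qed
  then show ?thesis
    using assms(2) by (intro bounded_linear_intro[where K = "C * (\<Sum>b\<in>fin_basis. norm (f b))"])
      (auto simp: linear_add linear_scale)
qed

lemma bounded_linear_coord:
  assumes "finite_dimensional_set (UNIV :: 'e::real_normed_vector set)"
  shows "bounded_linear (coord (b :: 'e))"
  using bounded_linear_fin_dim[OF assms linear_coord[OF assms]] .

lemma bilinear_bounded_fin_dim:
  fixes B :: "'e::real_normed_vector \<Rightarrow> 'e \<Rightarrow> 'f::real_normed_vector"
  assumes fd: "finite_dimensional_set (UNIV :: 'e set)" and "bilinear B"
  shows "\<exists>M\<ge>0. \<forall>x y. norm (B x y) \<le> M * norm x * norm y"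
proof -
  obtain C where C: "C > 0" "\<And>b x. b \<in> fin_basis \<Longrightarrow> \<bar>coord b (x :: 'e)\<bar> \<le> C * norm x"
    using coord_le[OF fd] by blast
  have lin: "linear (B x)" "linear (\<lambda>x. B x y)" for x y
    using assms(2) by (auto simp: bilinear_def)
  define S where "S = (\<Sum>b\<in>(fin_basis :: 'e set). \<Sum>d\<in>(fin_basis :: 'e set). norm (B b d))"
  have "norm (B x y) \<le> C * C * S * norm x * norm y" for x y
  proof -
    have "B x y = (\<Sum>b\<in>fin_basis. coord b x *\<^sub>R (\<Sum>d\<in>fin_basis. coord d y *\<^sub>R B b d))"
      by (subst linear_eq_sum_coord[OF fd lin(2)], subst linear_eq_sum_coord[OF fd lin(1)]) (rule refl)
    also have "norm \<dots> \<le> (\<Sum>b\<in>fin_basis. (C * norm x) * (\<Sum>d\<in>fin_basis. (C * norm y) * norm (B b d)))"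
    proof (rule sum_norm_le)
      fix b :: 'e assume b: "b \<in> fin_basis"
      have "norm (\<Sum>d\<in>fin_basis. coord d y *\<^sub>R B b d) \<le> (\<Sum>d\<in>fin_basis. (C * norm y) * norm (B b d))"
        by (rule sum_norm_le) (simp add: C(2) mult_right_mono)
      then show "norm (coord b x *\<^sub>R (\<Sum>d\<in>fin_basis. coord d y *\<^sub>R B b d))
          \<le> (C * norm x) * (\<Sum>d\<in>fin_basis. (C * norm y) * norm (B b d))"
        unfolding norm_scaleR using C(1) by (intro mult_mono C(2)[OF b]) auto
    qed
    also have "\<dots> = C * C * S * norm x * norm y"
      by (simp add: S_def sum_distrib_left algebra_simps)
    finally show ?thesis .
  qed
  moreover have "0 \<le> C * C * S" using C by (simp add: S_def sum_nonneg)
  ultimately show ?thesis by blast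
qed

lemma compact_fin_dim:
  fixes S :: "'e::real_normed_vector set"
  assumes fd: "finite_dimensional_set (UNIV :: 'e set)" and "bounded S" "closed S"
  shows "compact S"
proof -
  obtain C where C: "C > 0" "\<And>b x. b \<in> fin_basis \<Longrightarrow> \<bar>coord b (x :: 'e)\<bar> \<le> C * norm x"
    using coord_le[OF fd] by blast
  obtain M where M: "\<And>x. x \<in> S \<Longrightarrow> norm x \<le> M"
    using \<open>bounded S\<close> by (auto simp: bounded_iff)
  define R where "R = C * M"
  have box: "compact {\<Sum>b\<in>F. c b *\<^sub>R b | c. \<forall>b\<in>F. \<bar>c b\<bar> \<le> R}" if "finite F" for F :: "'e set"
    using that
  proof (induction F rule: finite_induct)
    case empty
    then show ?case by simp
  next
    case (insert b F)
    have "compact ((\<lambda>t. t *\<^sub>R b) ` {-R..R})"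
      by (intro compact_continuous_image continuous_intros) auto
    from compact_sums[OF this insert.IH]
    have "compact {x + y |x y. x \<in> (\<lambda>t. t *\<^sub>R b) ` {-R..R} \<and>
        y \<in> {\<Sum>b\<in>F. c b *\<^sub>R b | c. \<forall>b\<in>F. \<bar>c b\<bar> \<le> R}}" .
    also have "\<dots> = {\<Sum>b\<in>insert b F. c b *\<^sub>R b | c. \<forall>b\<in>insert b F. \<bar>c b\<bar> \<le> R}" (is "?X = ?Y")
    proof (intro subset_antisym subsetI)
      fix z assume "z \<in> ?X"
      then obtain t c where "t \<in> {-R..R}" and c: "\<forall>b\<in>F. \<bar>c b\<bar> \<le> R" and
        z: "z = t *\<^sub>R b + (\<Sum>b\<in>F. c b *\<^sub>R b)"
        by blast
      then have tc: "\<bar>t\<bar> \<le> R" "\<forall>b\<in>F. \<bar>c b\<bar> \<le> R" "z = t *\<^sub>R b + (\<Sum>b\<in>F. c b *\<^sub>R b)"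
        by auto
      have "(\<Sum>d\<in>F. (c(b := t)) d *\<^sub>R d) = (\<Sum>d\<in>F. c d *\<^sub>R d)"
        using insert.hyps by (intro sum.cong) auto
      then have "z = (\<Sum>d\<in>insert b F. (c(b := t)) d *\<^sub>R d)"
        using insert.hyps tc by simp
      then show "z \<in> ?Y" using tc by (intro CollectI exI[of _ "c(b := t)"]) auto
    next
      fix z assume "z \<in> ?Y"
      then obtain c where "\<forall>b\<in>insert b F. \<bar>c b\<bar> \<le> R" "z = (\<Sum>b\<in>insert b F. c b *\<^sub>R b)" by auto
      then have "z = c b *\<^sub>R b + (\<Sum>b\<in>F. c b *\<^sub>R b)" "c b \<in> {-R..R}" "\<forall>b\<in>F. \<bar>c b\<bar> \<le> R"
        using insert.hyps by auto
      then show "z \<in> ?X" by blast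
    qed
    finally show ?case .
  qed
  have "S \<subseteq> {\<Sum>b\<in>fin_basis. c b *\<^sub>R b | c. \<forall>b\<in>fin_basis. \<bar>c b\<bar> \<le> R}"
  proof
    fix x assume "x \<in> S"
    have "\<bar>coord b x\<bar> \<le> R" if "b \<in> fin_basis" for b
      using C(2)[OF that, of x] M[OF \<open>x \<in> S\<close>] C(1) unfolding R_def
      by (meson mult_left_mono less_imp_le order_trans)
    then show "x \<in> {\<Sum>b\<in>fin_basis. c b *\<^sub>R b | c. \<forall>b\<in>fin_basis. \<bar>c b\<bar> \<le> R}"
      by (intro CollectI exI[of _ "\<lambda>b. coord b x"]) (simp add: sum_coord[OF fd])
  qed
  then show ?thesis
    using compact_Int_closed[OF box[OF fin_basis(1)[OF fd]] \<open>closed S\<close>] by (simp add: Int_absorb1)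
qed

lemma finite_dimensional_Times:
  assumes "finite_dimensional_set (UNIV :: 'e::real_vector set)"
    and "finite_dimensional_set (UNIV :: 'f::real_vector set)"
  shows "finite_dimensional_set (UNIV :: ('e \<times> 'f) set)"
proof -
  note f1 = fin_basis[OF assms(1)] and f2 = fin_basis[OF assms(2)]
  define S :: "('e \<times> 'f) set" where "S = (\<lambda>b. (b, 0)) ` fin_basis \<union> (\<lambda>b. (0, b)) ` fin_basis"
  have "(x, y) \<in> span S" for x y
  proof -
    have "(\<Sum>b\<in>fin_basis. coord b x *\<^sub>R (b, 0 :: 'f)) \<in> span S"
      "(\<Sum>b\<in>fin_basis. coord b y *\<^sub>R (0 :: 'e, b)) \<in> span S"
      by (intro span_sum span_scale span_base; simp add: S_def)+
    moreover have "(\<Sum>b\<in>fin_basis. coord b x *\<^sub>R (b, 0 :: 'f)) = (x, 0)"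
      "(\<Sum>b\<in>fin_basis. coord b y *\<^sub>R (0 :: 'e, b)) = (0, y)"
      using sum_coord[OF assms(1), of x] sum_coord[OF assms(2), of y]
      by (auto simp: prod_eq_iff fst_sum snd_sum)
    ultimately have "(x, 0) + (0, y) \<in> span S" by (intro span_add) auto
    then show ?thesis by simp
  qed
  then have "UNIV \<subseteq> span S" by auto
  moreover have "finite S" using f1 f2 by (simp add: S_def)
  ultimately show ?thesis unfolding finite_dimensional_set_def by blast
qed

section \<open>Local solutions of autonomous differential equations\<close>

text \<open>Picard iteration is a contraction on the continuous curves in the ball. The curves are
  stopped at the times \<open>\<plusminus>\<epsilon>\<close>, so that they form a closed subset of the complete space of
  bounded continuous functions on the whole line.\<close>

lemma picard_banach:
  fixes f :: "'b::banach \<Rightarrow> 'b"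
  assumes "r > 0" "L > 0"
    and lip: "\<And>x y. x \<in> cball x0 r \<Longrightarrow> y \<in> cball x0 r \<Longrightarrow> norm (f x - f y) \<le> L * norm (x - y)"
  shows "\<exists>\<epsilon>>0. \<exists>x. x 0 = x0 \<and>
    (\<forall>t\<in>{-\<epsilon><..<\<epsilon>}. x t \<in> cball x0 r \<and> (x has_vector_derivative f (x t)) (at t))"
proof -
  define M where "M = norm (f x0) + L * r + 1"
  have "M > 0" using assms by (simp add: M_def add_nonneg_pos)
  have fM: "norm (f x) \<le> M" if "x \<in> cball x0 r" for x
  proof -
    have "norm (f x) \<le> norm (f x0) + norm (f x - f x0)" by (metis add.commute diff_add_cancel norm_triangle_ineq)
    also have "norm (f x - f x0) \<le> L * norm (x - x0)" using lip[OF that, of x0] assms by simp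
    also have "\<dots> \<le> L * r" using that assms by (simp add: dist_norm norm_minus_commute)
    finally show ?thesis by (simp add: M_def)
  qed
  define \<epsilon> where "\<epsilon> = min (r / M) (1 / (2 * L))"
  have \<epsilon>: "\<epsilon> > 0" "M * \<epsilon> \<le> r" "L * \<epsilon> \<le> 1 / 2"
    using assms \<open>M > 0\<close> by (auto simp: \<epsilon>_def field_simps min_def)
  define I where "I = {-\<epsilon>..\<epsilon>}"
  define cl where "cl t = max (-\<epsilon>) (min \<epsilon> t)" for t
  have cl: "cl t \<in> I" "t \<in> I \<Longrightarrow> cl t = t" for t using \<epsilon>(1) by (auto simp: cl_def I_def)
  have cont_cl: "continuous_on UNIV cl" unfolding cl_def by (intro continuous_intros)
  have contf: "continuous_on (cball x0 r) f"
    using lip assms(2)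
    by (intro lipschitz_on_continuous_on[of L]) (auto simp: lipschitz_on_def dist_norm)
  define S :: "(real \<Rightarrow>\<^sub>C 'b) set" where "S = {x. \<forall>t. apply_bcontfun x t \<in> cball x0 r}"
  have ex: "\<exists>y. y \<in> S \<and> apply_bcontfun y 0 = x0 \<and>
      (\<forall>t\<in>I. (apply_bcontfun y has_vector_derivative f (apply_bcontfun x t)) (at t within I)) \<and>
      (\<forall>t. apply_bcontfun y t = apply_bcontfun y (cl t))"
    if x: "x \<in> S" for x
  proof -
    have "continuous_on I (\<lambda>t. f (apply_bcontfun x t))"
      using x by (intro continuous_on_compose2[OF contf] continuous_intros) (auto simp: S_def)
    then obtain g where g: "\<And>t. t \<in> I \<Longrightarrow> (g has_vector_derivative f (apply_bcontfun x t)) (at t within I)"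
      using antiderivative_continuous unfolding I_def by blast
    define h where "h t = x0 + (g (cl t) - g 0)" for t
    have gb: "norm (g t - g s) \<le> M * norm (t - s)" if "t \<in> I" "s \<in> I" for s t
    proof (rule differentiable_bound[of I])
      show "(g has_derivative (\<lambda>h. h *\<^sub>R f (apply_bcontfun x u))) (at u within I)" if "u \<in> I" for u
        using g[OF that] by (simp add: has_vector_derivative_def)
      show "onorm (\<lambda>h. h *\<^sub>R f (apply_bcontfun x u)) \<le> M" for u
      proof (rule onorm_le)
        fix h :: real
        have "norm (f (apply_bcontfun x u)) * \<bar>h\<bar> \<le> M * \<bar>h\<bar>"
          using fM[of "apply_bcontfun x u"] x by (intro mult_right_mono) (auto simp: S_def)
        then show "norm (h *\<^sub>R f (apply_bcontfun x u)) \<le> M * norm h" by (simp add: mult.commute)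
      qed
    qed (use that in \<open>auto simp: I_def\<close>)
    have contg: "continuous_on I g"
      using g by (meson continuous_on_eq_continuous_within has_vector_derivative_continuous)
    have hball: "h t \<in> cball x0 r" for t
    proof -
      have "norm (g (cl t) - g 0) \<le> M * norm (cl t - 0)"
        using cl(1) \<epsilon>(1) by (intro gb) (auto simp: I_def)
      also have "\<dots> \<le> M * \<epsilon>" using cl(1)[of t] \<open>M > 0\<close> by (auto simp: I_def)
      finally show ?thesis using \<epsilon> by (simp add: h_def dist_norm norm_minus_commute)
    qed
    have "continuous_on UNIV h"
      unfolding h_def using cl(1)
      by (intro continuous_intros continuous_on_compose2[OF contg cont_cl]) auto
    moreover have "bounded (range h)" using hball by (meson bounded_cball bounded_subset image_subsetI)
    ultimately have hb: "h \<in> bcontfun" by (simp add: bcontfun_def)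
    then have app: "apply_bcontfun (Bcontfun h) = h" by (simp add: Bcontfun_inverse)
    have "(h has_vector_derivative f (apply_bcontfun x t)) (at t within I)" if t: "t \<in> I" for t
    proof -
      have "((\<lambda>t. x0 + (g t - g 0)) has_vector_derivative f (apply_bcontfun x t)) (at t within I)"
        using g[OF t] by (auto intro!: derivative_eq_intros)
      then show ?thesis
        using t cl(2) by (rule_tac has_vector_derivative_transform[rotated 2]) (auto simp: h_def)
    qed
    moreover have "h 0 = x0" using cl(2)[of 0] \<epsilon>(1) by (simp add: h_def I_def)
    ultimately show ?thesis
      using hball cl by (intro exI[of _ "Bcontfun h"]) (auto simp: app S_def h_def)
  qed
  then obtain T where T: "\<And>x. x \<in> S \<Longrightarrow> T x \<in> S" "\<And>x. x \<in> S \<Longrightarrow> apply_bcontfun (T x) 0 = x0"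
    "\<And>x t. x \<in> S \<Longrightarrow> t \<in> I \<Longrightarrow>
      (apply_bcontfun (T x) has_vector_derivative f (apply_bcontfun x t)) (at t within I)"
    "\<And>x t. x \<in> S \<Longrightarrow> apply_bcontfun (T x) t = apply_bcontfun (T x) (cl t)"
    by metis
  have contr: "dist (T x) (T y) \<le> 1 / 2 * dist x y" if x: "x \<in> S" and y: "y \<in> S" for x y
  proof (rule dist_bound)
    fix t
    let ?d = "\<lambda>t. apply_bcontfun (T x) t - apply_bcontfun (T y) t"
    have "norm (?d (cl t) - ?d 0) \<le> (L * dist x y) * norm (cl t - 0)"
    proof (rule differentiable_bound[of I])
      show "(?d has_derivative (\<lambda>h. h *\<^sub>R (f (apply_bcontfun x u) - f (apply_bcontfun y u)))) (at u within I)"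
        if "u \<in> I" for u
        using has_vector_derivative_diff[OF T(3)[OF x that] T(3)[OF y that]]
        by (simp add: has_vector_derivative_def)
      show "onorm (\<lambda>h. h *\<^sub>R (f (apply_bcontfun x u) - f (apply_bcontfun y u))) \<le> L * dist x y" for u
      proof (rule onorm_le)
        fix h :: real
        have "norm (f (apply_bcontfun x u) - f (apply_bcontfun y u)) \<le> L * dist (apply_bcontfun x u) (apply_bcontfun y u)"
          using lip x y by (simp add: S_def dist_norm)
        also have "\<dots> \<le> L * dist x y" using assms(2) dist_bounded[of x u y] by simp
        finally show "norm (h *\<^sub>R (f (apply_bcontfun x u) - f (apply_bcontfun y u))) \<le> L * dist x y * norm h"
          unfolding norm_scaleR by (simp add: mult.commute[of _ "\<bar>h\<bar>"] mult_left_mono)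
      qed
    qed (use cl(1) \<epsilon>(1) in \<open>auto simp: I_def\<close>)
    also have "norm (cl t - 0) \<le> \<epsilon>" using cl(1)[of t] by (auto simp: I_def)
    then have "(L * dist x y) * norm (cl t - 0) \<le> (L * dist x y) * \<epsilon>"
      using assms by (intro mult_left_mono) auto
    also have "\<dots> = (L * \<epsilon>) * dist x y" by simp
    also have "\<dots> \<le> 1 / 2 * dist x y" using \<epsilon> by (intro mult_right_mono) auto
    finally show "dist (apply_bcontfun (T x) t) (apply_bcontfun (T y) t) \<le> 1 / 2 * dist x y"
      using T(2)[OF x] T(2)[OF y] T(4)[OF x, of t] T(4)[OF y, of t] by (simp add: dist_norm)
  qed
  have "closed S"
  proof -
    have "S = (\<Inter>t. (\<lambda>x. apply_bcontfun x t) -` cball x0 r)" by (auto simp: S_def)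
    moreover have "closed ((\<lambda>x :: real \<Rightarrow>\<^sub>C 'b. apply_bcontfun x t) -` cball x0 r)" for t
    proof (rule closed_vimage)
      show "continuous_on UNIV (\<lambda>x :: real \<Rightarrow>\<^sub>C 'b. apply_bcontfun x t)"
        by (rule lipschitz_on_continuous_on[of 1]) (auto simp: lipschitz_on_def dist_bounded)
    qed simp
    ultimately show ?thesis by (auto intro: closed_INT)
  qed
  moreover have "const_bcontfun x0 \<in> S" using assms(1) by (simp add: S_def)
  ultimately have "\<exists>!x\<in>S. T x = x"
    using T(1) contr by (intro Banach_fix[of S "1/2" T]) (auto simp: complete_eq_closed)
  then obtain x where x: "x \<in> S" "T x = x" by blast
  have "(apply_bcontfun x has_vector_derivative f (apply_bcontfun x t)) (at t)" if "t \<in> {-\<epsilon><..<\<epsilon>}" for t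
    using T(3)[OF x(1), of t] x(2) that at_within_Icc_at[of "-\<epsilon>" t \<epsilon>] by (auto simp: I_def)
  moreover have "apply_bcontfun x 0 = x0" using T(2)[OF x(1)] x(2) by simp
  moreover have "apply_bcontfun x t \<in> cball x0 r" for t using x(1) unfolding S_def by blast
  ultimately show ?thesis
    using \<epsilon>(1) by (intro exI[of _ \<epsilon>] exI[of _ "apply_bcontfun x"] conjI ballI)
qed

text \<open>The class of \<open>'e\<close> does not express completeness. The equation is therefore
  solved in the Banach space of bounded functionals on \<open>'e\<close>, of which \<open>'e\<close> is a
  retract by means of a basis.\<close>

lemma picard_fin_dim:
  fixes f :: "'e::real_normed_vector \<Rightarrow> 'e"
  assumes fd: "finite_dimensional_set (UNIV :: 'e set)" and "r > 0" "L > 0"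
    and lip: "\<And>x y. x \<in> cball x0 r \<Longrightarrow> y \<in> cball x0 r \<Longrightarrow> norm (f x - f y) \<le> L * norm (x - y)"
  shows "\<exists>\<epsilon>>0. \<exists>x. x 0 = x0 \<and>
    (\<forall>t\<in>{-\<epsilon><..<\<epsilon>}. x t \<in> cball x0 r \<and> (x has_vector_derivative f (x t)) (at t))"
proof -
  define \<iota> :: "'e \<Rightarrow> ('e \<Rightarrow>\<^sub>L real)"
    where "\<iota> e = (\<Sum>b\<in>fin_basis. coord b e *\<^sub>R Blinfun (coord b))" for e
  define \<rho> :: "('e \<Rightarrow>\<^sub>L real) \<Rightarrow> 'e" where "\<rho> g = (\<Sum>b\<in>fin_basis. blinfun_apply g b *\<^sub>R b)" for g
  have "linear \<iota>"
    by (intro linearI) (simp_all add: \<iota>_def linear_add[OF linear_coord[OF fd]]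
      linear_scale[OF linear_coord[OF fd]] scaleR_left_distrib sum.distrib scaleR_sum_right)
  then have bi: "bounded_linear \<iota>" by (rule bounded_linear_fin_dim[OF fd])
  have br: "bounded_linear \<rho>"
    unfolding \<rho>_def
    by (intro bounded_linear_sum bounded_linear_scaleR_const blinfun.bounded_linear_left)
  have app: "blinfun_apply (Blinfun (coord b)) x = coord b x" for b x :: 'e
    by (simp add: bounded_linear_Blinfun_apply bounded_linear_coord[OF fd])
  have ri: "\<rho> (\<iota> e) = e" for e
  proof -
    have "blinfun_apply (\<iota> e) d = coord d e" if "d \<in> fin_basis" for d
    proof -
      have "blinfun_apply (\<iota> e) d = (\<Sum>b\<in>fin_basis. coord b e * coord b d)"
        by (simp add: \<iota>_def blinfun.sum_left blinfun.scaleR_left app)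
      also have "\<dots> = (\<Sum>b\<in>fin_basis. if b = d then coord b e else 0)"
        using that fin_basis[OF fd] by (intro sum.cong) (auto simp: coord_def representation_basis)
      finally show ?thesis using that fin_basis[OF fd] by simp
    qed
    then show ?thesis unfolding \<rho>_def by (simp add: sum_coord[OF fd])
  qed
  obtain Ki where Ki: "Ki > 0" "\<And>x. norm (\<iota> x) \<le> norm x * Ki" using bounded_linear.pos_bounded[OF bi] by blast
  obtain Kr where Kr: "Kr > 0" "\<And>x. norm (\<rho> x) \<le> norm x * Kr" using bounded_linear.pos_bounded[OF br] by blast
  have rball: "\<rho> y \<in> cball x0 r" if "y \<in> cball (\<iota> x0) (r / Kr)" for y
  proof -
    have "norm (x0 - \<rho> y) = norm (\<rho> (\<iota> x0 - y))"
      by (simp add: ri bounded_linear.linear[OF br] linear_diff)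
    also have "\<dots> \<le> norm (\<iota> x0 - y) * Kr" by (rule Kr)
    also have "\<dots> \<le> r" using that Kr(1) by (simp add: dist_norm field_simps)
    finally show ?thesis by (simp add: dist_norm)
  qed
  have "\<exists>\<epsilon>>0. \<exists>x. x 0 = \<iota> x0 \<and> (\<forall>t\<in>{-\<epsilon><..<\<epsilon>}. x t \<in> cball (\<iota> x0) (r / Kr) \<and>
      (x has_vector_derivative \<iota> (f (\<rho> (x t)))) (at t))"
  proof (rule picard_banach)
    fix x y assume "x \<in> cball (\<iota> x0) (r / Kr)" "y \<in> cball (\<iota> x0) (r / Kr)"
    then have l: "norm (f (\<rho> x) - f (\<rho> y)) \<le> L * norm (\<rho> x - \<rho> y)" by (intro lip rball)
    have "norm (\<iota> (f (\<rho> x)) - \<iota> (f (\<rho> y))) = norm (\<iota> (f (\<rho> x) - f (\<rho> y)))"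
      by (simp add: bounded_linear.linear[OF bi] linear_diff)
    also have "\<dots> \<le> norm (f (\<rho> x) - f (\<rho> y)) * Ki" by (rule Ki)
    also have "\<dots> \<le> L * norm (\<rho> x - \<rho> y) * Ki" using l Ki by (intro mult_right_mono) auto
    also have "norm (\<rho> x - \<rho> y) = norm (\<rho> (x - y))"
      by (simp add: bounded_linear.linear[OF br] linear_diff)
    also have "L * norm (\<rho> (x - y)) * Ki \<le> L * (norm (x - y) * Kr) * Ki"
      using Kr Ki assms by (intro mult_right_mono mult_left_mono) auto
    finally show "norm (\<iota> (f (\<rho> x)) - \<iota> (f (\<rho> y))) \<le> (L * Kr * Ki) * norm (x - y)"
      by (simp add: algebra_simps)
  qed (use assms Kr Ki in auto)
  then obtain \<epsilon> x where x: "\<epsilon> > 0" "x 0 = \<iota> x0" "\<And>t. t \<in> {-\<epsilon><..<\<epsilon>} \<Longrightarrow> x t \<in> cball (\<iota> x0) (r / Kr)"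
    "\<And>t. t \<in> {-\<epsilon><..<\<epsilon>} \<Longrightarrow> (x has_vector_derivative \<iota> (f (\<rho> (x t)))) (at t)" by blast
  have "((\<lambda>t. \<rho> (x t)) has_vector_derivative f (\<rho> (x t))) (at t)" if "t \<in> {-\<epsilon><..<\<epsilon>}" for t
    using bounded_linear.has_vector_derivative[OF br x(4)[OF that]] by (simp add: ri)
  moreover have "\<rho> (x 0) = x0" using x(2) ri by simp
  moreover have "\<rho> (x t) \<in> cball x0 r" if "t \<in> {-\<epsilon><..<\<epsilon>}" for t
    using rball[OF x(3)[OF that]] .
  ultimately show ?thesis
    using x(1) by (intro exI[of _ \<epsilon>] exI[of _ "\<lambda>t. \<rho> (x t)"] conjI ballI)
qed

section \<open>Calculus of smooth maps\<close>

lemma Ck_on_cong: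
  assumes "open S" "\<And>x. x \<in> S \<Longrightarrow> f x = g x" "Ck_on k f S"
  shows "Ck_on k g S"
  using assms(2,3)
proof (induction k arbitrary: f g)
  case 0
  then show ?case by (simp cong: continuous_on_cong)
next
  case (Suc k)
  have d: "(g has_derivative frechet_derivative f (at x)) (at x)" if "x \<in> S" for x
  proof -
    have "(f has_derivative frechet_derivative f (at x)) (at x)"
      using Suc.prems(2) that by (auto simp: frechet_derivative_works[symmetric])
    then show ?thesis
      by (rule has_derivative_transform_within_open[OF _ assms(1) that]) (rule Suc.prems(1))
  qed
  then have "frechet_derivative g (at x) = frechet_derivative f (at x)" if "x \<in> S" for x
    using frechet_derivative_at that by metis
  then have "Ck_on k (\<lambda>x. frechet_derivative g (at x) v) S" for v
    using Suc.IH[of "\<lambda>x. frechet_derivative f (at x) v"] Suc.prems(2) by simp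
  then show ?case using d by (auto simp: differentiable_def)
qed

lemma Ck_on_subset: "Ck_on k f S \<Longrightarrow> T \<subseteq> S \<Longrightarrow> Ck_on k f T"
  by (induction k arbitrary: f) (auto intro: continuous_on_subset)

lemma Ck_on_local:
  assumes "\<And>x. x \<in> S \<Longrightarrow> \<exists>T. open T \<and> x \<in> T \<and> Ck_on k f T"
  shows "Ck_on k f S"
  using assms
proof (induction k arbitrary: f)
  case 0
  have "isCont f x" if "x \<in> S" for x
    using 0[OF that] by (auto simp: continuous_on_eq_continuous_at)
  then show ?case by (simp add: continuous_at_imp_continuous_on)
next
  case (Suc k)
  have "Ck_on k (\<lambda>x. frechet_derivative f (at x) v) S" for v
    by (rule Suc.IH) (use Suc.prems in fastforce)
  moreover have "f differentiable (at x)" if "x \<in> S" for x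
    using Suc.prems[OF that] by auto
  ultimately show ?case by simp
qed

lemma Ck_on_Suc_imp: "Ck_on (Suc k) f S \<Longrightarrow> Ck_on k f S"
proof (induction k arbitrary: f)
  case 0
  then show ?case
    by (auto intro!: continuous_at_imp_continuous_on differentiable_imp_continuous_within)
next
  case (Suc k)
  then have "Ck_on k (\<lambda>x. frechet_derivative f (at x) v) S" for v
    by (metis Ck_on.simps(2))
  moreover have "\<forall>x\<in>S. f differentiable (at x)" using Suc.prems by simp
  ultimately show ?case by simp
qed

lemma Ck_on_SucI:
  assumes "open S" and d: "\<And>x. x \<in> S \<Longrightarrow> (f has_derivative f' x) (at x)"
    and "\<And>v. Ck_on k (\<lambda>x. f' x v) S"
  shows "Ck_on (Suc k) f S"
proof -
  have "frechet_derivative f (at x) = f' x" if "x \<in> S" for x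
    using frechet_derivative_at[OF d[OF that]] by simp
  then have "Ck_on k (\<lambda>x. frechet_derivative f (at x) v) S" for v
    using Ck_on_cong[OF assms(1) _ assms(3)[of v]] by simp
  moreover have "f differentiable (at x)" if "x \<in> S" for x
    using d[OF that] by (auto simp: differentiable_def)
  ultimately show ?thesis by simp
qed

lemma Ck_on_SucD:
  assumes "Ck_on (Suc k) f S"
  shows "x \<in> S \<Longrightarrow> (f has_derivative frechet_derivative f (at x)) (at x)"
    and "Ck_on k (\<lambda>x. frechet_derivative f (at x) v) S"
  using assms by (auto simp: frechet_derivative_works[symmetric])

lemma Ck_on_const: "open S \<Longrightarrow> Ck_on k (\<lambda>x. c) S"
proof (induction k arbitrary: c)
  case (Suc k)
  then show ?case by (intro Ck_on_SucI[where f' = "\<lambda>_ _. 0"]) auto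
qed simp

lemma Ck_on_linear: "bounded_linear f \<Longrightarrow> open S \<Longrightarrow> Ck_on k f S"
proof (cases k)
  case 0
  then show "bounded_linear f \<Longrightarrow> open S \<Longrightarrow> Ck_on k f S"
    by (simp add: linear_continuous_on)
next
  case (Suc j)
  assume "bounded_linear f" "open S"
  then show ?thesis unfolding Suc
    by (intro Ck_on_SucI[where f' = "\<lambda>_. f"]) (auto intro: bounded_linear_imp_has_derivative Ck_on_const)
qed

lemma Ck_on_linear_comp:
  assumes "bounded_linear h" "open S" "Ck_on k f S"
  shows "Ck_on k (\<lambda>x. h (f x)) S"
  using assms(3)
proof (induction k arbitrary: f)
  case 0
  then show ?case using assms(1) by (simp add: bounded_linear.continuous_on)
next
  case (Suc k)
  show ?case
  proof (rule Ck_on_SucI[OF assms(2)])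
    show "((\<lambda>x. h (f x)) has_derivative (\<lambda>v. h (frechet_derivative f (at x) v))) (at x)" if "x \<in> S" for x
      using bounded_linear.has_derivative[OF assms(1) Ck_on_SucD(1)[OF Suc.prems that]] .
  qed (rule Suc.IH[OF Ck_on_SucD(2)[OF Suc.prems]])
qed

lemma Ck_on_add:
  assumes "open S" "Ck_on k f S" "Ck_on k g S"
  shows "Ck_on k (\<lambda>x. f x + g x) S"
  using assms(2,3)
proof (induction k arbitrary: f g)
  case 0
  then show ?case by (simp add: continuous_on_add)
next
  case (Suc k)
  show ?case
  proof (rule Ck_on_SucI[OF assms(1)])
    show "((\<lambda>x. f x + g x) has_derivative (\<lambda>v. frechet_derivative f (at x) v + frechet_derivative g (at x) v)) (at x)"
      if "x \<in> S" for x
      by (rule has_derivative_add[OF Suc.prems[THEN Ck_on_SucD(1), OF that]])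
  qed (intro Suc.IH Ck_on_SucD(2) Suc.prems)
qed

lemma Ck_on_sum:
  assumes "open S" "finite I" "\<And>i. i \<in> I \<Longrightarrow> Ck_on k (f i) S"
  shows "Ck_on k (\<lambda>x. \<Sum>i\<in>I. f i x) S"
  using assms(2,3)
  by (induction I rule: finite_induct) (auto intro!: Ck_on_const Ck_on_add assms(1))

lemma Ck_on_scaleR:
  fixes c :: "'e::real_normed_vector \<Rightarrow> real"
  assumes "open S" "Ck_on k c S" "Ck_on k f S"
  shows "Ck_on k (\<lambda>x. c x *\<^sub>R f x) S"
  using assms(2,3)
proof (induction k arbitrary: c f)
  case 0
  then show ?case by (simp add: continuous_on_scaleR)
next
  case (Suc k)
  show ?case
  proof (rule Ck_on_SucI[OF assms(1)])
    show "((\<lambda>x. c x *\<^sub>R f x) has_derivative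
        (\<lambda>v. c x *\<^sub>R frechet_derivative f (at x) v + frechet_derivative c (at x) v *\<^sub>R f x)) (at x)"
      if "x \<in> S" for x
      by (rule has_derivative_scaleR[OF Suc.prems[THEN Ck_on_SucD(1), OF that]])
  qed (intro Suc.IH Ck_on_add assms(1) Ck_on_SucD(2) Suc.prems Ck_on_Suc_imp)
qed

lemma Ck_on_Pair:
  assumes "open S" "Ck_on k f S" "Ck_on k g S"
  shows "Ck_on k (\<lambda>x. (f x, g x)) S"
  using assms(2,3)
proof (induction k arbitrary: f g)
  case 0
  then show ?case by (simp add: continuous_on_Pair)
next
  case (Suc k)
  show ?case
  proof (rule Ck_on_SucI[OF assms(1)])
    show "((\<lambda>x. (f x, g x)) has_derivative (\<lambda>v. (frechet_derivative f (at x) v, frechet_derivative g (at x) v))) (at x)"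
      if "x \<in> S" for x
      by (rule has_derivative_Pair[OF Suc.prems[THEN Ck_on_SucD(1), OF that]])
  qed (intro Suc.IH Ck_on_SucD(2) Suc.prems)
qed

text \<open>Expanding the inner derivative in a basis reduces the derivative of the
  composition to products of functions of the same kind.\<close>

lemma Ck_on_compose:
  fixes f :: "'e::real_normed_vector \<Rightarrow> 'f::real_normed_vector"
    and g :: "'f \<Rightarrow> 'g::real_normed_vector"
  assumes fd: "finite_dimensional_set (UNIV :: 'f set)"
    and "open S" "f ` S \<subseteq> T" "Ck_on k f S" "Ck_on k g T"
  shows "Ck_on k (\<lambda>x. g (f x)) S"
  using assms(4,5)
proof (induction k arbitrary: g)
  case 0
  then show ?case using continuous_on_compose2[of T g S f] assms(3) by auto
next
  case (Suc k)
  have fT: "f x \<in> T" if "x \<in> S" for x using assms(3) that by auto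
  let ?f' = "\<lambda>x. frechet_derivative f (at x)" and ?g' = "\<lambda>y. frechet_derivative g (at y)"
  show ?case
  proof (rule Ck_on_SucI[OF assms(2)])
    fix x assume x: "x \<in> S"
    have dg: "(g has_derivative ?g' (f x)) (at (f x))" using Ck_on_SucD(1)[OF Suc.prems(2) fT[OF x]] .
    have lin: "linear (?g' (f x))" using has_derivative_bounded_linear[OF dg] by (rule bounded_linear.linear)
    have "((\<lambda>x. g (f x)) has_derivative (\<lambda>v. ?g' (f x) (?f' x v))) (at x)"
      using has_derivative_compose[OF Ck_on_SucD(1)[OF Suc.prems(1) x] dg] .
    then show "((\<lambda>x. g (f x)) has_derivative
        (\<lambda>v. \<Sum>b\<in>fin_basis. coord b (?f' x v) *\<^sub>R ?g' (f x) b)) (at x)"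
      by (simp add: linear_eq_sum_coord[OF fd lin, symmetric])
  next
    fix v
    show "Ck_on k (\<lambda>x. \<Sum>b\<in>fin_basis. coord b (?f' x v) *\<^sub>R ?g' (f x) b) S"
    proof (intro Ck_on_sum[OF assms(2) fin_basis(1)[OF fd]] Ck_on_scaleR[OF assms(2)])
      fix b :: 'f
      show "Ck_on k (\<lambda>x. coord b (?f' x v)) S"
        by (intro Ck_on_linear_comp[OF bounded_linear_coord[OF fd] assms(2)] Ck_on_SucD(2) Suc.prems)
      show "Ck_on k (\<lambda>x. ?g' (f x) b) S"
        by (intro Suc.IH[where g = "\<lambda>y. ?g' y b"] Ck_on_Suc_imp[OF Suc.prems(1)] Ck_on_SucD(2) Suc.prems)
    qed
  qed
qed

lemma smooth_on_open_cong:
  assumes "smooth_on_open f S" "\<And>x. x \<in> S \<Longrightarrow> f x = g x"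
  shows "smooth_on_open g S"
  using assms Ck_on_cong unfolding smooth_on_open_def by blast

lemma smooth_on_open_subset: "smooth_on_open f S \<Longrightarrow> open T \<Longrightarrow> T \<subseteq> S \<Longrightarrow> smooth_on_open f T"
  using Ck_on_subset unfolding smooth_on_open_def by blast

lemma smooth_on_open_UN:
  assumes "\<And>i. i \<in> I \<Longrightarrow> smooth_on_open f (S i)"
  shows "smooth_on_open f (\<Union>i\<in>I. S i)"
  unfolding smooth_on_open_def
proof (intro conjI allI)
  show "open (\<Union>i\<in>I. S i)" using assms by (auto simp: smooth_on_open_def)
  show "Ck_on k f (\<Union>i\<in>I. S i)" for k
    using assms by (intro Ck_on_local) (auto simp: smooth_on_open_def)
qed

lemma smooth_on_open_continuous: "smooth_on_open f S \<Longrightarrow> continuous_on S f"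
  unfolding smooth_on_open_def using Ck_on.simps(1) by blast

lemma smooth_on_open_preimage: "smooth_on_open f S \<Longrightarrow> open T \<Longrightarrow> open (S \<inter> f -` T)"
  using continuous_open_preimage[OF smooth_on_open_continuous] by (auto simp: smooth_on_open_def)

lemma smooth_on_open_compose:
  fixes f :: "'e::real_normed_vector \<Rightarrow> 'f::real_normed_vector"
  assumes fd: "finite_dimensional_set (UNIV :: 'f set)"
    and f: "smooth_on_open f S" and g: "smooth_on_open g T"
  shows "smooth_on_open (\<lambda>x. g (f x)) (S \<inter> f -` T)"
  unfolding smooth_on_open_def
proof (intro conjI allI)
  show o: "open (S \<inter> f -` T)" using smooth_on_open_preimage[OF f] g by (simp add: smooth_on_open_def)
  show "Ck_on k (\<lambda>x. g (f x)) (S \<inter> f -` T)" for k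
  proof (rule Ck_on_compose[OF fd o])
    show "f ` (S \<inter> f -` T) \<subseteq> T" by blast
    have "Ck_on k f S" using f by (simp add: smooth_on_open_def)
    then show "Ck_on k f (S \<inter> f -` T)" by (rule Ck_on_subset) blast
    show "Ck_on k g T" using g by (simp add: smooth_on_open_def)
  qed
qed

lemma smooth_on_open_derivative:
  assumes "smooth_on_open f S"
  shows "x \<in> S \<Longrightarrow> (f has_derivative frechet_derivative f (at x)) (at x)"
    and "smooth_on_open (\<lambda>x. frechet_derivative f (at x) v) S"
  using assms Ck_on_SucD unfolding smooth_on_open_def by blast+

text \<open>Left-invariant vector fields and the adjoint representation are partial differentials of
  this kind, which is where their smoothness comes from.\<close>

lemma smooth_on_open_partial:
  fixes f :: "'e::real_normed_vector \<times> 'f::real_normed_vector \<Rightarrow> 'g::real_normed_vector"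
  assumes fd: "finite_dimensional_set (UNIV :: 'e set)" "finite_dimensional_set (UNIV :: 'f set)"
    and f: "smooth_on_open f S"
  shows "smooth_on_open (\<lambda>x. frechet_derivative f (at (x, y)) (0, v)) {x. (x, y) \<in> S}"
proof -
  have "Ck_on k (\<lambda>x :: 'e. (x, y)) UNIV" for k
    by (rule Ck_on_Pair[OF open_UNIV Ck_on_linear[OF bounded_linear_ident open_UNIV] Ck_on_const[OF open_UNIV]])
  then have "smooth_on_open (\<lambda>x :: 'e. (x, y)) UNIV" by (simp add: smooth_on_open_def)
  note smooth_on_open_compose[OF finite_dimensional_Times[OF fd] this smooth_on_open_derivative(2)[OF f, of "(0, v)"]]
  moreover have "UNIV \<inter> (\<lambda>x. (x, y)) -` S = {x. (x, y) \<in> S}" by blast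
  ultimately show ?thesis by (simp only:)
qed

lemma partial_derivative:
  assumes "(f has_derivative f') (at (x, y))"
  shows "((\<lambda>y. f (x, y)) has_derivative (\<lambda>v. f' (0, v))) (at y)"
    and "((\<lambda>x. f (x, y)) has_derivative (\<lambda>v. f' (v, 0))) (at x)"
proof -
  have "((\<lambda>y. (x, y)) has_derivative (\<lambda>v. (0, v))) (at y)"
    "((\<lambda>x. (x, y)) has_derivative (\<lambda>v. (v, 0))) (at x)"
    by (auto intro!: derivative_eq_intros)
  from this[THEN has_derivative_compose, of f f'] assms
  show "((\<lambda>y. f (x, y)) has_derivative (\<lambda>v. f' (0, v))) (at y)"
    "((\<lambda>x. f (x, y)) has_derivative (\<lambda>v. f' (v, 0))) (at x)" by auto
qed

text \<open>The operator norm of the derivative is controlled by its values on a basis, which depend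
  continuously on the point.\<close>

lemma smooth_on_open_locally_Lipschitz:
  fixes f :: "'e::real_normed_vector \<Rightarrow> 'g::real_normed_vector"
  assumes fd: "finite_dimensional_set (UNIV :: 'e set)"
    and f: "smooth_on_open f S" and x0: "x0 \<in> S"
  shows "\<exists>r>0. \<exists>L>0. cball x0 r \<subseteq> S \<and>
    (\<forall>x\<in>cball x0 r. \<forall>y\<in>cball x0 r. norm (f x - f y) \<le> L * norm (x - y))"
proof -
  let ?f' = "\<lambda>x. frechet_derivative f (at x)"
  obtain C where C: "C > 0" "\<And>b x. b \<in> fin_basis \<Longrightarrow> \<bar>coord b (x :: 'e)\<bar> \<le> C * norm x"
    using coord_le[OF fd] by blast
  define h where "h x = (\<Sum>b\<in>(fin_basis :: 'e set). norm (?f' x b))" for x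
  have "continuous_on S h"
    unfolding h_def
    by (intro continuous_on_sum continuous_on_norm smooth_on_open_continuous smooth_on_open_derivative(2) f)
  then have "isCont h x0" using f x0 by (simp add: smooth_on_open_def continuous_on_eq_continuous_at)
  then have "\<forall>\<^sub>F x in nhds x0. h x < h x0 + 1"
    by (intro order_tendstoD(2)[of h "h x0"]) (auto simp: isCont_def tendsto_at_iff_tendsto_nhds)
  moreover have "\<forall>\<^sub>F x in nhds x0. x \<in> S" using f x0 by (simp add: smooth_on_open_def eventually_nhds_in_open)
  ultimately have "\<forall>\<^sub>F x in nhds x0. h x < h x0 + 1 \<and> x \<in> S" by eventually_elim simp
  then obtain d where d: "d > 0" "\<And>x. dist x x0 < d \<Longrightarrow> h x < h x0 + 1 \<and> x \<in> S"
    by (auto simp: eventually_nhds_metric)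
  define L where "L = C * (h x0 + 1)"
  have "h x0 \<ge> 0" by (simp add: h_def sum_nonneg)
  then have "L > 0" using C by (simp add: L_def)
  have ball: "h x < h x0 + 1" "x \<in> S" if "x \<in> cball x0 (d / 2)" for x
    using d(2)[of x] that d(1) by (auto simp: dist_commute)
  have "norm (f x - f y) \<le> L * norm (x - y)" if "x \<in> cball x0 (d / 2)" "y \<in> cball x0 (d / 2)" for x y
  proof (rule differentiable_bound[OF convex_cball[of x0 "d / 2"] _ _ that])
    fix z assume z: "z \<in> cball x0 (d / 2)"
    have dz: "(f has_derivative ?f' z) (at z)" using smooth_on_open_derivative(1)[OF f] ball z by blast
    then show "(f has_derivative ?f' z) (at z within cball x0 (d / 2))" by (rule has_derivative_at_withinI)
    have lin: "linear (?f' z)" using has_derivative_bounded_linear[OF dz] by (rule bounded_linear.linear)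
    show "onorm (?f' z) \<le> L"
    proof (rule onorm_bound)
      fix v
      have "?f' z v = (\<Sum>b\<in>fin_basis. coord b v *\<^sub>R ?f' z b)" by (rule linear_eq_sum_coord[OF fd lin])
      also have "norm \<dots> \<le> (\<Sum>b\<in>fin_basis. (C * norm v) * norm (?f' z b))"
        by (rule sum_norm_le) (simp add: C(2) mult_right_mono)
      also have "\<dots> = (C * norm v) * h z" by (simp add: h_def sum_distrib_left)
      also have "\<dots> \<le> (C * norm v) * (h x0 + 1)"
        using ball(1)[OF z] C by (intro mult_left_mono) auto
      finally show "norm (?f' z v) \<le> L * norm v" by (simp add: L_def algebra_simps)
    qed (use \<open>L > 0\<close> in simp)
  qed
  then show ?thesis
    using d(1) \<open>L > 0\<close> ball(2) by (intro exI[of _ "d / 2"] conjI exI[of _ L]) auto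
qed

section \<open>Atlases\<close>

text \<open>Separated from the compatibility of charts, because for a product it follows at once from
  the factors.\<close>

definition topological_atlas :: "'a topology \<Rightarrow> ('a, 'e::real_normed_vector) chart set \<Rightarrow> bool" where
  "topological_atlas T A \<longleftrightarrow>
     (\<forall>(U, \<phi>)\<in>A. openin T U \<and> open (\<phi> ` U) \<and>
        homeomorphic_map (subtopology T U) (top_of_set (\<phi> ` U)) \<phi>) \<and>
     (\<Union>(fst ` A)) = topspace T"

abbreviation vector_atlas :: "('v::real_normed_vector, 'v) chart set" where
  "vector_atlas \<equiv> {(UNIV, \<lambda>w. w)}"

lemma smooth_atlas_topological: "smooth_atlas T A \<Longrightarrow> topological_atlas T A"
  by (auto simp: smooth_atlas_def topological_atlas_def)

lemma topological_atlasD: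
  assumes "topological_atlas T A" "(U, \<phi>) \<in> A"
  shows "openin T U" "open (\<phi> ` U)" "homeomorphic_map (subtopology T U) (top_of_set (\<phi> ` U)) \<phi>"
    "inj_on \<phi> U"
proof -
  show "openin T U" "open (\<phi> ` U)" and h: "homeomorphic_map (subtopology T U) (top_of_set (\<phi> ` U)) \<phi>"
    using assms by (auto simp: topological_atlas_def)
  then have "topspace (subtopology T U) = U" by (auto dest: openin_subset)
  with h show "inj_on \<phi> U" by (auto simp: homeomorphic_eq_everything_map)
qed

lemma topological_atlas_cover:
  assumes "topological_atlas T A" "x \<in> topspace T"
  obtains U \<phi> where "(U, \<phi>) \<in> A" "x \<in> U"
proof -
  have "x \<in> \<Union> (fst ` A)" using assms by (simp add: topological_atlas_def)
  then obtain c where "c \<in> A" "x \<in> fst c" by blast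
  then show ?thesis using that[of "fst c" "snd c"] by simp
qed

lemma chart_preimage_open:
  assumes "topological_atlas T A" "(U, \<phi>) \<in> A" "open W"
  shows "openin T {x \<in> U. \<phi> x \<in> W}"
proof -
  note h = topological_atlasD[OF assms(1,2)]
  have top: "topspace (subtopology T U) = U" using h(1) by (auto dest: openin_subset)
  have "continuous_map (subtopology T U) (top_of_set (\<phi> ` U)) \<phi>"
    using h(3) by (rule homeomorphic_imp_continuous_map)
  then have "openin (subtopology T U) {x \<in> U. \<phi> x \<in> (\<phi> ` U) \<inter> W}"
    using openin_continuous_map_preimage[of "subtopology T U" "top_of_set (\<phi> ` U)" \<phi> "(\<phi> ` U) \<inter> W"]
      openin_open_Int[OF assms(3), of "\<phi> ` U"]
    unfolding top by blast
  then have "openin T {x \<in> U. \<phi> x \<in> (\<phi> ` U) \<inter> W}"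
    using h(1) openin_open_subtopology by blast
  moreover have "{x \<in> U. \<phi> x \<in> (\<phi> ` U) \<inter> W} = {x \<in> U. \<phi> x \<in> W}" by auto
  ultimately show ?thesis by simp
qed

lemma chart_image_open:
  assumes "topological_atlas T A" "(U, \<phi>) \<in> A" "openin T W"
  shows "open (\<phi> ` (U \<inter> W))"
proof -
  note h = topological_atlasD[OF assms(1,2)]
  have "open_map (subtopology T U) (top_of_set (\<phi> ` U)) \<phi>"
    using h(3) by (rule homeomorphic_imp_open_map)
  moreover have "openin (subtopology T U) (U \<inter> W)"
    using assms(3) by (simp add: openin_subtopology_Int2)
  ultimately have "openin (top_of_set (\<phi> ` U)) (\<phi> ` (U \<inter> W))" by (simp add: open_map_def)
  then show ?thesis using h(2) openin_open_eq by blast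
qed

lemma topological_atlas_prod:
  assumes "topological_atlas T A" "topological_atlas T' A'"
  shows "topological_atlas (prod_topology T T') (prod_atlas A A')"
  unfolding topological_atlas_def
proof (intro conjI ballI)
  fix c assume "c \<in> prod_atlas A A'"
  then obtain U \<phi> V \<psi> where c: "c = (U \<times> V, map_prod \<phi> \<psi>)" and U: "(U, \<phi>) \<in> A" and V: "(V, \<psi>) \<in> A'"
    by (auto simp: prod_atlas_def)
  note u = topological_atlasD[OF assms(1) U] and v = topological_atlasD[OF assms(2) V]
  have im: "map_prod \<phi> \<psi> ` (U \<times> V) = (\<phi> ` U) \<times> (\<psi> ` V)" by force
  obtain f g where "homeomorphic_maps (subtopology T U) (top_of_set (\<phi> ` U)) \<phi> f"
    "homeomorphic_maps (subtopology T' V) (top_of_set (\<psi> ` V)) \<psi> g"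
    using u(3) v(3) by (auto simp: homeomorphic_map_maps)
  then have "homeomorphic_maps (subtopology (prod_topology T T') (U \<times> V)) (top_of_set (\<phi> ` U \<times> \<psi> ` V))
      (\<lambda>(x, y). (\<phi> x, \<psi> y)) (\<lambda>(x, y). (f x, g y))"
    unfolding subtopology_Times
    by (metis homeomorphic_maps_prod prod_topology_subtopology_eu)
  then have "homeomorphic_map (subtopology (prod_topology T T') (U \<times> V))
      (top_of_set (map_prod \<phi> \<psi> ` (U \<times> V))) (map_prod \<phi> \<psi>)"
    unfolding im unfolding map_prod_def homeomorphic_map_maps by blast
  then show "case c of (U, \<phi>) \<Rightarrow> openin (prod_topology T T') U \<and> open (\<phi> ` U) \<and>
        homeomorphic_map (subtopology (prod_topology T T') U) (top_of_set (\<phi> ` U)) \<phi>"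
    using u v by (simp add: c im openin_prod_Times_iff open_Times)
next
  have "\<Union> (fst ` prod_atlas A A') = \<Union> (fst ` A) \<times> \<Union> (fst ` A')"
    by (force simp: prod_atlas_def)
  then show "\<Union> (fst ` prod_atlas A A') = topspace (prod_topology T T')"
    using assms by (simp add: topological_atlas_def)
qed

lemma smooth_mapD:
  assumes "smooth_map A A' f" "(U, \<phi>) \<in> A" "(V, \<psi>) \<in> A'"
  shows "smooth_on_open (\<lambda>x. \<psi> (f (inv_into U \<phi> x))) (\<phi> ` (U \<inter> f -` V))"
  using assms by (auto simp: smooth_map_def o_def)

lemma smooth_mapI:
  assumes "\<And>U \<phi> V \<psi>. (U, \<phi>) \<in> A \<Longrightarrow> (V, \<psi>) \<in> A' \<Longrightarrow>
    smooth_on_open (\<lambda>x. \<psi> (f (inv_into U \<phi> x))) (\<phi> ` (U \<inter> f -` V))"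
  shows "smooth_map A A' f"
  using assms by (auto simp: smooth_map_def o_def)

lemma smooth_map_continuous:
  assumes A: "topological_atlas T A" and A': "topological_atlas T' A'"
    and f: "smooth_map A A' f" and fT: "f ` topspace T \<subseteq> topspace T'"
  shows "continuous_map T T' f"
  unfolding continuous_map_def
proof (intro conjI allI impI)
  show "f \<in> topspace T \<rightarrow> topspace T'" using fT by auto
  fix W assume W: "openin T' W"
  show "openin T {x \<in> topspace T. f x \<in> W}"
  proof (subst openin_subopen, intro ballI)
    fix x assume "x \<in> {x \<in> topspace T. f x \<in> W}"
    then have x: "x \<in> topspace T" "f x \<in> W" by auto
    obtain U \<phi> where U: "(U, \<phi>) \<in> A" "x \<in> U" using topological_atlas_cover[OF A x(1)] .
    have "f x \<in> topspace T'" using x fT by auto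
    then obtain V \<psi> where V: "(V, \<psi>) \<in> A'" "f x \<in> V" by (rule topological_atlas_cover[OF A'])
    note u = topological_atlasD[OF A U(1)] and v = topological_atlasD[OF A' V(1)]
    let ?F = "\<lambda>x. \<psi> (f (inv_into U \<phi> x))" and ?O = "\<phi> ` (U \<inter> f -` V)"
    have "open (?O \<inter> ?F -` (\<psi> ` (V \<inter> W)))"
      by (rule smooth_on_open_preimage[OF smooth_mapD[OF f U(1) V(1)] chart_image_open[OF A' V(1) W]])
    from chart_preimage_open[OF A U(1) this]
    have "openin T {y \<in> U. \<phi> y \<in> ?O \<inter> ?F -` (\<psi> ` (V \<inter> W))}" .
    moreover have "x \<in> {y \<in> U. \<phi> y \<in> ?O \<inter> ?F -` (\<psi> ` (V \<inter> W))}"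
      using U V x u(4) by auto
    moreover have "{y \<in> U. \<phi> y \<in> ?O \<inter> ?F -` (\<psi> ` (V \<inter> W))} \<subseteq> {x \<in> topspace T. f x \<in> W}"
    proof
      fix y assume "y \<in> {y \<in> U. \<phi> y \<in> ?O \<inter> ?F -` (\<psi> ` (V \<inter> W))}"
      then have y: "y \<in> U" "\<phi> y \<in> ?O" "?F (\<phi> y) \<in> \<psi> ` (V \<inter> W)" by auto
      have "f y \<in> V" using y(1,2) u(4) by (auto simp: inj_on_def)
      moreover have "\<psi> (f y) \<in> \<psi> ` (V \<inter> W)" using y u(4) by simp
      ultimately have "f y \<in> W" using v(4) by (auto simp: inj_on_def)
      then show "y \<in> {x \<in> topspace T. f x \<in> W}" using y(1) openin_subset[OF u(1)] by auto
    qed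
    ultimately show "\<exists>S. openin T S \<and> x \<in> S \<and> S \<subseteq> {x \<in> topspace T. f x \<in> W}" by blast
  qed
qed

text \<open>The image of a chart domain need not lie in one chart domain. It is covered by the parts
  that are mapped into a fixed one, where the chain rule for functions applies.\<close>

lemma smooth_map_compose:
  fixes A :: "('a, 'e::real_normed_vector) chart set" and A' :: "('b, 'f::real_normed_vector) chart set"
  assumes fd: "finite_dimensional_set (UNIV :: 'f set)"
    and A: "topological_atlas T A" and A': "topological_atlas T' A'"
    and f: "smooth_map A A' f" and g: "smooth_map A' A'' g"
    and fT: "f ` topspace T \<subseteq> topspace T'"
  shows "smooth_map A A'' (\<lambda>x. g (f x))"
proof (rule smooth_mapI)
  fix U \<phi> W \<omega> assume U: "(U, \<phi>) \<in> A" and W: "(W, \<omega>) \<in> A''"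
  note u = topological_atlasD[OF A U]
  let ?F = "\<lambda>\<psi> x. \<psi> (f (inv_into U \<phi> x))" and ?G = "\<lambda>V \<psi> y. \<omega> (g (inv_into V \<psi> y))"
  let ?S = "\<lambda>(V, \<psi>). \<phi> ` (U \<inter> f -` V) \<inter> ?F \<psi> -` (\<psi> ` (V \<inter> g -` W))"
  have "smooth_on_open (\<lambda>x. \<omega> (g (f (inv_into U \<phi> x)))) (\<Union>c\<in>A'. ?S c)"
  proof (rule smooth_on_open_UN)
    fix c assume "c \<in> A'"
    then obtain V \<psi> where c: "c = (V, \<psi>)" and V: "(V, \<psi>) \<in> A'" by (cases c) auto
    note v = topological_atlasD[OF A' V]
    have "smooth_on_open (\<lambda>x. ?G V \<psi> (?F \<psi> x)) (?S c)"
      unfolding c prod.case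
      by (rule smooth_on_open_compose[OF fd smooth_mapD[OF f U V] smooth_mapD[OF g V W]])
    then show "smooth_on_open (\<lambda>x. \<omega> (g (f (inv_into U \<phi> x)))) (?S c)"
    proof (rule smooth_on_open_cong)
      fix z assume "z \<in> ?S c"
      then obtain x where "x \<in> U" "f x \<in> V" "z = \<phi> x" by (auto simp: c)
      then show "?G V \<psi> (?F \<psi> z) = \<omega> (g (f (inv_into U \<phi> z)))" using u(4) v(4) by simp
    qed
  qed
  also have "(\<Union>c\<in>A'. ?S c) = \<phi> ` (U \<inter> (\<lambda>x. g (f x)) -` W)"
  proof (intro subset_antisym subsetI)
    fix z assume "z \<in> (\<Union>c\<in>A'. ?S c)"
    then obtain V \<psi> where V: "(V, \<psi>) \<in> A'" and z: "z \<in> \<phi> ` (U \<inter> f -` V)" "?F \<psi> z \<in> \<psi> ` (V \<inter> g -` W)"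
      by auto
    note v = topological_atlasD[OF A' V]
    from z(1) obtain x where x: "x \<in> U" "f x \<in> V" "z = \<phi> x" by auto
    with z(2) u(4) have "\<psi> (f x) \<in> \<psi> ` (V \<inter> g -` W)" by simp
    then have "g (f x) \<in> W" using x v(4) by (auto simp: inj_on_def)
    then show "z \<in> \<phi> ` (U \<inter> (\<lambda>x. g (f x)) -` W)" using x by auto
  next
    fix z assume "z \<in> \<phi> ` (U \<inter> (\<lambda>x. g (f x)) -` W)"
    then obtain x where x: "x \<in> U" "g (f x) \<in> W" "z = \<phi> x" by auto
    have "x \<in> topspace T" using x(1) openin_subset[OF u(1)] by auto
    then have "f x \<in> topspace T'" using fT by auto
    then obtain V \<psi> where V: "(V, \<psi>) \<in> A'" "f x \<in> V" by (rule topological_atlas_cover[OF A'])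
    have "z \<in> ?S (V, \<psi>)" using x V u(4) by auto
    then show "z \<in> (\<Union>c\<in>A'. ?S c)" using V by blast
  qed
  finally show "smooth_on_open (\<lambda>x. \<omega> (g (f (inv_into U \<phi> x)))) (\<phi> ` (U \<inter> (\<lambda>x. g (f x)) -` W))" .
qed

lemma inv_into_map_prod:
  assumes "inj_on \<phi> U" "inj_on \<psi> V" "z \<in> \<phi> ` U \<times> \<psi> ` V"
  shows "inv_into (U \<times> V) (map_prod \<phi> \<psi>) z = (inv_into U \<phi> (fst z), inv_into V \<psi> (snd z))"
proof -
  obtain x y where xy: "x \<in> U" "y \<in> V" "z = map_prod \<phi> \<psi> (x, y)" using assms(3) by auto
  have "inj_on (map_prod \<phi> \<psi>) (U \<times> V)" using assms by (auto simp: inj_on_def)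
  then show ?thesis unfolding xy(3) using assms xy by (subst inv_into_f_f) auto
qed

lemma smooth_map_Pair:
  assumes A: "topological_atlas T A" and f: "smooth_map A A1 f" and g: "smooth_map A A2 g"
  shows "smooth_map A (prod_atlas A1 A2) (\<lambda>x. (f x, g x))"
proof (rule smooth_mapI)
  fix U \<phi> W \<omega> assume U: "(U, \<phi>) \<in> A" and "(W, \<omega>) \<in> prod_atlas A1 A2"
  then obtain V1 \<psi>1 V2 \<psi>2 where W: "W = V1 \<times> V2" "\<omega> = map_prod \<psi>1 \<psi>2"
    and V: "(V1, \<psi>1) \<in> A1" "(V2, \<psi>2) \<in> A2" by (auto simp: prod_atlas_def)
  note u = topological_atlasD[OF A U] and s1 = smooth_mapD[OF f U V(1)] and s2 = smooth_mapD[OF g U V(2)]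
  have eq: "\<phi> ` (U \<inter> (\<lambda>x. (f x, g x)) -` W) = \<phi> ` (U \<inter> f -` V1) \<inter> \<phi> ` (U \<inter> g -` V2)"
    using u(4) unfolding W by (auto simp: inj_on_def)
  have o: "open (\<phi> ` (U \<inter> f -` V1) \<inter> \<phi> ` (U \<inter> g -` V2))"
    using s1 s2 by (auto simp: smooth_on_open_def)
  show "smooth_on_open (\<lambda>x. \<omega> (f (inv_into U \<phi> x), g (inv_into U \<phi> x))) (\<phi> ` (U \<inter> (\<lambda>x. (f x, g x)) -` W))"
    unfolding eq unfolding W map_prod_simp smooth_on_open_def
    using o s1 s2 by (auto intro!: Ck_on_Pair intro: Ck_on_subset simp: smooth_on_open_def)
qed

lemma smooth_map_const:
  assumes "topological_atlas T A"
  shows "smooth_map A A' (\<lambda>_. c)"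
proof (rule smooth_mapI)
  fix U \<phi> V \<psi> assume "(U, \<phi>) \<in> A"
  from topological_atlasD[OF assms this] have "open (\<phi> ` (U \<inter> (\<lambda>_. c) -` V))"
    by (cases "c \<in> V") auto
  then show "smooth_on_open (\<lambda>x. \<psi> c) (\<phi> ` (U \<inter> (\<lambda>_. c) -` V))"
    by (simp add: smooth_on_open_def Ck_on_const)
qed

lemma smooth_map_fst:
  fixes A1 :: "('a, 'e::real_normed_vector) chart set" and A2 :: "('b, 'f::real_normed_vector) chart set"
  assumes fd: "finite_dimensional_set (UNIV :: 'e set)"
    and A1: "smooth_atlas T1 A1" and A2: "topological_atlas T2 A2"
  shows "smooth_map (prod_atlas A1 A2) A1 fst"
proof (rule smooth_mapI)
  fix W \<omega> V \<psi> assume "(W, \<omega>) \<in> prod_atlas A1 A2" and V: "(V, \<psi>) \<in> A1"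
  then obtain U1 \<phi>1 U2 \<phi>2 where W: "W = U1 \<times> U2" "\<omega> = map_prod \<phi>1 \<phi>2"
    and U: "(U1, \<phi>1) \<in> A1" "(U2, \<phi>2) \<in> A2" by (auto simp: prod_atlas_def)
  note u1 = topological_atlasD[OF smooth_atlas_topological[OF A1] U(1)] and u2 = topological_atlasD[OF A2 U(2)]
  have s: "smooth_on_open (\<lambda>x. \<psi> (inv_into U1 \<phi>1 x)) (\<phi>1 ` (U1 \<inter> V))"
    using A1 smooth_mapD[of A1 A1 "\<lambda>x. x", OF _ U(1) V] by (simp add: smooth_atlas_def)
  have "smooth_on_open (\<lambda>z :: 'e \<times> 'f. \<psi> (inv_into U1 \<phi>1 (fst z))) (UNIV \<inter> fst -` (\<phi>1 ` (U1 \<inter> V)))"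
    by (intro smooth_on_open_compose[OF fd _ s])
      (simp add: smooth_on_open_def Ck_on_linear bounded_linear_fst)
  moreover have eq: "\<omega> ` (W \<inter> fst -` V) = \<phi>1 ` (U1 \<inter> V) \<times> \<phi>2 ` U2"
    unfolding W by force
  moreover have "open (\<phi>1 ` (U1 \<inter> V) \<times> \<phi>2 ` U2)"
    using s u2 by (auto intro: open_Times simp: smooth_on_open_def)
  ultimately have "smooth_on_open (\<lambda>z :: 'e \<times> 'f. \<psi> (inv_into U1 \<phi>1 (fst z))) (\<omega> ` (W \<inter> fst -` V))"
    by (elim smooth_on_open_subset) auto
  then show "smooth_on_open (\<lambda>x. \<psi> (fst (inv_into W \<omega> x))) (\<omega> ` (W \<inter> fst -` V))"
    by (rule smooth_on_open_cong)
      (use inv_into_map_prod[OF u1(4) u2(4)] in \<open>auto simp: eq W\<close>)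
qed

lemma smooth_map_snd:
  fixes A1 :: "('a, 'e::real_normed_vector) chart set" and A2 :: "('b, 'f::real_normed_vector) chart set"
  assumes fd: "finite_dimensional_set (UNIV :: 'f set)"
    and A1: "topological_atlas T1 A1" and A2: "smooth_atlas T2 A2"
  shows "smooth_map (prod_atlas A1 A2) A2 snd"
proof (rule smooth_mapI)
  fix W \<omega> V \<psi> assume "(W, \<omega>) \<in> prod_atlas A1 A2" and V: "(V, \<psi>) \<in> A2"
  then obtain U1 \<phi>1 U2 \<phi>2 where W: "W = U1 \<times> U2" "\<omega> = map_prod \<phi>1 \<phi>2"
    and U: "(U1, \<phi>1) \<in> A1" "(U2, \<phi>2) \<in> A2" by (auto simp: prod_atlas_def)
  note u1 = topological_atlasD[OF A1 U(1)] and u2 = topological_atlasD[OF smooth_atlas_topological[OF A2] U(2)]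
  have s: "smooth_on_open (\<lambda>x. \<psi> (inv_into U2 \<phi>2 x)) (\<phi>2 ` (U2 \<inter> V))"
    using A2 smooth_mapD[of A2 A2 "\<lambda>x. x", OF _ U(2) V] by (simp add: smooth_atlas_def)
  have "smooth_on_open (\<lambda>z :: 'e \<times> 'f. \<psi> (inv_into U2 \<phi>2 (snd z))) (UNIV \<inter> snd -` (\<phi>2 ` (U2 \<inter> V)))"
    by (intro smooth_on_open_compose[OF fd _ s])
      (simp add: smooth_on_open_def Ck_on_linear bounded_linear_snd)
  moreover have eq: "\<omega> ` (W \<inter> snd -` V) = \<phi>1 ` U1 \<times> \<phi>2 ` (U2 \<inter> V)"
    unfolding W by force
  moreover have "open (\<phi>1 ` U1 \<times> \<phi>2 ` (U2 \<inter> V))"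
    using s u1 by (auto intro: open_Times simp: smooth_on_open_def)
  ultimately have "smooth_on_open (\<lambda>z :: 'e \<times> 'f. \<psi> (inv_into U2 \<phi>2 (snd z))) (\<omega> ` (W \<inter> snd -` V))"
    by (elim smooth_on_open_subset) auto
  then show "smooth_on_open (\<lambda>x. \<psi> (snd (inv_into W \<omega> x))) (\<omega> ` (W \<inter> snd -` V))"
    by (rule smooth_on_open_cong)
      (use inv_into_map_prod[OF u1(4) u2(4)] in \<open>auto simp: eq W\<close>)
qed

section \<open>Curves through the identity of a Lie group\<close>

lemma isCont_eventually_open:
  assumes "isCont f a" "open S" "f a \<in> S"
  shows "\<forall>\<^sub>F x in nhds a. f x \<in> S"
  by (rule topological_tendstoD[OF _ assms(2,3)])
    (use assms(1) in \<open>simp add: isCont_def tendsto_at_iff_tendsto_nhds\<close>)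

lemma has_derivative_chain:
  assumes "(f has_derivative f') (at x)" "(g has_derivative g') (at y)" "f x = y"
  shows "((\<lambda>x. g (f x)) has_derivative (\<lambda>v. g' (f' v))) (at x)"
  using has_derivative_compose[of f f' x UNIV g g'] assms by simp

lemma has_vector_derivative_shift:
  "((\<lambda>h. f (t + h)) has_vector_derivative f') (at 0) \<longleftrightarrow> (f has_vector_derivative f') (at (t :: real))"
proof
  have d: "((\<lambda>s. s - t) has_vector_derivative 1) (at t)" "((\<lambda>h. t + h) has_vector_derivative 1) (at 0)"
    by (auto intro!: derivative_eq_intros)
  show "((\<lambda>h. f (t + h)) has_vector_derivative f') (at 0) \<Longrightarrow> (f has_vector_derivative f') (at t)"
    using vector_diff_chain_at[OF d(1), of "\<lambda>h. f (t + h)" f'] by (simp add: o_def)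
  show "(f has_vector_derivative f') (at t) \<Longrightarrow> ((\<lambda>h. f (t + h)) has_vector_derivative f') (at 0)"
    using vector_diff_chain_at[OF d(2), of f f'] by (simp add: o_def)
qed

context lie_group
begin

abbreviation "T \<equiv> lie_topology G"
abbreviation "U0 \<equiv> fst (base_chart G)"
abbreviation "e0 \<equiv> coords G \<one>"

lemma cancel_left:
  assumes "x \<in> carrier G" "y \<in> carrier G"
  shows "x \<otimes> (inv x \<otimes> y) = y" "inv x \<otimes> (x \<otimes> y) = y"
  using assms by (simp_all flip: m_assoc)

lemma fd: "finite_dimensional_set (UNIV :: 'e set)"
  using finite_dimensional by (auto simp: finite_dimensional_set_def)

lemma fd2: "finite_dimensional_set (UNIV :: ('e \<times> 'e) set)"
  by (rule finite_dimensional_Times[OF fd fd])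

lemma top_atlas: "topological_atlas T (atlas G)"
  by (rule smooth_atlas_topological[OF atlas])

lemma top_atlas2: "topological_atlas (prod_topology T T) (prod_atlas (atlas G) (atlas G))"
  by (rule topological_atlas_prod[OF top_atlas top_atlas])

lemma base_chart: "(U0, coords G) \<in> atlas G"
  using base_chart_in_atlas by (simp add: coords_def)

lemma base_chart2: "(U0 \<times> U0, map_prod (coords G) (coords G)) \<in> prod_atlas (atlas G) (atlas G)"
  unfolding prod_atlas_def using base_chart by blast

lemma open_U0: "openin T U0" and open_coords: "open (coords G ` U0)" and inj_coords: "inj_on (coords G) U0"
  using topological_atlasD[OF top_atlas base_chart] by auto

lemma U0_carrier: "x \<in> U0 \<Longrightarrow> x \<in> carrier G"
  using openin_subset[OF open_U0] topspace_eq by auto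

lemma uncoords_eq: "uncoords G = inv_into U0 (coords G)"
  by (simp add: uncoords_def coords_def)

lemma uncoords_coords: "x \<in> U0 \<Longrightarrow> uncoords G (coords G x) = x"
  using inj_coords by (simp add: uncoords_eq)

lemma coords_uncoords: "y \<in> coords G ` U0 \<Longrightarrow> coords G (uncoords G y) = y"
  by (simp add: uncoords_eq f_inv_into_f)

lemma uncoords_U0: "y \<in> coords G ` U0 \<Longrightarrow> uncoords G y \<in> U0"
  by (simp add: uncoords_eq inv_into_into)

lemma e0: "e0 \<in> coords G ` U0" "uncoords G e0 = \<one>"
  using one_in_base_chart uncoords_coords by auto

lemma smooth_id: "smooth_map (atlas G) (atlas G) (\<lambda>x. x)"
  using atlas by (simp add: smooth_atlas_def)

lemma smooth_map_group_mult:
  assumes A: "topological_atlas TB A" and f: "smooth_map A (atlas G) f" and g: "smooth_map A (atlas G) g"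
    and "f ` topspace TB \<subseteq> carrier G" "g ` topspace TB \<subseteq> carrier G"
  shows "smooth_map A (atlas G) (\<lambda>x. f x \<otimes> g x)"
proof -
  have "smooth_map A (atlas G) (\<lambda>x. (\<lambda>(x, y). x \<otimes> y) (f x, g x))"
    using assms(4,5)
    by (intro smooth_map_compose[OF fd2 A top_atlas2 smooth_map_Pair[OF A f g] smooth_mult])
      (auto simp: topspace_eq)
  then show ?thesis by simp
qed

lemma smooth_map_group_inv:
  assumes A: "topological_atlas TB A" and f: "smooth_map A (atlas G) f"
    and "f ` topspace TB \<subseteq> carrier G"
  shows "smooth_map A (atlas G) (\<lambda>x. inv (f x))"
  using assms(3) by (intro smooth_map_compose[OF fd A top_atlas f smooth_inverse]) (auto simp: topspace_eq)

lemma smooth_bitranslation: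
  assumes "g \<in> carrier G" "h \<in> carrier G"
  shows "smooth_map (atlas G) (atlas G) (\<lambda>x. g \<otimes> x \<otimes> h)"
  by (rule smooth_map_group_mult[OF top_atlas] smooth_map_const[OF top_atlas] smooth_id |
      use assms in \<open>auto simp: topspace_eq\<close>)+

lemma smooth_conj2:
  "smooth_map (prod_atlas (atlas G) (atlas G)) (atlas G) (\<lambda>z. fst z \<otimes> snd z \<otimes> inv (fst z))"
  by (rule smooth_map_group_mult[OF top_atlas2] smooth_map_group_inv[OF top_atlas2]
      smooth_map_fst[OF fd atlas top_atlas] smooth_map_snd[OF fd top_atlas atlas] |
      auto simp: topspace_eq)+

lemma continuous_mult: "continuous_map (prod_topology T T) T (\<lambda>(x, y). x \<otimes> y)"
  by (rule smooth_map_continuous[OF top_atlas2 top_atlas smooth_mult]) (auto simp: topspace_eq)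

lemma continuous_inv: "continuous_map T T (\<lambda>x. inv x)"
  by (rule smooth_map_continuous[OF top_atlas top_atlas smooth_inverse]) (auto simp: topspace_eq)

lemma continuous_bitranslation:
  assumes "g \<in> carrier G" "h \<in> carrier G"
  shows "continuous_map T T (\<lambda>x. g \<otimes> x \<otimes> h)"
  using assms by (intro smooth_map_continuous[OF top_atlas top_atlas smooth_bitranslation]) (auto simp: topspace_eq)

lemma open_bitranslation:
  assumes "g \<in> carrier G" "h \<in> carrier G" "openin T W"
  shows "openin T {x \<in> carrier G. g \<otimes> x \<otimes> h \<in> W}"
  using openin_continuous_map_preimage[OF continuous_bitranslation[OF assms(1,2)] assms(3)]
  by (simp add: topspace_eq)

lemma smooth_in_base_chart:
  assumes f: "smooth_map (atlas G) (atlas G) f" and x: "x \<in> U0" "f x \<in> U0"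
  shows "(\<lambda>y. coords G (f (uncoords G y))) differentiable (at (coords G x))"
proof -
  have "smooth_on_open (\<lambda>y. coords G (f (uncoords G y))) (coords G ` (U0 \<inter> f -` U0))"
    using smooth_mapD[OF f base_chart base_chart] by (simp add: uncoords_eq)
  from smooth_on_open_derivative(1)[OF this] x show ?thesis by (auto simp: differentiable_def)
qed

lemma smooth2_in_base_chart:
  assumes f: "smooth_map (prod_atlas (atlas G) (atlas G)) (atlas G) f"
  shows "smooth_on_open (\<lambda>z. coords G (f (uncoords G (fst z), uncoords G (snd z))))
    (map_prod (coords G) (coords G) ` (U0 \<times> U0 \<inter> f -` U0))"
  by (rule smooth_on_open_cong[OF smooth_mapD[OF f base_chart2 base_chart]])
    (use inv_into_map_prod[OF inj_coords inj_coords] in \<open>auto simp: uncoords_eq\<close>)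

text \<open>The values of the coordinate map outside its domain are arbitrary, so that staying in the
  domain has to be demanded separately.\<close>

definition tangent :: "(real \<Rightarrow> 'a) \<Rightarrow> 'e \<Rightarrow> bool" where
  "tangent \<gamma> X \<longleftrightarrow> \<gamma> 0 = \<one> \<and> (\<forall>\<^sub>F t in nhds 0. \<gamma> t \<in> U0) \<and>
     ((\<lambda>t. coords G (\<gamma> t)) has_vector_derivative X) (at 0)"

definition has_diff_one :: "('a \<Rightarrow> 'f::real_normed_vector) \<Rightarrow> ('e \<Rightarrow> 'f) \<Rightarrow> bool" where
  "has_diff_one F D \<longleftrightarrow> ((\<lambda>y. F (uncoords G y)) has_derivative D) (at e0)"

lemma tangent_unique: "tangent \<gamma> X \<Longrightarrow> tangent \<gamma> Y \<Longrightarrow> X = Y"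
  unfolding tangent_def using vector_derivative_unique_at by blast

lemma tangent_one: "tangent (\<lambda>_. \<one>) 0"
  unfolding tangent_def using one_in_base_chart by simp

lemma tangent_cong:
  assumes "tangent \<gamma> X" "\<forall>\<^sub>F t in nhds 0. \<gamma> t = \<delta> t"
  shows "tangent \<delta> X"
proof -
  have "\<gamma> 0 = \<delta> 0" using assms(2) by (rule eventually_nhds_x_imp_x)
  moreover have "\<forall>\<^sub>F t in nhds 0. \<delta> t \<in> U0"
    using assms unfolding tangent_def by (auto elim: eventually_elim2)
  moreover have "((\<lambda>t. coords G (\<delta> t)) has_vector_derivative X) (at 0)"
  proof -
    obtain S where S: "open S" "0 \<in> S" "\<And>t. t \<in> S \<Longrightarrow> \<gamma> t = \<delta> t"
      using assms(2) by (auto simp: eventually_nhds)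
    then show ?thesis
      using assms(1) by (auto simp: tangent_def intro: has_vector_derivative_transform_within_open[of _ _ _ S])
  qed
  ultimately show ?thesis using assms(1) by (simp add: tangent_def)
qed

lemma tangent_eventually:
  assumes "tangent \<gamma> X" "openin T W" "\<one> \<in> W"
  shows "\<forall>\<^sub>F t in nhds 0. \<gamma> t \<in> W"
proof -
  have cont: "isCont (\<lambda>t. coords G (\<gamma> t)) 0" and ev: "\<forall>\<^sub>F t in nhds 0. \<gamma> t \<in> U0"
    using assms(1) by (auto simp: tangent_def has_vector_derivative_continuous)
  have "open (coords G ` (U0 \<inter> W))" by (rule chart_image_open[OF top_atlas base_chart assms(2)])
  moreover have "coords G (\<gamma> 0) \<in> coords G ` (U0 \<inter> W)"
    using assms one_in_base_chart by (auto simp: tangent_def)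
  ultimately have "\<forall>\<^sub>F t in nhds 0. coords G (\<gamma> t) \<in> coords G ` (U0 \<inter> W)"
    by (intro isCont_eventually_open[OF cont])
  with ev show ?thesis
  proof eventually_elim
    case (elim t)
    then show ?case using inj_coords by (auto simp: inj_on_def)
  qed
qed

lemma has_diff_one_tangent:
  assumes "has_diff_one F D" "tangent \<gamma> X"
  shows "((\<lambda>t. F (\<gamma> t)) has_vector_derivative D X) (at 0)"
proof -
  have d: "((\<lambda>t. coords G (\<gamma> t)) has_vector_derivative X) (at 0)" and "coords G (\<gamma> 0) = e0"
    using assms(2) by (auto simp: tangent_def)
  then have "((\<lambda>t. F (uncoords G (coords G (\<gamma> t)))) has_vector_derivative D X) (at 0)"
    using assms(1) has_derivative_compose[of "\<lambda>t. coords G (\<gamma> t)" "\<lambda>h. h *\<^sub>R X" 0 UNIV "\<lambda>y. F (uncoords G y)" D]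
      linear_scale[OF bounded_linear.linear[OF has_derivative_bounded_linear], of "\<lambda>y. F (uncoords G y)" D]
    unfolding has_vector_derivative_def has_diff_one_def by auto
  moreover obtain S where "open S" "0 \<in> S" "\<And>t. t \<in> S \<Longrightarrow> \<gamma> t \<in> U0"
    using assms(2) by (auto simp: tangent_def eventually_nhds)
  ultimately show ?thesis
    using has_vector_derivative_transform_within_open[of "\<lambda>t. F (uncoords G (coords G (\<gamma> t)))" "D X" 0 S "\<lambda>t. F (\<gamma> t)"]
      uncoords_coords by auto
qed

lemma has_diff_one_diff_one:
  assumes "smooth_map (atlas G) (atlas G) f" "f \<one> = \<one>"
  shows "has_diff_one (\<lambda>x. coords G (f x)) (diff_one G f)"
  using smooth_in_base_chart[OF assms(1) one_in_base_chart] assms(2) one_in_base_chart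
  by (simp add: has_diff_one_def diff_one_def frechet_derivative_works o_def)

lemma tangent_smooth:
  assumes f: "smooth_map (atlas G) (atlas G) f" "f ` carrier G \<subseteq> carrier G" "f \<one> = \<one>"
    and "tangent \<gamma> X"
  shows "tangent (\<lambda>t. f (\<gamma> t)) (diff_one G f X)"
proof -
  have "continuous_map T T f"
    using f by (intro smooth_map_continuous[OF top_atlas top_atlas]) (auto simp: topspace_eq)
  then have "openin T {x \<in> carrier G. f x \<in> U0}"
    using openin_continuous_map_preimage[OF _ open_U0] topspace_eq by fastforce
  from tangent_eventually[OF assms(4) this] f one_in_base_chart
  have "\<forall>\<^sub>F t in nhds 0. f (\<gamma> t) \<in> U0" by (simp add: eventually_conj_iff)
  moreover have "((\<lambda>t. coords G (f (\<gamma> t))) has_vector_derivative diff_one G f X) (at 0)"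
    by (rule has_diff_one_tangent[OF has_diff_one_diff_one[OF f(1,3)] assms(4)])
  ultimately show ?thesis using assms by (simp add: tangent_def)
qed

definition coord_mult :: "'e \<times> 'e \<Rightarrow> 'e" where
  "coord_mult z = coords G (uncoords G (fst z) \<otimes> uncoords G (snd z))"

definition coord_mult_domain :: "('e \<times> 'e) set" where
  "coord_mult_domain = map_prod (coords G) (coords G) ` (U0 \<times> U0 \<inter> (\<lambda>(x, y). x \<otimes> y) -` U0)"

lemma smooth_coord_mult: "smooth_on_open coord_mult coord_mult_domain"
  using smooth2_in_base_chart[OF smooth_mult]
  by (simp add: coord_mult_def[abs_def] coord_mult_domain_def)

lemma coord_mult_domain_e0: "y \<in> coords G ` U0 \<Longrightarrow> (y, e0) \<in> coord_mult_domain"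
  "y \<in> coords G ` U0 \<Longrightarrow> (e0, y) \<in> coord_mult_domain"
  using one_in_base_chart U0_carrier by (force simp: coord_mult_domain_def)+

lemma coord_mult_e0: "y \<in> coords G ` U0 \<Longrightarrow> coord_mult (y, e0) = y"
  "y \<in> coords G ` U0 \<Longrightarrow> coord_mult (e0, y) = y"
  using e0 U0_carrier uncoords_U0 coords_uncoords by (auto simp: coord_mult_def)

text \<open>Both partial maps are the identity, because \<open>\<one>\<close> is neutral.\<close>

lemma has_derivative_coord_mult:
  "(coord_mult has_derivative (\<lambda>(v, w). v + w)) (at (e0, e0))"
proof -
  let ?D = "frechet_derivative coord_mult (at (e0, e0))"
  have D: "(coord_mult has_derivative ?D) (at (e0, e0))"
    by (rule smooth_on_open_derivative(1)[OF smooth_coord_mult coord_mult_domain_e0(1)[OF e0(1)]])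
  have id: "((\<lambda>y. y) has_derivative (\<lambda>v. v)) (at e0)" by (rule has_derivative_ident)
  have "((\<lambda>y. coord_mult (e0, y)) has_derivative (\<lambda>v. v)) (at e0)"
    "((\<lambda>y. coord_mult (y, e0)) has_derivative (\<lambda>v. v)) (at e0)"
    by (rule has_derivative_transform_within_open[OF id open_coords e0(1)]; simp add: coord_mult_e0)+
  then have "(\<lambda>v. ?D (0, v)) = (\<lambda>v. v)" "(\<lambda>v. ?D (v, 0)) = (\<lambda>v. v)"
    using partial_derivative[OF D] has_derivative_unique by blast+
  then have D0: "?D (0, w) = w" "?D (v, 0) = v" for v w by meson+
  have "?D z = (\<lambda>(v, w). v + w) z" for z
  proof (cases z)
    case (Pair v w)
    have "?D ((v, 0) + (0, w)) = ?D (v, 0) + ?D (0, w)"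
      by (rule linear_add[OF bounded_linear.linear[OF has_derivative_bounded_linear[OF D]]])
    also have "\<dots> = v + w" unfolding D0 ..
    finally show ?thesis unfolding Pair by simp
  qed
  then have "?D = (\<lambda>(v, w). v + w)" by (rule ext)
  with D show ?thesis by (simp only:)
qed

lemma tangent_mult:
  assumes "tangent \<gamma> X" "tangent \<delta> Y"
  shows "tangent (\<lambda>t. \<gamma> t \<otimes> \<delta> t) (X + Y)"
proof -
  have d: "((\<lambda>t. coords G (\<gamma> t)) has_vector_derivative X) (at 0)"
    "((\<lambda>t. coords G (\<delta> t)) has_vector_derivative Y) (at 0)" "\<gamma> 0 = \<one>" "\<delta> 0 = \<one>"
    and ev: "\<forall>\<^sub>F t in nhds 0. \<gamma> t \<in> U0" "\<forall>\<^sub>F t in nhds 0. \<delta> t \<in> U0"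
    using assms by (auto simp: tangent_def)
  have op: "open coord_mult_domain" using smooth_coord_mult by (simp add: smooth_on_open_def)
  have "((\<lambda>t. (coords G (\<gamma> t), coords G (\<delta> t))) has_derivative (\<lambda>h. (h *\<^sub>R X, h *\<^sub>R Y))) (at 0)"
    using has_derivative_Pair d unfolding has_vector_derivative_def by blast
  moreover from this have "isCont (\<lambda>t. (coords G (\<gamma> t), coords G (\<delta> t))) 0"
    by (rule has_derivative_continuous)
  then have "\<forall>\<^sub>F t in nhds 0. (coords G (\<gamma> t), coords G (\<delta> t)) \<in> coord_mult_domain"
    by (rule isCont_eventually_open[OF _ op]) (use coord_mult_domain_e0(1)[OF e0(1)] d(3,4) in simp)
  with ev have ev2: "\<forall>\<^sub>F t in nhds 0. \<gamma> t \<otimes> \<delta> t \<in> U0 \<and> coord_mult (coords G (\<gamma> t), coords G (\<delta> t)) = coords G (\<gamma> t \<otimes> \<delta> t)"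
  proof eventually_elim
    case (elim t)
    then have "\<gamma> t \<otimes> \<delta> t \<in> U0"
      using inj_coords by (auto simp: coord_mult_domain_def inj_on_def)
    then show ?case using elim by (simp add: coord_mult_def uncoords_coords)
  qed
  then obtain S where S: "open S" "0 \<in> S" "\<And>t. t \<in> S \<Longrightarrow>
      coord_mult (coords G (\<gamma> t), coords G (\<delta> t)) = coords G (\<gamma> t \<otimes> \<delta> t)"
    by (auto simp: eventually_nhds)
  have "((\<lambda>t. coord_mult (coords G (\<gamma> t), coords G (\<delta> t))) has_derivative
      (\<lambda>h. (\<lambda>(v, w). v + w) (h *\<^sub>R X, h *\<^sub>R Y))) (at 0)"
    by (rule has_derivative_chain[OF calculation has_derivative_coord_mult]) (simp add: d(3,4))
  then have "((\<lambda>t. coord_mult (coords G (\<gamma> t), coords G (\<delta> t))) has_vector_derivative (X + Y)) (at 0)"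
    by (simp add: has_vector_derivative_def scaleR_add_right)
  from has_vector_derivative_transform_within_open[OF this S] ev2 d(3,4)
  show ?thesis by (simp add: tangent_def eventually_conj_iff)
qed

lemma tangent_inv:
  assumes "tangent \<gamma> X"
  shows "tangent (\<lambda>t. inv (\<gamma> t)) (- X)"
proof -
  have t: "tangent (\<lambda>t. inv (\<gamma> t)) (diff_one G (\<lambda>x. inv x) X)"
    using assms by (intro tangent_smooth smooth_inverse) auto
  from tangent_mult[OF assms this]
  have "tangent (\<lambda>t. \<gamma> t \<otimes> inv (\<gamma> t)) (X + diff_one G (\<lambda>x. inv x) X)" .
  moreover have "\<forall>\<^sub>F t in nhds 0. \<gamma> t \<otimes> inv (\<gamma> t) = \<one>"
    using assms by (auto simp: tangent_def U0_carrier elim: eventually_mono)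
  ultimately have "tangent (\<lambda>_. \<one>) (X + diff_one G (\<lambda>x. inv x) X)" by (rule tangent_cong)
  then have "X + diff_one G (\<lambda>x. inv x) X = 0" using tangent_one tangent_unique by blast
  then show ?thesis using t by (simp add: add_eq_0_iff)
qed

section \<open>One-parameter subgroups and the exponential map\<close>

definition log_derivative :: "(real \<Rightarrow> 'a) \<Rightarrow> real \<Rightarrow> 'e \<Rightarrow> bool" where
  "log_derivative \<gamma> t X \<longleftrightarrow> tangent (\<lambda>h. inv (\<gamma> t) \<otimes> \<gamma> (t + h)) X"

text \<open>The velocity of \<open>\<gamma> \<delta>\<inverse>\<close> at \<open>t\<close> is the image of \<open>X - X\<close> under the differential of the
  bitranslation \<open>x \<mapsto> \<gamma>(t) x \<delta>(t)\<inverse>\<close>.\<close>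

lemma equal_log_derivative_ratio_constant:
  assumes "\<And>t. t \<in> {-r<..<r} \<Longrightarrow> \<gamma> t \<in> carrier G \<and> \<delta> t \<in> carrier G"
    and "\<And>t. t \<in> {-r<..<r} \<Longrightarrow> log_derivative \<gamma> t X \<and> log_derivative \<delta> t X"
    and "\<And>t. t \<in> {-r<..<r} \<Longrightarrow> \<gamma> t \<otimes> inv (\<delta> t) \<in> U0"
    and t: "t \<in> {-r<..<r}"
  shows "\<gamma> t \<otimes> inv (\<delta> t) = \<gamma> 0 \<otimes> inv (\<delta> 0)"
proof -
  let ?w = "\<lambda>t. \<gamma> t \<otimes> inv (\<delta> t)"
  have "((\<lambda>t. coords G (?w t)) has_vector_derivative 0) (at t within {-r<..<r})" if t: "t \<in> {-r<..<r}" for t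
  proof -
    note c = assms(1)[OF t]
    let ?f = "\<lambda>x. \<gamma> t \<otimes> x \<otimes> inv (\<delta> t)"
    have "(\<lambda>y. coords G (?f (uncoords G y))) differentiable (at e0)"
      using c assms(3)[OF t] by (intro smooth_in_base_chart smooth_bitranslation one_in_base_chart) auto
    then obtain D where D: "has_diff_one (\<lambda>x. coords G (?f x)) D"
      by (auto simp: has_diff_one_def differentiable_def)
    let ?c = "\<lambda>h. (inv (\<gamma> t) \<otimes> \<gamma> (t + h)) \<otimes> inv (inv (\<delta> t) \<otimes> \<delta> (t + h))"
    have "tangent ?c (X + - X)"
      using assms(2)[OF t] unfolding log_derivative_def by (intro tangent_mult tangent_inv) auto
    then have "tangent ?c 0" by simp
    from has_diff_one_tangent[OF D this]
    have "((\<lambda>h. coords G (?f (?c h))) has_vector_derivative 0) (at 0)"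
      using linear_0[OF bounded_linear.linear[OF has_derivative_bounded_linear[OF D[unfolded has_diff_one_def]]]]
      by simp
    moreover have "open {-r - t<..<r - t}" "0 \<in> {-r - t<..<r - t}" using t by auto
    moreover have "coords G (?f (?c h)) = coords G (?w (t + h))" if "h \<in> {-r - t<..<r - t}" for h
    proof -
      have "\<gamma> (t + h) \<in> carrier G" "\<delta> (t + h) \<in> carrier G" using assms(1)[of "t + h"] that by auto
      then have "?f (?c h) = ?w (t + h)" using c by (simp add: m_assoc inv_mult_group cancel_left)
      then show ?thesis by simp
    qed
    ultimately have "((\<lambda>h. coords G (?w (t + h))) has_vector_derivative 0) (at 0)"
      by (rule has_vector_derivative_transform_within_open)
    then have "((\<lambda>s. coords G (?w s)) has_vector_derivative 0) (at t)"
      using has_vector_derivative_shift[of "\<lambda>t. coords G (?w t)" t 0] by simp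
    then show ?thesis by (rule has_vector_derivative_at_within)
  qed
  then have "coords G (?w t) = coords G (?w 0)"
    using has_vector_derivative_zero_constant[of "{-r<..<r}" "\<lambda>t. coords G (?w t)"] t by force
  moreover have "0 \<in> {-r<..<r}" using t by auto
  ultimately show ?thesis using assms(3) t inj_coords by (metis inj_onD)
qed

lemma one_parameter_subgroupD:
  assumes "one_parameter_subgroup G X \<gamma>"
  shows "\<gamma> t \<in> carrier G" "\<gamma> (s + t) = \<gamma> s \<otimes> \<gamma> t" "\<gamma> 0 = \<one>" "tangent \<gamma> X"
    "inv (\<gamma> t) = \<gamma> (- t)" "log_derivative \<gamma> t X"
proof -
  have c: "continuous_map euclideanreal T \<gamma>"
    and d: "((\<lambda>t. coords G (\<gamma> t)) has_vector_derivative X) (at 0)"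
    and add: "\<gamma> (s + t) = \<gamma> s \<otimes> \<gamma> t" for s t
    using assms by (auto simp: one_parameter_subgroup_def o_def)
  show "\<gamma> (s + t) = \<gamma> s \<otimes> \<gamma> t" by (rule add)
  have car: "\<gamma> t \<in> carrier G" for t using c topspace_eq by (auto simp: continuous_map_def)
  then show "\<gamma> t \<in> carrier G" .
  show one: "\<gamma> 0 = \<one>" using add[of 0 0] car[of 0] by (metis add_0 l_cancel_one')
  have "open (\<gamma> -` U0)"
    using openin_continuous_map_preimage[OF c open_U0] by (simp add: vimage_def)
  then have "\<forall>\<^sub>F t in nhds 0. \<gamma> t \<in> U0"
    using one one_in_base_chart eventually_nhds_in_open[of "\<gamma> -` U0" 0] by simp
  then show tan: "tangent \<gamma> X" using one d by (simp add: tangent_def)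
  show iv: "inv (\<gamma> t) = \<gamma> (- t)"
    using add[of "- t" t] one car by (intro inv_equality) auto
  have "inv (\<gamma> t) \<otimes> \<gamma> (t + h) = \<gamma> h" for h
    using add[of "- t" "t + h"] by (simp add: iv)
  then show "log_derivative \<gamma> t X" using tan by (simp add: log_derivative_def)
qed

lemma one_parameter_subgroup_pow:
  assumes "one_parameter_subgroup G X \<gamma>"
  shows "\<gamma> (real n * t) = \<gamma> t [^] n"
proof (induction n)
  case 0
  then show ?case using one_parameter_subgroupD(3)[OF assms] by simp
next
  case (Suc n)
  then show ?case using one_parameter_subgroupD(2)[OF assms, of "real n * t" t] by (simp add: algebra_simps)
qed

text \<open>The ratio of the two subgroups is constant near \<open>0\<close>, and a one-parameter subgroup is
  determined by its germ at \<open>0\<close>.\<close>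

lemma one_parameter_subgroup_unique:
  assumes g: "one_parameter_subgroup G X \<gamma>" and d: "one_parameter_subgroup G X \<delta>"
  shows "\<gamma> = \<delta>"
proof
  fix t
  note g' = one_parameter_subgroupD[OF g] and d' = one_parameter_subgroupD[OF d]
  have "tangent (\<lambda>t. \<gamma> t \<otimes> inv (\<delta> t)) (X + - X)"
    by (intro tangent_mult tangent_inv g'(4) d'(4))
  then have "\<forall>\<^sub>F t in nhds 0. \<gamma> t \<otimes> inv (\<delta> t) \<in> U0" by (simp add: tangent_def)
  then obtain r where r: "r > 0" "\<And>t. dist t 0 < r \<Longrightarrow> \<gamma> t \<otimes> inv (\<delta> t) \<in> U0"
    by (auto simp: eventually_nhds_metric)
  have loc: "\<gamma> s = \<delta> s" if s: "s \<in> {-r<..<r}" for s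
  proof -
    have "\<gamma> s \<otimes> inv (\<delta> s) = \<gamma> 0 \<otimes> inv (\<delta> 0)"
      by (rule equal_log_derivative_ratio_constant[OF _ _ _ s])
        (use g'(1,6) d'(1,6) r(2) in \<open>auto simp: dist_real_def\<close>)
    also have "\<dots> = \<one>" by (simp add: g' d')
    finally show ?thesis using g'(1) d'(1) by (metis inv_closed inv_equality inv_inv)
  qed
  obtain n :: nat where n: "\<bar>t\<bar> / r < real n" using reals_Archimedean2 by blast
  then have "n > 0" using r by (cases n) (auto simp: field_simps)
  have "\<bar>t / real n\<bar> < r" using n r \<open>n > 0\<close> by (simp add: field_simps)
  then have "- r < t / real n" "t / real n < r" by linarith+
  then have "\<gamma> (t / real n) = \<delta> (t / real n)" by (intro loc) simp
  then have "\<gamma> (real n * (t / real n)) = \<delta> (real n * (t / real n))"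
    by (simp only: one_parameter_subgroup_pow[OF g] one_parameter_subgroup_pow[OF d])
  then show "\<gamma> t = \<delta> t" using \<open>n > 0\<close> by simp
qed

text \<open>The curve solves the differential equation of the left-invariant vector field \<open>V\<close> of \<open>X\<close> in the
  base chart. Translating it back to the identity inverts the differential that defines \<open>V\<close>.\<close>

lemma local_integral_curve:
  obtains r \<gamma> where "r > 0" "\<gamma> 0 = \<one>" "tangent \<gamma> X"
    "\<And>t. t \<in> {-r<..<r} \<Longrightarrow> \<gamma> t \<in> U0 \<and> log_derivative \<gamma> t X"
proof -
  define V where "V x = frechet_derivative coord_mult (at (x, e0)) (0, X)" for x
  have "{x. (x, e0) \<in> coord_mult_domain} = coords G ` U0"
    using coord_mult_domain_e0 by (auto simp: coord_mult_domain_def)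
  then have "smooth_on_open V (coords G ` U0)"
    using smooth_on_open_partial[OF fd fd smooth_coord_mult, of e0 X] by (simp add: V_def[abs_def])
  from smooth_on_open_locally_Lipschitz[OF fd this e0(1)]
  obtain \<rho> L where \<rho>: "\<rho> > 0" "L > 0" "cball e0 \<rho> \<subseteq> coords G ` U0"
    "\<And>x y. x \<in> cball e0 \<rho> \<Longrightarrow> y \<in> cball e0 \<rho> \<Longrightarrow> norm (V x - V y) \<le> L * norm (x - y)" by blast
  from picard_fin_dim[OF fd \<rho>(1,2,4)] obtain r x where r: "r > 0" and x: "x 0 = e0"
    "\<And>t. t \<in> {-r<..<r} \<Longrightarrow> x t \<in> cball e0 \<rho> \<and> (x has_vector_derivative V (x t)) (at t)" by blast
  define \<gamma> where "\<gamma> t = uncoords G (x t)" for t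
  have xU: "x t \<in> coords G ` U0" if "t \<in> {-r<..<r}" for t using x(2)[OF that] \<rho>(3) by blast
  have gU: "\<gamma> t \<in> U0" "coords G (\<gamma> t) = x t" if "t \<in> {-r<..<r}" for t
    using xU[OF that] by (auto simp: \<gamma>_def uncoords_U0 coords_uncoords)
  have ld: "log_derivative \<gamma> t X" if t: "t \<in> {-r<..<r}" for t
  proof -
    define g where "g = \<gamma> t"
    have g: "g \<in> U0" "g \<in> carrier G" "coords G g = x t" using gU[OF t] U0_carrier by (auto simp: g_def)
    let ?k = "\<lambda>y. coords G (inv g \<otimes> uncoords G y)"
    have "(\<lambda>y. coords G ((\<lambda>z. inv g \<otimes> z \<otimes> \<one>) (uncoords G y))) differentiable (at (coords G g))"
      by (rule smooth_in_base_chart) (use g one_in_base_chart in \<open>auto intro: smooth_bitranslation\<close>)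
    then obtain k' where "((\<lambda>y. coords G (inv g \<otimes> uncoords G y \<otimes> \<one>)) has_derivative k') (at (x t))"
      by (auto simp: differentiable_def g)
    then have k': "(?k has_derivative k') (at (x t))"
      by (rule has_derivative_transform_within_open[OF _ open_coords xU[OF t]])
        (use g U0_carrier uncoords_U0 in auto)
    let ?m' = "frechet_derivative coord_mult (at (x t, e0))"
    have m': "(coord_mult has_derivative ?m') (at (x t, e0))"
      by (rule smooth_on_open_derivative(1)[OF smooth_coord_mult coord_mult_domain_e0(1)[OF xU[OF t]]])
    have "((\<lambda>y. coord_mult (x t, y)) has_derivative (\<lambda>v. ?m' (0, v))) (at e0)"
      by (rule partial_derivative(1)[OF m'])
    moreover have "coord_mult (x t, e0) = x t" using coord_mult_e0 xU[OF t] by simp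
    ultimately have km: "((\<lambda>y. ?k (coord_mult (x t, y))) has_derivative (\<lambda>v. k' (?m' (0, v)))) (at e0)"
      by (intro has_derivative_chain[of "\<lambda>y. coord_mult (x t, y)" _ e0 ?k k' "x t"] k')
    have op: "open {y. (x t, y) \<in> coord_mult_domain}"
    proof -
      have "open (Pair (x t) -` coord_mult_domain)"
        using smooth_coord_mult by (intro open_vimage continuous_intros) (simp add: smooth_on_open_def)
      then show ?thesis by (simp add: vimage_def)
    qed
    have "?k (coord_mult (x t, y)) = y" if y: "(x t, y) \<in> coord_mult_domain" for y
    proof -
      obtain a b where a: "a \<in> U0" "coords G g = coords G a"
        and b: "b \<in> U0" "a \<otimes> b \<in> U0" "y = coords G b"
        using y g(3) by (auto simp: coord_mult_domain_def)
      have "a = g" using inj_onD[OF inj_coords a(2) g(1) a(1)] by simp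
      have "uncoords G (x t) = g" by (simp add: g_def \<gamma>_def)
      then have "?k (coord_mult (x t, y)) = coords G (inv g \<otimes> (g \<otimes> b))"
        using b \<open>a = g\<close> by (simp add: coord_mult_def uncoords_coords)
      also have "inv g \<otimes> (g \<otimes> b) = b" using g(2) U0_carrier[OF b(1)] by (simp add: cancel_left)
      finally show ?thesis using b by simp
    qed
    then have "((\<lambda>y. y) has_derivative (\<lambda>v. k' (?m' (0, v)))) (at e0)"
      by (intro has_derivative_transform_within_open[OF km op])
        (use coord_mult_domain_e0(1)[OF xU[OF t]] in auto)
    then have "k' (?m' (0, v)) = v" for v
      using has_derivative_unique[OF _ has_derivative_ident] by metis
    then have kV: "k' (V (x t)) = X" by (simp add: V_def)
    have "((\<lambda>h. x (t + h)) has_vector_derivative V (x t)) (at 0)"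
      using x(2)[OF t] by (simp add: has_vector_derivative_shift)
    then have dx: "((\<lambda>h. x (t + h)) has_derivative (\<lambda>h. h *\<^sub>R V (x t))) (at 0)"
      by (simp add: has_vector_derivative_def)
    then have "((\<lambda>h. ?k (x (t + h))) has_derivative (\<lambda>h. k' (h *\<^sub>R V (x t)))) (at 0)"
      by (rule has_derivative_chain[OF _ k']) simp
    then have "((\<lambda>h. coords G (inv (\<gamma> t) \<otimes> \<gamma> (t + h))) has_vector_derivative X) (at 0)"
      using linear_scale[OF bounded_linear.linear[OF has_derivative_bounded_linear[OF k']]] kV
      by (simp add: has_vector_derivative_def \<gamma>_def g_def)
    moreover have "\<forall>\<^sub>F h in nhds 0. inv (\<gamma> t) \<otimes> \<gamma> (t + h) \<in> U0"
    proof -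
      have "open (coords G ` (U0 \<inter> {x \<in> carrier G. inv g \<otimes> x \<otimes> \<one> \<in> U0}))"
        using g by (intro chart_image_open[OF top_atlas base_chart] open_bitranslation open_U0) auto
      moreover have "x (t + 0) \<in> coords G ` (U0 \<inter> {x \<in> carrier G. inv g \<otimes> x \<otimes> \<one> \<in> U0})"
        using g one_in_base_chart by (auto intro!: image_eqI[of _ _ g])
      moreover have "isCont (\<lambda>h. x (t + h)) 0" using has_derivative_continuous[OF dx] .
      ultimately have "\<forall>\<^sub>F h in nhds 0. x (t + h) \<in> coords G ` (U0 \<inter> {x \<in> carrier G. inv g \<otimes> x \<otimes> \<one> \<in> U0})"
        using isCont_eventually_open[of 0 "\<lambda>h. x (t + h)"] by blast
      then show ?thesis
      proof eventually_elim
        case (elim h)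
        then obtain y where "x (t + h) = coords G y" "y \<in> U0" "y \<in> carrier G" "inv g \<otimes> y \<otimes> \<one> \<in> U0" by auto
        then show ?case using g(2) by (simp add: \<gamma>_def[of "t + h"] flip: g_def) (simp add: uncoords_coords)
      qed
    qed
    ultimately show ?thesis using g by (simp add: log_derivative_def tangent_def g_def)
  qed
  have g0: "\<gamma> 0 = \<one>" by (simp add: \<gamma>_def x e0)
  then have "tangent \<gamma> X"
  proof -
    have "tangent (\<lambda>h. inv (\<gamma> 0) \<otimes> \<gamma> (0 + h)) X" using ld[of 0] r by (simp add: log_derivative_def)
    moreover have "\<forall>\<^sub>F h in nhds 0. h \<in> {-r<..<r}" using r by (intro eventually_nhds_in_open) auto
    then have "\<forall>\<^sub>F h in nhds 0. inv (\<gamma> 0) \<otimes> \<gamma> (0 + h) = \<gamma> h"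
      by eventually_elim (use gU U0_carrier g0 in auto)
    ultimately show ?thesis by (rule tangent_cong)
  qed
  with r g0 gU ld show ?thesis using that by blast
qed

text \<open>For fixed \<open>s\<close> the curves \<open>t \<mapsto> \<gamma>(s) \<gamma>(t)\<close> and \<open>t \<mapsto> \<gamma>(s + t)\<close> have the same logarithmic
  derivative, so that their ratio is constant. The time is restricted so that the ratio stays in
  the base chart.\<close>

lemma local_one_parameter_subgroup:
  obtains r \<gamma> where "r > 0" "tangent \<gamma> X" "\<And>t. \<bar>t\<bar> < r \<Longrightarrow> \<gamma> t \<in> carrier G"
    "\<And>s t. \<bar>s\<bar> < r \<Longrightarrow> \<bar>t\<bar> < r \<Longrightarrow> \<gamma> (s + t) = \<gamma> s \<otimes> \<gamma> t"
proof -
  obtain r \<gamma> where r: "r > 0" and g0: "\<gamma> 0 = \<one>" and tan: "tangent \<gamma> X"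
    and g: "\<And>t. t \<in> {-r<..<r} \<Longrightarrow> \<gamma> t \<in> U0 \<and> log_derivative \<gamma> t X"
    using local_integral_curve by blast
  define f where "f = (\<lambda>((x, y), z). (x \<otimes> y) \<otimes> inv z)"
  have "continuous_map (prod_topology (prod_topology T T) T) T (\<lambda>w. (\<lambda>(x, y). x \<otimes> y) (fst w))"
    using continuous_map_compose[OF continuous_map_fst[of "prod_topology T T" T] continuous_mult] by (simp only: o_def)
  moreover have "continuous_map (prod_topology (prod_topology T T) T) T (\<lambda>w. inv (snd w))"
    using continuous_map_compose[OF continuous_map_snd[of "prod_topology T T" T] continuous_inv] by (simp only: o_def)
  ultimately have "continuous_map (prod_topology (prod_topology T T) T) (prod_topology T T)
      (\<lambda>w. ((\<lambda>(x, y). x \<otimes> y) (fst w), inv (snd w)))"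
    by (rule continuous_map_pairedI)
  from continuous_map_compose[OF this continuous_mult]
  have "continuous_map (prod_topology (prod_topology T T) T) T
      (\<lambda>w. (\<lambda>(x, y). x \<otimes> y) ((\<lambda>(x, y). x \<otimes> y) (fst w), inv (snd w)))"
    by (simp only: o_def)
  then have "continuous_map (prod_topology (prod_topology T T) T) T f"
    unfolding f_def case_prod_unfold fst_conv snd_conv .
  from openin_continuous_map_preimage[OF this open_U0]
  have "openin (prod_topology (prod_topology T T) T) {w \<in> topspace (prod_topology (prod_topology T T) T). f w \<in> U0}" .
  moreover have "((\<one>, \<one>), \<one>) \<in> {w \<in> topspace (prod_topology (prod_topology T T) T). f w \<in> U0}"
    using one_in_base_chart by (simp add: f_def topspace_eq)
  ultimately obtain P W3 where P: "openin (prod_topology T T) P" "(\<one>, \<one>) \<in> P" and W3: "openin T W3" "\<one> \<in> W3"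
    and sub: "P \<times> W3 \<subseteq> {w \<in> topspace (prod_topology (prod_topology T T) T). f w \<in> U0}"
    unfolding openin_prod_topology_alt[of "prod_topology T T"] by meson
  then obtain W1 W2 where W: "openin T W1" "openin T W2" "\<one> \<in> W1" "\<one> \<in> W2" "W1 \<times> W2 \<subseteq> P"
    unfolding openin_prod_topology_alt[of T] by meson
  have "openin T (W1 \<inter> W2 \<inter> W3)" using W W3 by auto
  then have "\<forall>\<^sub>F t in nhds 0. \<gamma> t \<in> W1 \<inter> W2 \<inter> W3" by (rule tangent_eventually[OF tan]) (use W W3 in auto)
  then obtain d where d: "d > 0" "\<And>t. dist t 0 < d \<Longrightarrow> \<gamma> t \<in> W1 \<inter> W2 \<inter> W3"
    by (auto simp: eventually_nhds_metric)
  define \<rho> where "\<rho> = min (d / 2) (r / 2)"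
  have \<rho>: "\<rho> > 0" using d(1) r by (simp add: \<rho>_def)
  have car: "\<gamma> t \<in> carrier G" if "\<bar>t\<bar> < r" for t using g[of t] that U0_carrier[of "\<gamma> t"] by (simp add: abs_less_iff)
  have hom: "\<gamma> (s + t) = \<gamma> s \<otimes> \<gamma> t" if s: "\<bar>s\<bar> < \<rho>" and t: "\<bar>t\<bar> < \<rho>" for s t
  proof -
    have cs: "\<gamma> s \<in> carrier G" using car s \<rho>_def r by auto
    have "(\<gamma> s \<otimes> \<gamma> t) \<otimes> inv (\<gamma> (s + t)) = (\<gamma> s \<otimes> \<gamma> 0) \<otimes> inv (\<gamma> (s + 0))"
    proof (rule equal_log_derivative_ratio_constant[where \<gamma> = "\<lambda>t. \<gamma> s \<otimes> \<gamma> t" and \<delta> = "\<lambda>t. \<gamma> (s + t)"])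
      show "t \<in> {-\<rho><..<\<rho>}" using t by auto
      fix t assume t: "t \<in> {-\<rho><..<\<rho>}"
      have tr: "t \<in> {-r<..<r}" "s + t \<in> {-r<..<r}" using s t by (auto simp: \<rho>_def abs_less_iff)
      then have ct: "\<gamma> t \<in> carrier G" "\<gamma> (s + t) \<in> carrier G" using g U0_carrier by auto
      show "\<gamma> s \<otimes> \<gamma> t \<in> carrier G \<and> \<gamma> (s + t) \<in> carrier G" using cs ct by simp
      have l: "log_derivative \<gamma> t X" "log_derivative \<gamma> (s + t) X" using g tr by auto
      have "\<forall>\<^sub>F h in nhds 0. h \<in> {-r - t<..<r - t}" using tr by (intro eventually_nhds_in_open) auto
      then have "\<forall>\<^sub>F h in nhds 0. inv (\<gamma> t) \<otimes> \<gamma> (t + h) = inv (\<gamma> s \<otimes> \<gamma> t) \<otimes> (\<gamma> s \<otimes> \<gamma> (t + h))"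
      proof eventually_elim
        case (elim h)
        then have "\<gamma> (t + h) \<in> carrier G" using g[of "t + h"] U0_carrier by auto
        then show ?case using cs ct by (simp add: inv_mult_group m_assoc cancel_left)
      qed
      with l(1) have "log_derivative (\<lambda>t. \<gamma> s \<otimes> \<gamma> t) t X"
        unfolding log_derivative_def by (rule tangent_cong)
      moreover have "log_derivative (\<lambda>t. \<gamma> (s + t)) t X" using l(2) by (simp add: log_derivative_def add.assoc)
      ultimately show "log_derivative (\<lambda>t. \<gamma> s \<otimes> \<gamma> t) t X \<and> log_derivative (\<lambda>t. \<gamma> (s + t)) t X" ..
      have "dist s 0 < d" "dist t 0 < d" "dist (s + t) 0 < d"
        using s t by (auto simp: \<rho>_def dist_real_def abs_less_iff)
      then have "((\<gamma> s, \<gamma> t), \<gamma> (s + t)) \<in> P \<times> W3" using d(2) W(5) by blast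
      then show "\<gamma> s \<otimes> \<gamma> t \<otimes> inv (\<gamma> (s + t)) \<in> U0" using sub by (auto simp: f_def)
    qed
    also have "\<dots> = \<one>" using cs g0 by simp
    finally have "(\<gamma> s \<otimes> \<gamma> t) \<otimes> inv (\<gamma> (s + t)) = \<one>" .
    moreover have "\<gamma> t \<in> carrier G" "\<gamma> (s + t) \<in> carrier G"
      using s t r by (auto simp: \<rho>_def intro!: car)
    ultimately show ?thesis using cs by (metis inv_closed inv_equality inv_inv m_closed)
  qed
  show ?thesis
    by (rule that[OF \<rho> tan _ hom]) (use car r in \<open>auto simp: \<rho>_def\<close>)
qed

text \<open>A local one-parameter subgroup extends by \<open>t \<mapsto> \<gamma>(t/n)\<^sup>n\<close>, which does not depend on
  the large number \<open>n\<close>.\<close>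

lemma one_parameter_subgroup_exists: "\<exists>\<gamma>. one_parameter_subgroup G X \<gamma>"
proof -
  obtain r \<gamma> where r: "r > 0" and tan: "tangent \<gamma> X" and car: "\<And>t. \<bar>t\<bar> < r \<Longrightarrow> \<gamma> t \<in> carrier G"
    and hom: "\<And>s t. \<bar>s\<bar> < r \<Longrightarrow> \<bar>t\<bar> < r \<Longrightarrow> \<gamma> (s + t) = \<gamma> s \<otimes> \<gamma> t"
    using local_one_parameter_subgroup by blast
  have g0: "\<gamma> 0 = \<one>" using tan by (simp add: tangent_def)
  have pow: "\<gamma> (real k * t) = \<gamma> t [^] k" if "\<bar>real k * t\<bar> < r" for k t
    using that
  proof (induction k)
    case 0
    then show ?case by (simp add: g0)
  next
    case (Suc k)
    have le: "\<bar>real k * t\<bar> \<le> \<bar>real (Suc k) * t\<bar>" "\<bar>t\<bar> \<le> \<bar>real (Suc k) * t\<bar>"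
      unfolding abs_mult by (auto simp: mult_right_mono distrib_right)
    then have "\<gamma> (real k * t + t) = \<gamma> (real k * t) \<otimes> \<gamma> t" using Suc.prems by (intro hom) auto
    then show ?case using Suc le by (simp add: algebra_simps)
  qed
  define \<Gamma> where "\<Gamma> t = (let n = Suc (nat \<lceil>\<bar>t\<bar> / r\<rceil>) in \<gamma> (t / real n) [^] n)" for t
  have big: "\<Gamma> t = \<gamma> (t / real n) [^] n" if n: "n > 0" "\<bar>t\<bar> < r * real n" for t n
  proof -
    define N where "N = Suc (nat \<lceil>\<bar>t\<bar> / r\<rceil>)"
    have "\<bar>t\<bar> / r < real N" unfolding N_def by linarith
    then have N: "N > 0" "\<bar>t\<bar> < r * real N" using r by (auto simp: N_def field_simps)
    have small: "\<bar>t / real n\<bar> < r" "\<bar>t / real N\<bar> < r" using n N by (auto simp: field_simps)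
    have e: "real N * (t / (real n * real N)) = t / real n" "real n * (t / (real n * real N)) = t / real N"
      using n N by (auto simp: field_simps)
    have le: "\<bar>t / (real n * real N)\<bar> < r"
    proof -
      have "\<bar>t / (real n * real N)\<bar> = \<bar>t / real n\<bar> / real N" by (simp add: abs_divide)
      also have "\<dots> \<le> \<bar>t / real n\<bar> / 1" using N(1) by (intro divide_left_mono) auto
      finally show ?thesis using small by simp
    qed
    have "\<gamma> (t / real n) [^] n = (\<gamma> (t / (real n * real N)) [^] N) [^] n"
      using pow[of N "t / (real n * real N)"] small e by simp
    also have "\<dots> = (\<gamma> (t / (real n * real N)) [^] n) [^] N"
      using car[OF le] by (simp add: nat_pow_pow mult.commute)
    also have "\<dots> = \<gamma> (t / real N) [^] N"
      using pow[of n "t / (real n * real N)"] small e by simp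
    also have "\<dots> = \<Gamma> t" by (simp add: \<Gamma>_def N_def Let_def)
    finally show ?thesis by simp
  qed
  have loc: "\<Gamma> t = \<gamma> t" if "\<bar>t\<bar> < r" for t using big[of 1 t] that car by simp
  have carG: "\<Gamma> t \<in> carrier G" for t
  proof -
    obtain n :: nat where n: "\<bar>t\<bar> / r < real n" using reals_Archimedean2 by blast
    then have "n > 0" using r by (cases n) (auto simp: field_simps)
    have n2: "\<bar>t\<bar> < r * real n" "\<bar>t / real n\<bar> < r" using n r \<open>n > 0\<close> by (auto simp: field_simps)
    show ?thesis unfolding big[OF \<open>n > 0\<close> n2(1)] using car[OF n2(2)] by simp
  qed
  have add: "\<Gamma> (s + t) = \<Gamma> s \<otimes> \<Gamma> t" for s t
  proof -
    obtain n :: nat where n: "(\<bar>s\<bar> + \<bar>t\<bar>) / r < real n" using reals_Archimedean2 by blast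
    have "n > 0"
    proof (rule ccontr)
      assume "\<not> n > 0"
      then show False using n r by (simp add: divide_less_0_iff)
    qed
    have n2: "\<bar>s\<bar> + \<bar>t\<bar> < r * real n" using n r by (simp add: field_simps)
    then have b: "\<bar>s\<bar> < r * real n" "\<bar>t\<bar> < r * real n" "\<bar>s + t\<bar> < r * real n" by linarith+
    then have sm: "\<bar>s / real n\<bar> < r" "\<bar>t / real n\<bar> < r" using \<open>n > 0\<close> by (auto simp: field_simps)
    have h1: "\<gamma> (s / real n + t / real n) = \<gamma> (s / real n) \<otimes> \<gamma> (t / real n)" using hom sm by blast
    have h2: "\<gamma> (s / real n + t / real n) = \<gamma> (t / real n) \<otimes> \<gamma> (s / real n)"
      using hom[OF sm(2,1)] by (simp add: add.commute)
    have "\<Gamma> (s + t) = \<gamma> (s / real n + t / real n) [^] n"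
      using big[OF \<open>n > 0\<close> b(3)] by (simp add: add_divide_distrib)
    also have "\<dots> = \<gamma> (s / real n) [^] n \<otimes> \<gamma> (t / real n) [^] n"
      unfolding h1 using h1 h2 car sm by (intro pow_mult_distrib) auto
    also have "\<dots> = \<Gamma> s \<otimes> \<Gamma> t" using big[OF \<open>n > 0\<close> b(1)] big[OF \<open>n > 0\<close> b(2)] by simp
    finally show ?thesis .
  qed
  have evr: "\<forall>\<^sub>F t in nhds 0. \<gamma> t = \<Gamma> t"
    unfolding eventually_nhds_metric using r loc by (intro exI[of _ r]) (auto simp: dist_real_def)
  have tanG: "tangent \<Gamma> X" by (rule tangent_cong[OF tan evr])
  have "continuous_map euclideanreal T \<Gamma>"
    unfolding continuous_map_def
  proof (intro conjI allI impI)
    show "\<Gamma> \<in> topspace euclideanreal \<rightarrow> topspace T" using carG topspace_eq by auto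
    fix W assume W: "openin T W"
    have "open {t. \<Gamma> t \<in> W}"
    proof (subst open_subopen, intro ballI)
      fix t0 assume "t0 \<in> {t. \<Gamma> t \<in> W}"
      then have "\<one> \<in> {x \<in> carrier G. \<Gamma> t0 \<otimes> x \<otimes> \<one> \<in> W}" using carG by simp
      from tangent_eventually[OF tanG open_bitranslation[OF carG one_closed W] this]
      have "\<forall>\<^sub>F h in nhds 0. \<Gamma> (t0 + h) \<in> W" using carG by (auto simp: add elim: eventually_mono)
      then obtain S where S: "open S" "0 \<in> S" "\<And>h. h \<in> S \<Longrightarrow> \<Gamma> (t0 + h) \<in> W" by (auto simp: eventually_nhds)
      have "open ((+) t0 ` S)" using S(1) by (rule open_translation)
      moreover have "t0 \<in> (+) t0 ` S" using S(2) by force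
      ultimately show "\<exists>U. open U \<and> t0 \<in> U \<and> U \<subseteq> {t. \<Gamma> t \<in> W}" using S(3) by blast
    qed
    then show "openin euclideanreal {x \<in> topspace euclideanreal. \<Gamma> x \<in> W}" by simp
  qed
  then have "one_parameter_subgroup G X \<Gamma>"
    using add tanG by (simp add: one_parameter_subgroup_def tangent_def o_def)
  then show ?thesis by blast
qed

lemma one_parameter_subgroup_scale:
  assumes "one_parameter_subgroup G X \<gamma>"
  shows "one_parameter_subgroup G (c *\<^sub>R X) (\<lambda>t. \<gamma> (c * t))"
proof -
  have "continuous_map euclideanreal euclideanreal (\<lambda>t. c * t)" by (simp add: continuous_intros)
  then have "continuous_map euclideanreal T (\<lambda>t. \<gamma> (c * t))"
    using assms continuous_map_compose[of euclideanreal euclideanreal "\<lambda>t. c * t" T \<gamma>]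
    by (simp add: one_parameter_subgroup_def o_def)
  moreover have "((*) c has_vector_derivative c) (at 0)"
    by (auto intro!: derivative_eq_intros simp flip: has_real_derivative_iff_has_vector_derivative)
  then have "((\<lambda>t. coords G (\<gamma> (c * t))) has_vector_derivative c *\<^sub>R X) (at 0)"
    using vector_diff_chain_at[of "\<lambda>t. c * t" c 0 "\<lambda>t. coords G (\<gamma> t)" X] assms
    by (simp add: one_parameter_subgroup_def o_def)
  ultimately show ?thesis
    using assms by (simp add: one_parameter_subgroup_def o_def distrib_left)
qed

text \<open>The exponential map is defined by the values at time \<open>1\<close>. The other values follow from the
  uniqueness of the subgroup for the rescaled velocity.\<close>

lemma one_parameter_subgroup_exp: "one_parameter_subgroup G X (\<lambda>t. lie_exp G (t *\<^sub>R X))"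
proof -
  define \<gamma> where "\<gamma> Y = (THE \<gamma>. one_parameter_subgroup G Y \<gamma>)" for Y
  have g: "one_parameter_subgroup G Y (\<gamma> Y)" for Y
    unfolding \<gamma>_def using one_parameter_subgroup_exists one_parameter_subgroup_unique by (metis theI')
  have "lie_exp G (t *\<^sub>R X) = \<gamma> X t" for t
  proof -
    have "\<gamma> (t *\<^sub>R X) = (\<lambda>s. \<gamma> X (t * s))"
      using one_parameter_subgroup_unique[OF g one_parameter_subgroup_scale[OF g]] .
    then show ?thesis by (simp add: lie_exp_def \<gamma>_def[symmetric])
  qed
  with g[of X] show ?thesis by simp
qed

lemma one_parameter_subgroup_eq_exp:
  assumes "one_parameter_subgroup G X \<gamma>"
  shows "\<gamma> t = lie_exp G (t *\<^sub>R X)"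
  using one_parameter_subgroup_unique[OF assms one_parameter_subgroup_exp] by metis

lemma exp_carrier [simp]: "lie_exp G X \<in> carrier G"
  using one_parameter_subgroupD(1)[OF one_parameter_subgroup_exp, where t = 1] by simp

lemma exp_scale_add: "lie_exp G ((s + t) *\<^sub>R X) = lie_exp G (s *\<^sub>R X) \<otimes> lie_exp G (t *\<^sub>R X)"
  using one_parameter_subgroupD(2)[OF one_parameter_subgroup_exp] .

lemma exp_zero [simp]: "lie_exp G 0 = \<one>"
  using one_parameter_subgroupD(3)[OF one_parameter_subgroup_exp] by simp

lemma exp_minus: "lie_exp G (- X) = inv (lie_exp G X)"
  using one_parameter_subgroupD(5)[OF one_parameter_subgroup_exp, where t = 1] by simp

lemma tangent_exp: "tangent (\<lambda>t. lie_exp G (t *\<^sub>R X)) X"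
  using one_parameter_subgroupD(4)[OF one_parameter_subgroup_exp] .

lemma continuous_exp: "continuous_map euclideanreal T (\<lambda>t. lie_exp G (t *\<^sub>R X))"
  using one_parameter_subgroup_exp by (simp add: one_parameter_subgroup_def)

lemma hom_exp:
  assumes hom: "f \<in> hom G G" and smooth: "smooth_map (atlas G) (atlas G) f"
  shows "f (lie_exp G X) = lie_exp G (diff_one G f X)"
proof -
  have car: "f ` carrier G \<subseteq> carrier G" using hom by (auto simp: hom_def)
  have one: "f \<one> = \<one>" using hom hom_one is_group by blast
  have "continuous_map T T f"
    using car by (intro smooth_map_continuous[OF top_atlas top_atlas smooth]) (auto simp: topspace_eq)
  then have "continuous_map euclideanreal T (\<lambda>t. f (lie_exp G (t *\<^sub>R X)))"
    using continuous_map_compose[OF continuous_exp, of T f X] by (simp add: o_def)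
  moreover have "tangent (\<lambda>t. f (lie_exp G (t *\<^sub>R X))) (diff_one G f X)"
    by (rule tangent_smooth[OF smooth car one tangent_exp])
  moreover have "f (lie_exp G ((s + t) *\<^sub>R X)) = f (lie_exp G (s *\<^sub>R X)) \<otimes> f (lie_exp G (t *\<^sub>R X))" for s t
    using hom by (simp add: exp_scale_add hom_mult)
  ultimately have "one_parameter_subgroup G (diff_one G f X) (\<lambda>t. f (lie_exp G (t *\<^sub>R X)))"
    by (simp add: one_parameter_subgroup_def tangent_def o_def)
  from one_parameter_subgroup_eq_exp[OF this, of 1] show ?thesis by simp
qed

lemma linear_diff_one:
  assumes "smooth_map (atlas G) (atlas G) f" "f \<one> = \<one>"
  shows "linear (diff_one G f)"
  using has_diff_one_diff_one[OF assms] unfolding has_diff_one_def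
  by (intro bounded_linear.linear has_derivative_bounded_linear)

section \<open>The adjoint representation\<close>

lemma conj_hom: "g \<in> carrier G \<Longrightarrow> (\<lambda>x. g \<otimes> x \<otimes> inv g) \<in> hom G G"
  by (auto simp: hom_def m_assoc inv_solve_left)

lemma smooth_conj: "g \<in> carrier G \<Longrightarrow> smooth_map (atlas G) (atlas G) (\<lambda>x. g \<otimes> x \<otimes> inv g)"
  by (simp add: smooth_bitranslation)

lemma tangent_conj: "g \<in> carrier G \<Longrightarrow> tangent \<gamma> X \<Longrightarrow> tangent (\<lambda>t. g \<otimes> \<gamma> t \<otimes> inv g) (Ad G g X)"
  unfolding Ad_def by (rule tangent_smooth[OF smooth_conj]) auto

lemma Ad_exp: "g \<in> carrier G \<Longrightarrow> g \<otimes> lie_exp G X \<otimes> inv g = lie_exp G (Ad G g X)"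
  unfolding Ad_def using hom_exp[OF conj_hom smooth_conj] by simp

lemma linear_Ad: "g \<in> carrier G \<Longrightarrow> linear (Ad G g)"
  unfolding Ad_def by (rule linear_diff_one[OF smooth_conj]) auto

lemma Ad_mult:
  assumes "g \<in> carrier G" "h \<in> carrier G"
  shows "Ad G (g \<otimes> h) X = Ad G g (Ad G h X)"
proof -
  have "tangent (\<lambda>t. g \<otimes> (h \<otimes> lie_exp G (t *\<^sub>R X) \<otimes> inv h) \<otimes> inv g) (Ad G g (Ad G h X))"
    using assms by (intro tangent_conj tangent_exp)
  moreover have "g \<otimes> (h \<otimes> lie_exp G (t *\<^sub>R X) \<otimes> inv h) \<otimes> inv g = (g \<otimes> h) \<otimes> lie_exp G (t *\<^sub>R X) \<otimes> inv (g \<otimes> h)" for t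
    using assms by (simp add: m_assoc inv_mult_group)
  ultimately have "tangent (\<lambda>t. (g \<otimes> h) \<otimes> lie_exp G (t *\<^sub>R X) \<otimes> inv (g \<otimes> h)) (Ad G g (Ad G h X))"
    by (simp only:)
  moreover have "tangent (\<lambda>t. (g \<otimes> h) \<otimes> lie_exp G (t *\<^sub>R X) \<otimes> inv (g \<otimes> h)) (Ad G (g \<otimes> h) X)"
    using assms by (intro tangent_conj tangent_exp) auto
  ultimately show ?thesis using tangent_unique by blast
qed

lemma Ad_one: "Ad G \<one> X = X"
proof -
  have "tangent (\<lambda>t. \<one> \<otimes> lie_exp G (t *\<^sub>R X) \<otimes> inv \<one>) (Ad G \<one> X)"
    by (intro tangent_conj tangent_exp) auto
  then show ?thesis using tangent_exp[of X] tangent_unique by simp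
qed

text \<open>\<open>Ad(x)Y\<close> is the partial derivative of \<open>(x, y) \<mapsto> x y x\<inverse>\<close> in \<open>y\<close>.\<close>

lemma smooth_Ad: "smooth_on_open (\<lambda>x. Ad G (uncoords G x) Y) (coords G ` U0)"
proof -
  let ?C = "\<lambda>z. coords G (uncoords G (fst z) \<otimes> uncoords G (snd z) \<otimes> inv (uncoords G (fst z)))"
  let ?S = "map_prod (coords G) (coords G) ` (U0 \<times> U0 \<inter> (\<lambda>z. fst z \<otimes> snd z \<otimes> inv (fst z)) -` U0)"
  have sm: "smooth_on_open ?C ?S"
    using smooth2_in_base_chart[OF smooth_conj2] by simp
  have mem: "(x, e0) \<in> ?S" if "x \<in> coords G ` U0" for x
  proof -
    obtain g where g: "g \<in> U0" "x = coords G g" using \<open>x \<in> coords G ` U0\<close> by auto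
    then show ?thesis
      using one_in_base_chart U0_carrier by (intro image_eqI[of _ _ "(g, \<one>)"]) auto
  qed
  have "{x. (x, e0) \<in> ?S} = coords G ` U0" using mem by auto
  with smooth_on_open_partial[OF fd fd sm, of e0 Y]
  have "smooth_on_open (\<lambda>x. frechet_derivative ?C (at (x, e0)) (0, Y)) (coords G ` U0)" by simp
  then show ?thesis
  proof (rule smooth_on_open_cong)
    fix x assume x: "x \<in> coords G ` U0"
    have "((\<lambda>y. ?C (x, y)) has_derivative (\<lambda>v. frechet_derivative ?C (at (x, e0)) (0, v))) (at e0)"
      by (rule partial_derivative(1)[OF smooth_on_open_derivative(1)[OF sm mem[OF x]]])
    from frechet_derivative_at[OF this]
    show "frechet_derivative ?C (at (x, e0)) (0, Y) = Ad G (uncoords G x) Y"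
      by (simp add: Ad_def diff_one_def o_def fun_eq_iff)
  qed
qed

lemma has_diff_one_Ad: "has_diff_one (\<lambda>x. Ad G x Y) (\<lambda>X. bracket G X Y)"
  using smooth_on_open_derivative(1)[OF smooth_Ad e0(1)] by (simp add: has_diff_one_def bracket_def)

lemma linear_bracket_left: "linear (\<lambda>X. bracket G X Y)"
  using has_diff_one_Ad unfolding has_diff_one_def
  by (intro bounded_linear.linear has_derivative_bounded_linear)

lemma has_vector_derivative_Ad_exp:
  "((\<lambda>t. Ad G (lie_exp G (t *\<^sub>R H)) X) has_vector_derivative Ad G (lie_exp G (t *\<^sub>R H)) (bracket G H X)) (at t)"
proof -
  let ?A = "Ad G (lie_exp G (t *\<^sub>R H))"
  have "bounded_linear ?A" by (rule bounded_linear_fin_dim[OF fd linear_Ad]) simp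
  from bounded_linear.has_vector_derivative[OF this has_diff_one_tangent[OF has_diff_one_Ad tangent_exp]]
  have "((\<lambda>h. Ad G (lie_exp G ((t + h) *\<^sub>R H)) X) has_vector_derivative ?A (bracket G H X)) (at 0)"
    by (simp add: exp_scale_add Ad_mult)
  then show ?thesis
    using has_vector_derivative_shift[of "\<lambda>t. Ad G (lie_exp G (t *\<^sub>R H)) X" t] by simp
qed

text \<open>\<open>t \<mapsto> Ad(exp tH)X\<close> solves \<open>f' = c f\<close>.\<close>

lemma Ad_exp_eigenvector:
  assumes "bracket G H X = c *\<^sub>R X"
  shows "Ad G (lie_exp G H) X = exp c *\<^sub>R X"
proof -
  let ?f = "\<lambda>t. exp (- c * t) *\<^sub>R Ad G (lie_exp G (t *\<^sub>R H)) X"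
  have "(?f has_vector_derivative 0) (at t)" for t
  proof -
    have "((\<lambda>t. exp (- c * t)) has_real_derivative (- c * exp (- c * t))) (at t)"
      by (auto intro!: derivative_eq_intros)
    from has_vector_derivative_scaleR[OF this has_vector_derivative_Ad_exp[of H X t]]
    show ?thesis by (simp add: assms linear_scale[OF linear_Ad] scaleR_left_diff_distrib algebra_simps)
  qed
  then have "?f 1 = ?f 0"
    using has_vector_derivative_zero_constant[of UNIV ?f] by (metis UNIV_I convex_UNIV)
  then have "exp (- c) *\<^sub>R Ad G (lie_exp G H) X = X" by (simp add: Ad_one)
  then have "exp c *\<^sub>R exp (- c) *\<^sub>R Ad G (lie_exp G H) X = exp c *\<^sub>R X" by simp
  then show ?thesis by (simp flip: exp_add)
qed

lemma exp_add_commuting: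
  assumes "\<And>t. Ad G (lie_exp G (t *\<^sub>R H)) Z = Z"
  shows "lie_exp G (H + Z) = lie_exp G H \<otimes> lie_exp G Z"
proof -
  have comm: "lie_exp G (t *\<^sub>R H) \<otimes> lie_exp G (s *\<^sub>R Z) = lie_exp G (s *\<^sub>R Z) \<otimes> lie_exp G (t *\<^sub>R H)" for s t
  proof -
    have "lie_exp G (t *\<^sub>R H) \<otimes> lie_exp G (s *\<^sub>R Z) \<otimes> inv (lie_exp G (t *\<^sub>R H)) = lie_exp G (s *\<^sub>R Z)"
      by (simp add: Ad_exp assms linear_scale[OF linear_Ad])
    then have "lie_exp G (t *\<^sub>R H) \<otimes> lie_exp G (s *\<^sub>R Z) \<otimes> inv (lie_exp G (t *\<^sub>R H)) \<otimes> lie_exp G (t *\<^sub>R H)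
      = lie_exp G (s *\<^sub>R Z) \<otimes> lie_exp G (t *\<^sub>R H)" by simp
    then show ?thesis by (simp add: m_assoc)
  qed
  let ?g = "\<lambda>t. lie_exp G (t *\<^sub>R H) \<otimes> lie_exp G (t *\<^sub>R Z)"
  have "continuous_map euclideanreal T (\<lambda>t. (\<lambda>(x, y). x \<otimes> y) (lie_exp G (t *\<^sub>R H), lie_exp G (t *\<^sub>R Z)))"
    by (intro continuous_map_compose[OF _ continuous_mult, unfolded o_def] continuous_map_pairedI continuous_exp)
  then have "continuous_map euclideanreal T ?g" by simp
  moreover have "?g (s + t) = ?g s \<otimes> ?g t" for s t
  proof -
    have "?g (s + t) = lie_exp G (s *\<^sub>R H) \<otimes> (lie_exp G (t *\<^sub>R H) \<otimes> lie_exp G (s *\<^sub>R Z)) \<otimes> lie_exp G (t *\<^sub>R Z)"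
      by (simp add: exp_scale_add m_assoc)
    then show ?thesis unfolding comm[of t s] by (simp add: m_assoc)
  qed
  moreover have "tangent ?g (H + Z)" by (intro tangent_mult tangent_exp)
  ultimately have "one_parameter_subgroup G (H + Z) ?g"
    by (simp add: one_parameter_subgroup_def tangent_def o_def)
  from one_parameter_subgroup_eq_exp[OF this, of 1] show ?thesis by simp
qed

end

section \<open>Growth of linear actions\<close>

text \<open>The properties shared by \<open>\<pi>\<close> and \<open>Ad\<close> from which their growth on \<open>K\<close> and on \<open>A\<close> follows.\<close>

locale bounded_action = lie_group G
  for G :: "('a, 'e::real_normed_vector, 'm) lie_group_scheme" (structure) +
  fixes \<rho> :: "'a \<Rightarrow> 'v::real_normed_vector \<Rightarrow> 'v"
  assumes action_mult: "x \<in> carrier G \<Longrightarrow> y \<in> carrier G \<Longrightarrow> \<rho> (x \<otimes> y) v = \<rho> x (\<rho> y v)"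
    and action_one: "\<rho> \<one> v = v"
    and action_bounded: "x \<in> carrier G \<Longrightarrow> bounded_linear (\<rho> x)"
    and action_locally_bounded: "\<exists>W M. openin T W \<and> \<one> \<in> W \<and> (\<forall>x\<in>W. \<forall>v. norm (\<rho> x v) \<le> M * norm v)"
begin

lemma action_local_bound:
  obtains W M where "openin T W" "\<one> \<in> W" "M \<ge> 1" "\<And>x v. x \<in> W \<Longrightarrow> norm (\<rho> x v) \<le> M * norm v"
proof -
  obtain W M where W: "openin T W" "\<one> \<in> W" "\<And>x v. x \<in> W \<Longrightarrow> norm (\<rho> x v) \<le> M * norm v"
    using action_locally_bounded by auto
  have "norm (\<rho> x v) \<le> max M 1 * norm v" if "x \<in> W" for x v
    using W(3)[OF that, of v] mult_right_mono[of M "max M 1" "norm v"] by simp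
  with W that show ?thesis by (metis max.cobounded2)
qed

lemma action_compact_bound:
  assumes "compactin T K"
  shows "\<exists>M\<ge>0. \<forall>x\<in>K. \<forall>v. norm (\<rho> x v) \<le> M * norm v"
proof -
  obtain W M where W: "openin T W" "\<one> \<in> W" "M \<ge> 1" "\<And>x v. x \<in> W \<Longrightarrow> norm (\<rho> x v) \<le> M * norm v"
    using action_local_bound by blast
  define V where "V g = {x \<in> carrier G. \<one> \<otimes> x \<otimes> inv g \<in> W}" for g
  have K: "K \<subseteq> carrier G" using compactin_subset_topspace[OF assms] by (simp add: topspace_eq)
  have "openin T (V g)" if "g \<in> K" for g
    unfolding V_def using that K by (intro open_bitranslation W(1)) auto
  moreover have "K \<subseteq> \<Union> (V ` K)"
  proof
    fix x assume "x \<in> K"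
    then have "x \<in> V x" using K W(2) by (auto simp: V_def)
    then show "x \<in> \<Union> (V ` K)" using \<open>x \<in> K\<close> by blast
  qed
  ultimately obtain F where F: "finite F" "F \<subseteq> V ` K" "K \<subseteq> \<Union> F"
    using assms unfolding compactin_def by (metis (no_types, lifting) imageE)
  then obtain J where J: "J \<subseteq> K" "finite J" "F = V ` J" by (metis finite_subset_image)
  have "\<exists>b\<ge>0. \<forall>v. norm (\<rho> g v) \<le> b * norm v" if "g \<in> J" for g
    using bounded_linear.nonneg_bounded[OF action_bounded, of g] that J K by (auto simp: mult.commute)
  then obtain b where b: "\<And>g v. g \<in> J \<Longrightarrow> b g \<ge> 0 \<and> norm (\<rho> g v) \<le> b g * norm v" by metis
  have "norm (\<rho> x v) \<le> M * (\<Sum>g\<in>J. b g) * norm v" if x: "x \<in> K" for x v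
  proof -
    obtain g where g: "g \<in> J" "x \<in> V g" using x F J by auto
    then have gx: "g \<in> carrier G" "x \<in> carrier G" using J K x by auto
    have "x = (x \<otimes> inv g) \<otimes> g" using gx by (simp add: m_assoc)
    then have "\<rho> x v = \<rho> (x \<otimes> inv g) (\<rho> g v)" using gx action_mult[of "x \<otimes> inv g" g v] by simp
    also have "norm \<dots> \<le> M * norm (\<rho> g v)" using g gx by (intro W(4)) (auto simp: V_def)
    also have "\<dots> \<le> M * (b g * norm v)" using b[OF g(1)] W(3) by (intro mult_left_mono) auto
    also have "\<dots> \<le> M * ((\<Sum>g\<in>J. b g) * norm v)"
      using b W(3) g(1) J(2) by (intro mult_left_mono mult_right_mono member_le_sum) auto
    finally show ?thesis by (simp add: mult.assoc)
  qed
  moreover have "M * (\<Sum>g\<in>J. b g) \<ge> 0" using b W(3) by (auto intro!: sum_nonneg mult_nonneg_nonneg)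
  ultimately show ?thesis by blast
qed

text \<open>The time is divided into steps to which the local bound applies. Their number is linear
  in \<open>t\<close>.\<close>

lemma action_exp_bound:
  "\<exists>M\<ge>0. \<exists>c\<ge>0. \<forall>t v. norm (\<rho> (lie_exp G (t *\<^sub>R H)) v) \<le> M * exp (c * \<bar>t\<bar>) * norm v"
proof -
  obtain W M where W: "openin T W" "\<one> \<in> W" "M \<ge> 1" "\<And>x v. x \<in> W \<Longrightarrow> norm (\<rho> x v) \<le> M * norm v"
    using action_local_bound by blast
  have "\<forall>\<^sub>F t in nhds 0. lie_exp G (t *\<^sub>R H) \<in> W" by (rule tangent_eventually[OF tangent_exp W(1,2)])
  then obtain r where r: "r > 0" "\<And>t. dist t 0 < r \<Longrightarrow> lie_exp G (t *\<^sub>R H) \<in> W"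
    by (auto simp: eventually_nhds_metric)
  have pow: "norm (\<rho> (lie_exp G ((real n * s) *\<^sub>R H)) v) \<le> M ^ n * norm v" if s: "\<bar>s\<bar> < r" for n s v
  proof (induction n)
    case 0
    then show ?case by (simp add: action_one)
  next
    case (Suc n)
    have "\<rho> (lie_exp G ((real (Suc n) * s) *\<^sub>R H)) v = \<rho> (lie_exp G ((s + real n * s) *\<^sub>R H)) v"
      by (simp add: algebra_simps)
    also have "\<dots> = \<rho> (lie_exp G (s *\<^sub>R H)) (\<rho> (lie_exp G ((real n * s) *\<^sub>R H)) v)"
      by (simp only: exp_scale_add action_mult exp_carrier)
    also have "norm \<dots> \<le> M * norm (\<rho> (lie_exp G ((real n * s) *\<^sub>R H)) v)"
      using s by (intro W(4) r(2)) (simp add: dist_real_def)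
    also have "\<dots> \<le> M * (M ^ n * norm v)" using Suc W(3) by (intro mult_left_mono) auto
    finally show ?case by (simp add: mult.assoc)
  qed
  have "norm (\<rho> (lie_exp G (t *\<^sub>R H)) v) \<le> M ^ 2 * exp (ln M / r * \<bar>t\<bar>) * norm v" for t v
  proof -
    define n where "n = nat \<lceil>\<bar>t\<bar> / r\<rceil> + 1"
    have n: "n > 0" "\<bar>t\<bar> / r < real n" unfolding n_def by linarith+
    have n2: "real n \<le> \<bar>t\<bar> / r + 2"
    proof -
      have "0 \<le> \<bar>t\<bar> / r" using r by simp
      then show ?thesis unfolding n_def by linarith
    qed
    have "\<bar>t / real n\<bar> < r" using n r by (simp add: field_simps)
    from pow[OF this, of n v] have "norm (\<rho> (lie_exp G (t *\<^sub>R H)) v) \<le> M ^ n * norm v" using n(1) by simp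
    also have "M ^ n = M powr real n" using W(3) by (simp add: powr_realpow)
    also have "\<dots> \<le> M powr (\<bar>t\<bar> / r + 2)" using W(3) n2 by (intro powr_mono) auto
    also have "\<dots> = M powr (\<bar>t\<bar> / r) * M powr 2" by (rule powr_add)
    also have "M powr 2 = M ^ 2" using W(3) by (simp add: powr_numeral)
    also have "M powr (\<bar>t\<bar> / r) = exp (ln M / r * \<bar>t\<bar>)" using W(3) by (simp add: powr_def mult.commute)
    finally show ?thesis by (simp add: mult_right_mono mult.commute)
  qed
  moreover have "M ^ 2 \<ge> 0" "ln M / r \<ge> 0" using W(3) r by auto
  ultimately show ?thesis by blast
qed

text \<open>Along a basis of \<open>a\<close> the element \<open>exp H\<close> is a product of elements of one-parameter subgroups,
  and the coordinates of \<open>H\<close> are bounded by its norm.\<close>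

lemma action_exp_commuting_bound:
  assumes "subspace a" and add: "\<And>H Z. H \<in> a \<Longrightarrow> Z \<in> a \<Longrightarrow> lie_exp G (H + Z) = lie_exp G H \<otimes> lie_exp G Z"
  shows "\<exists>M\<ge>0. \<exists>c\<ge>0. \<forall>H\<in>a. \<forall>v. norm (\<rho> (lie_exp G H) v) \<le> M * exp (c * norm H) * norm v"
proof -
  obtain S where S: "S \<subseteq> a" "independent S" "a \<subseteq> span S" using maximal_independent_subset by blast
  have "finite S"
    using independent_span_bound[OF fin_basis(1)[OF fd] S(2)] fin_basis(3)[OF fd] by simp
  obtain C where C: "C > 0" "\<And>c b. b \<in> S \<Longrightarrow> \<bar>c b\<bar> \<le> C * norm (\<Sum>d\<in>S. c d *\<^sub>R d)"
    using independent_coefficients_bounded[OF \<open>finite S\<close> S(2)] by blast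
  have prod: "\<exists>M\<ge>0. \<exists>k\<ge>0. \<forall>c v. norm (\<rho> (lie_exp G (\<Sum>d\<in>F. c d *\<^sub>R d)) v) \<le> M * exp (k * (\<Sum>d\<in>F. \<bar>c d\<bar>)) * norm v"
    if "finite F" "F \<subseteq> a" for F
    using that
  proof (induction F rule: finite_induct)
    case empty
    show ?case by (intro exI[of _ 1] conjI exI[of _ 0]) (auto simp: action_one)
  next
    case (insert b F)
    obtain M k where M: "M \<ge> 0" "k \<ge> 0"
      "\<And>c v. norm (\<rho> (lie_exp G (\<Sum>d\<in>F. c d *\<^sub>R d)) v) \<le> M * exp (k * (\<Sum>d\<in>F. \<bar>c d\<bar>)) * norm v"
      using insert by auto
    obtain N j where N: "N \<ge> 0" "j \<ge> 0" "\<And>t v. norm (\<rho> (lie_exp G (t *\<^sub>R b)) v) \<le> N * exp (j * \<bar>t\<bar>) * norm v"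
      using action_exp_bound[of b] by blast
    define m where "m = max j k"
    have "norm (\<rho> (lie_exp G (\<Sum>d\<in>insert b F. c d *\<^sub>R d)) v) \<le>
        (N * M) * exp (m * (\<Sum>d\<in>insert b F. \<bar>c d\<bar>)) * norm v" for c v
    proof -
      let ?Z = "\<Sum>d\<in>F. c d *\<^sub>R d"
      have "lie_exp G (c b *\<^sub>R b + ?Z) = lie_exp G (c b *\<^sub>R b) \<otimes> lie_exp G ?Z"
        using insert.prems assms(1) by (intro add subspace_sum subspace_scale) auto
      then have "\<rho> (lie_exp G (\<Sum>d\<in>insert b F. c d *\<^sub>R d)) v = \<rho> (lie_exp G (c b *\<^sub>R b)) (\<rho> (lie_exp G ?Z) v)"
        using insert.hyps by (simp add: action_mult)
      also have "norm \<dots> \<le> N * exp (j * \<bar>c b\<bar>) * norm (\<rho> (lie_exp G ?Z) v)" by (rule N(3))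
      also have "\<dots> \<le> N * exp (m * \<bar>c b\<bar>) * (M * exp (m * (\<Sum>d\<in>F. \<bar>c d\<bar>)) * norm v)"
      proof (rule mult_mono)
        show "N * exp (j * \<bar>c b\<bar>) \<le> N * exp (m * \<bar>c b\<bar>)"
          using N(1) by (auto intro!: mult_left_mono mult_right_mono simp: m_def)
        have "M * exp (k * (\<Sum>d\<in>F. \<bar>c d\<bar>)) * norm v \<le> M * exp (m * (\<Sum>d\<in>F. \<bar>c d\<bar>)) * norm v"
          using M(1) by (intro mult_right_mono mult_left_mono) (auto intro!: mult_right_mono sum_nonneg simp: m_def)
        then show "norm (\<rho> (lie_exp G ?Z) v) \<le> M * exp (m * (\<Sum>d\<in>F. \<bar>c d\<bar>)) * norm v"
          using M(3) order_trans by blast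
      qed (use N(1) in auto)
      also have "\<dots> = (N * M) * exp (m * (\<Sum>d\<in>insert b F. \<bar>c d\<bar>)) * norm v"
        using insert.hyps by (simp add: distrib_left exp_add algebra_simps)
      finally show ?thesis .
    qed
    moreover have "N * M \<ge> 0" "m \<ge> 0" using M N by (auto simp: m_def)
    ultimately show ?case by blast
  qed
  from prod[OF \<open>finite S\<close> S(1)] obtain M k where M: "M \<ge> 0" "k \<ge> 0"
    "\<And>c v. norm (\<rho> (lie_exp G (\<Sum>d\<in>S. c d *\<^sub>R d)) v) \<le> M * exp (k * (\<Sum>d\<in>S. \<bar>c d\<bar>)) * norm v" by blast
  define q where "q = k * (real (card S) * C)"
  have "norm (\<rho> (lie_exp G H) v) \<le> M * exp (q * norm H) * norm v" if H: "H \<in> a" for H v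
  proof -
    have "H \<in> range (\<lambda>u. \<Sum>d\<in>S. u d *\<^sub>R d)" using H S(3) span_finite[OF \<open>finite S\<close>] by auto
    then obtain c where c: "H = (\<Sum>d\<in>S. c d *\<^sub>R d)" by blast
    have "(\<Sum>d\<in>S. \<bar>c d\<bar>) \<le> (\<Sum>d\<in>S. C * norm H)" unfolding c by (intro sum_mono C(2))
    then have "k * (\<Sum>d\<in>S. \<bar>c d\<bar>) \<le> k * (real (card S) * (C * norm H))"
      using M(2) by (intro mult_left_mono) auto
    then have "exp (k * (\<Sum>d\<in>S. \<bar>c d\<bar>)) \<le> exp (q * norm H)" by (simp add: q_def mult.assoc)
    then have "M * exp (k * (\<Sum>d\<in>S. \<bar>c d\<bar>)) * norm v \<le> M * exp (q * norm H) * norm v"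
      using M(1) by (intro mult_right_mono mult_left_mono) auto
    with M(3)[of c v] show ?thesis unfolding c[symmetric] by simp
  qed
  moreover have "q \<ge> 0" using M(2) C(1) by (simp add: q_def)
  ultimately show ?thesis using M(1) by blast
qed

end

context lie_group
begin

lemma bounded_action_Ad: "bounded_action G (Ad G)"
proof (rule bounded_action.intro[OF lie_group_axioms bounded_action_axioms.intro])
  show "x \<in> carrier G \<Longrightarrow> y \<in> carrier G \<Longrightarrow> Ad G (x \<otimes> y) v = Ad G x (Ad G y v)" for x y v
    by (rule Ad_mult)
  show "Ad G \<one> v = v" for v by (rule Ad_one)
  show bl: "x \<in> carrier G \<Longrightarrow> bounded_linear (Ad G x)" for x
    by (rule bounded_linear_fin_dim[OF fd linear_Ad])
  let ?h = "\<lambda>y. \<Sum>b\<in>fin_basis. norm (Ad G (uncoords G y) b)"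
  have "continuous_on (coords G ` U0) ?h"
    by (intro continuous_on_sum continuous_on_norm smooth_on_open_continuous smooth_Ad)
  then have "open (coords G ` U0 \<inter> ?h -` {..<?h e0 + 1})"
    by (rule continuous_open_preimage[OF _ open_coords]) simp
  from chart_preimage_open[OF top_atlas base_chart this]
  have W: "openin T {x \<in> U0. coords G x \<in> coords G ` U0 \<inter> ?h -` {..<?h e0 + 1}}" (is "openin T ?W") .
  obtain C where C: "C > 0" "\<And>b x. b \<in> fin_basis \<Longrightarrow> \<bar>coord b (x :: 'e)\<bar> \<le> C * norm x"
    using coord_le[OF fd] by blast
  have "norm (Ad G x v) \<le> (C * (?h e0 + 1)) * norm v" if x: "x \<in> ?W" for x v
  proof -
    have xU: "x \<in> U0" and "?h (coords G x) < ?h e0 + 1"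
      using x by (simp_all only: mem_Collect_eq Int_iff vimage_eq lessThan_iff)
    then have xc: "x \<in> carrier G" "(\<Sum>b\<in>fin_basis. norm (Ad G x b)) \<le> ?h e0 + 1"
      using U0_carrier[OF xU] uncoords_coords[OF xU] by simp_all
    have "Ad G x v = (\<Sum>b\<in>fin_basis. coord b v *\<^sub>R Ad G x b)"
      by (rule linear_eq_sum_coord[OF fd linear_Ad[OF xc(1)]])
    also have "norm \<dots> \<le> (\<Sum>b\<in>fin_basis. (C * norm v) * norm (Ad G x b))"
      by (rule sum_norm_le) (simp add: C(2) mult_right_mono)
    also have "\<dots> = (C * norm v) * (\<Sum>b\<in>fin_basis. norm (Ad G x b))" by (simp add: sum_distrib_left)
    also have "\<dots> \<le> (C * norm v) * (?h e0 + 1)" using C(1) xc(2) by (intro mult_left_mono) auto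
    finally show ?thesis by (simp add: mult_ac)
  qed
  moreover have "\<one> \<in> ?W" using one_in_base_chart by simp
  ultimately show "\<exists>W M. openin T W \<and> \<one> \<in> W \<and> (\<forall>x\<in>W. \<forall>v. norm (Ad G x v) \<le> M * norm v)"
    using W by (intro exI[of _ ?W] exI[of _ "C * (?h e0 + 1)"]) auto
qed

end

section \<open>Smooth vectors\<close>

lemma norm_scaleC: "norm (c *\<^sub>C v) = norm c * norm (v :: 'h::complex_hilbert_space)"
proof -
  have "cinner (c *\<^sub>C v) (c *\<^sub>C v) = c * cnj (c * cinner v v)"
    by (metis cinner_commute cinner_scaleC_left)
  also have "\<dots> = of_real ((norm c)\<^sup>2) * cinner v v"
    by (metis cinner_commute complex_cnj_mult complex_norm_square mult.assoc)
  finally have "cinner (c *\<^sub>C v) (c *\<^sub>C v) = of_real ((norm c)\<^sup>2) * cinner v v" .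
  then have "Re (cinner (c *\<^sub>C v) (c *\<^sub>C v)) = (norm c)\<^sup>2 * Re (cinner v v)"
    by (simp del: of_real_power)
  then show ?thesis by (simp add: norm_eq_sqrt_cinner real_sqrt_mult)
qed

lemma bounded_linear_scaleC: "bounded_linear (\<lambda>v :: 'h::complex_hilbert_space. c *\<^sub>C v)"
  by (rule bounded_linear_intro[where K = "norm c"])
    (simp_all add: scaleC_add_right scaleR_scaleC scaleC_scaleC norm_scaleC mult.commute)

lemma smooth_map_vector_iff:
  "smooth_map A vector_atlas F \<longleftrightarrow> (\<forall>(U, \<phi>)\<in>A. smooth_on_open (\<lambda>y. F (inv_into U \<phi> y)) (\<phi> ` U))"
  by (simp add: smooth_map_def o_def)

lemma smooth_map_vector_cong:
  assumes "topological_atlas T A" "smooth_map A vector_atlas F" "\<And>x. x \<in> topspace T \<Longrightarrow> F x = F' x"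
  shows "smooth_map A vector_atlas F'"
  unfolding smooth_map_vector_iff
proof (clarify)
  fix U \<phi> assume U: "(U, \<phi>) \<in> A"
  have "smooth_on_open (\<lambda>y. F (inv_into U \<phi> y)) (\<phi> ` U)"
    using assms(2) U by (auto simp: smooth_map_vector_iff)
  then show "smooth_on_open (\<lambda>y. F' (inv_into U \<phi> y)) (\<phi> ` U)"
  proof (rule smooth_on_open_cong)
    fix y assume "y \<in> \<phi> ` U"
    then have "inv_into U \<phi> y \<in> U" by (rule inv_into_into)
    then show "F (inv_into U \<phi> y) = F' (inv_into U \<phi> y)"
      using assms(3) openin_subset[OF topological_atlasD(1)[OF assms(1) U]] by blast
  qed
qed

lemma linear_bound_of_ball:
  fixes f :: "'v::real_normed_vector \<Rightarrow> 'w::real_normed_vector"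
  assumes f: "linear f" and r: "r > 0" and ball: "\<And>v. norm v < r \<Longrightarrow> norm (f v) < 1"
  shows "norm (f v) \<le> (2 / r) * norm v"
proof (cases "v = 0")
  case True
  then show ?thesis using linear_0[OF f] by simp
next
  case False
  define c where "c = r / (2 * norm v)"
  have c: "c > 0" using r False by (simp add: c_def)
  have "norm (f (c *\<^sub>R v)) < 1" using r False by (intro ball) (simp add: c_def)
  then have "c * norm (f v) < 1" using c by (simp add: linear_scale[OF f])
  then have "norm (f v) < 1 / c" using c by (simp add: field_simps)
  then show ?thesis using False r by (simp add: c_def)
qed

locale lie_rep = lie_group G
  for G :: "('a, 'e::real_normed_vector, 'm) lie_group_scheme" (structure) +
  fixes \<pi> :: "'a \<Rightarrow> 'h::complex_hilbert_space \<Rightarrow> 'h"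
  assumes rep: "continuous_rep G \<pi>"
begin

abbreviation "SV \<equiv> smooth_vectors G \<pi>"
abbreviation "d\<pi> \<equiv> derived_rep G \<pi>"

lemma rep_add: "x \<in> carrier G \<Longrightarrow> \<pi> x (v + w) = \<pi> x v + \<pi> x w"
  and rep_scaleC: "x \<in> carrier G \<Longrightarrow> \<pi> x (c *\<^sub>C v) = c *\<^sub>C \<pi> x v"
  and rep_one: "\<pi> \<one> v = v"
  and rep_mult: "x \<in> carrier G \<Longrightarrow> y \<in> carrier G \<Longrightarrow> \<pi> (x \<otimes> y) v = \<pi> x (\<pi> y v)"
  and rep_continuous: "continuous_map (prod_topology T euclidean) euclidean (\<lambda>(x, v). \<pi> x v)"
  using rep unfolding continuous_rep_def by auto

lemma rep_scaleR: "x \<in> carrier G \<Longrightarrow> \<pi> x (c *\<^sub>R v) = c *\<^sub>R \<pi> x v"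
  by (simp add: scaleR_scaleC rep_scaleC)

lemma rep_linear: "x \<in> carrier G \<Longrightarrow> linear (\<pi> x)"
  by (rule linearI) (auto simp: rep_add rep_scaleR)

lemma rep_locally_bounded: "\<exists>W M. openin T W \<and> \<one> \<in> W \<and> (\<forall>x\<in>W. \<forall>v. norm (\<pi> x v) \<le> M * norm v)"
proof -
  let ?O = "{z \<in> topspace (prod_topology T euclidean). (\<lambda>(x, v). \<pi> x v) z \<in> ball 0 1}"
  have "openin (prod_topology T euclidean) ?O"
    by (rule openin_continuous_map_preimage[OF rep_continuous]) simp
  moreover have "(\<one>, 0) \<in> ?O" by (simp add: topspace_eq rep_one)
  ultimately obtain W V where W: "openin T W" "open V" "\<one> \<in> W" "0 \<in> V" "W \<times> V \<subseteq> ?O"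
    unfolding openin_prod_topology_alt[of T euclidean] open_openin[symmetric] by meson
  obtain r where r: "r > 0" "ball 0 r \<subseteq> V" using W(2,4) open_contains_ball by blast
  have "norm (\<pi> x v) \<le> (2 / r) * norm v" if x: "x \<in> W" for x v
  proof (rule linear_bound_of_ball[OF _ r(1)])
    show "linear (\<pi> x)" using openin_subset[OF W(1)] x by (intro rep_linear) (auto simp: topspace_eq)
    fix w :: 'h assume "norm w < r"
    then have "(x, w) \<in> W \<times> V" using r(2) x by auto
    then show "norm (\<pi> x w) < 1" using W(5) by auto
  qed
  with W show ?thesis by blast
qed

lemma bounded_action_rep: "bounded_action G \<pi>"
proof (rule bounded_action.intro[OF lie_group_axioms bounded_action_axioms.intro])
  show "x \<in> carrier G \<Longrightarrow> y \<in> carrier G \<Longrightarrow> \<pi> (x \<otimes> y) v = \<pi> x (\<pi> y v)" for x y v by (rule rep_mult)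
  show "\<pi> \<one> v = v" for v by (rule rep_one)
  show "\<exists>W M. openin T W \<and> \<one> \<in> W \<and> (\<forall>x\<in>W. \<forall>v. norm (\<pi> x v) \<le> M * norm v)"
    by (rule rep_locally_bounded)
  show "bounded_linear (\<pi> x)" if x: "x \<in> carrier G" for x
  proof -
    have "continuous_map euclidean (prod_topology T euclidean) (\<lambda>v. (x, v))"
      using x by (intro continuous_map_pairedI) (auto simp: topspace_eq)
    from continuous_map_compose[OF this rep_continuous]
    have "continuous_on UNIV (\<pi> x)" by (simp add: o_def)
    then have "isCont (\<pi> x) 0" by (simp add: continuous_on_eq_continuous_at)
    then have "(\<pi> x \<longlongrightarrow> \<pi> x 0) (at 0)" by (simp add: isCont_def)
    then have "\<forall>\<^sub>F v in at 0. norm (\<pi> x v) < 1"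
      using order_tendstoD(2)[OF tendsto_norm, of "\<pi> x" 0 "at 0" 1] linear_0[OF rep_linear[OF x]] by simp
    then obtain d where d: "d > 0" "\<And>v. v \<noteq> 0 \<Longrightarrow> dist v 0 < d \<Longrightarrow> norm (\<pi> x v) < 1"
      by (auto simp: eventually_at)
    have "norm (\<pi> x v) \<le> (2 / d) * norm v" for v
    proof (rule linear_bound_of_ball[OF rep_linear[OF x] d(1)])
      show "norm (\<pi> x w) < 1" if "norm w < d" for w
        using d(2)[of w] that linear_0[OF rep_linear[OF x]] by (cases "w = 0") auto
    qed
    then have "norm (\<pi> x v) \<le> norm v * (2 / d)" for v by (metis mult.commute)
    then show ?thesis
      by (intro bounded_linear_intro[where K = "2 / d"]) (auto simp: rep_add[OF x] rep_scaleR[OF x])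
  qed
qed

sublocale rep: bounded_action G \<pi> by (rule bounded_action_rep)
sublocale Ad: bounded_action G "Ad G" by (rule bounded_action_Ad)

lemma rep_bounded_linear: "x \<in> carrier G \<Longrightarrow> bounded_linear (\<pi> x)"
  by (rule rep.action_bounded)

lemma smooth_vectors_iff: "v \<in> SV \<longleftrightarrow> smooth_map (atlas G) vector_atlas (\<lambda>x. \<pi> x v)"
  by (simp add: smooth_vectors_def)

lemma smooth_vectors_chart:
  "v \<in> SV \<Longrightarrow> (U, \<phi>) \<in> atlas G \<Longrightarrow> smooth_on_open (\<lambda>y. \<pi> (inv_into U \<phi> y) v) (\<phi> ` U)"
  by (auto simp: smooth_vectors_iff smooth_map_vector_iff)

lemma chart_carrier:
  assumes "(U, \<phi>) \<in> atlas G" "y \<in> \<phi> ` U"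
  shows "inv_into U \<phi> y \<in> carrier G"
proof -
  have "inv_into U \<phi> y \<in> U" using assms(2) by (rule inv_into_into)
  then show ?thesis
    using openin_subset[OF topological_atlasD(1)[OF top_atlas assms(1)]] by (auto simp: topspace_eq)
qed

lemma smooth_vectors_add: "v \<in> SV \<Longrightarrow> w \<in> SV \<Longrightarrow> v + w \<in> SV"
proof -
  assume v: "v \<in> SV" and w: "w \<in> SV"
  show "v + w \<in> SV"
    unfolding smooth_vectors_iff smooth_map_vector_iff
  proof clarify
    fix U \<phi> assume U: "(U, \<phi>) \<in> atlas G"
    have "smooth_on_open (\<lambda>y. \<pi> (inv_into U \<phi> y) v + \<pi> (inv_into U \<phi> y) w) (\<phi> ` U)"
      using smooth_vectors_chart[OF v U] smooth_vectors_chart[OF w U]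
      by (simp add: smooth_on_open_def Ck_on_add)
    then show "smooth_on_open (\<lambda>y. \<pi> (inv_into U \<phi> y) (v + w)) (\<phi> ` U)"
      by (rule smooth_on_open_cong) (simp add: rep_add[OF chart_carrier[OF U]])
  qed
qed

lemma smooth_vectors_scaleC: "v \<in> SV \<Longrightarrow> c *\<^sub>C v \<in> SV"
proof -
  assume v: "v \<in> SV"
  show "c *\<^sub>C v \<in> SV"
    unfolding smooth_vectors_iff smooth_map_vector_iff
  proof clarify
    fix U \<phi> assume U: "(U, \<phi>) \<in> atlas G"
    have "smooth_on_open (\<lambda>y. c *\<^sub>C \<pi> (inv_into U \<phi> y) v) (\<phi> ` U)"
      using smooth_vectors_chart[OF v U]
      by (simp add: smooth_on_open_def Ck_on_linear_comp[OF bounded_linear_scaleC])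
    then show "smooth_on_open (\<lambda>y. \<pi> (inv_into U \<phi> y) (c *\<^sub>C v)) (\<phi> ` U)"
      by (rule smooth_on_open_cong) (simp add: rep_scaleC[OF chart_carrier[OF U]])
  qed
qed

lemma smooth_vectors_scaleR: "v \<in> SV \<Longrightarrow> c *\<^sub>R v \<in> SV"
  by (simp add: scaleR_scaleC smooth_vectors_scaleC)

lemma smooth_vectors_zero: "0 \<in> SV"
  unfolding smooth_vectors_iff
  by (rule smooth_map_vector_cong[OF top_atlas smooth_map_const[OF top_atlas, of _ 0]])
    (simp add: topspace_eq linear_0[OF rep_linear])

lemma smooth_vectors_subspace: "subspace SV"
  by (auto simp: subspace_def smooth_vectors_zero smooth_vectors_add smooth_vectors_scaleR)

lemma smooth_vectors_diff: "v \<in> SV \<Longrightarrow> w \<in> SV \<Longrightarrow> v - w \<in> SV"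
  by (rule subspace_diff[OF smooth_vectors_subspace])

lemma smooth_vectors_rep:
  assumes "v \<in> SV" "g \<in> carrier G"
  shows "\<pi> g v \<in> SV"
proof -
  have "smooth_map (atlas G) vector_atlas (\<lambda>x. (\<lambda>x. \<pi> x v) (\<one> \<otimes> x \<otimes> g))"
    using assms by (intro smooth_map_compose[OF fd top_atlas top_atlas smooth_bitranslation])
      (auto simp: smooth_vectors_iff topspace_eq)
  then show ?thesis
    unfolding smooth_vectors_iff
    by (rule smooth_map_vector_cong[OF top_atlas]) (use assms in \<open>auto simp: topspace_eq rep_mult\<close>)
qed

lemma has_diff_one_rep:
  assumes "v \<in> SV"
  shows "has_diff_one (\<lambda>x. \<pi> x v) (\<lambda>X. d\<pi> X v)"
proof -
  from smooth_on_open_derivative(1)[OF smooth_vectors_chart[OF assms base_chart] e0(1)]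
  have D: "has_diff_one (\<lambda>x. \<pi> x v) (frechet_derivative (\<lambda>y. \<pi> (inv_into U0 (coords G) y) v) (at e0))" (is "has_diff_one _ ?D")
    by (simp add: has_diff_one_def uncoords_eq)
  have "d\<pi> X v = ?D X" for X
    unfolding derived_rep_def by (rule vector_derivative_at[OF has_diff_one_tangent[OF D tangent_exp]])
  then have "(\<lambda>X. d\<pi> X v) = ?D" by (rule ext)
  with D show ?thesis by simp
qed

lemma has_vector_derivative_rep:
  "v \<in> SV \<Longrightarrow> tangent \<gamma> X \<Longrightarrow> ((\<lambda>t. \<pi> (\<gamma> t) v) has_vector_derivative d\<pi> X v) (at 0)"
  by (rule has_diff_one_tangent[OF has_diff_one_rep])

lemma derived_rep_eqI:
  assumes "((\<lambda>t. \<pi> (lie_exp G (t *\<^sub>R X)) v) has_vector_derivative w) (at 0)"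
  shows "d\<pi> X v = w"
  unfolding derived_rep_def using assms by (rule vector_derivative_at)

lemma linear_derived_rep_left: "v \<in> SV \<Longrightarrow> linear (\<lambda>X. d\<pi> X v)"
  using has_diff_one_rep unfolding has_diff_one_def
  by (intro bounded_linear.linear has_derivative_bounded_linear)

lemma derived_rep_add:
  assumes "v \<in> SV" "w \<in> SV"
  shows "d\<pi> X (v + w) = d\<pi> X v + d\<pi> X w"
  by (rule derived_rep_eqI)
    (use has_vector_derivative_add[OF has_vector_derivative_rep[OF assms(1) tangent_exp]
      has_vector_derivative_rep[OF assms(2) tangent_exp]] in \<open>simp add: rep_add\<close>)

lemma derived_rep_scaleC:
  assumes "v \<in> SV"
  shows "d\<pi> X (c *\<^sub>C v) = c *\<^sub>C d\<pi> X v"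
  by (rule derived_rep_eqI)
    (use bounded_linear.has_vector_derivative[OF bounded_linear_scaleC[of c] has_vector_derivative_rep[OF assms tangent_exp]]
      in \<open>simp add: rep_scaleC\<close>)

lemma derived_rep_scaleR: "v \<in> SV \<Longrightarrow> d\<pi> X (c *\<^sub>R v) = c *\<^sub>R d\<pi> X v"
  by (simp add: scaleR_scaleC derived_rep_scaleC)

text \<open>The orbit map of \<open>d\<pi>(X)v\<close> is the partial derivative in \<open>y\<close>, in direction \<open>X\<close> at the
  identity, of the smooth map \<open>(x, y) \<mapsto> \<pi>(xy)v\<close>.\<close>

lemma smooth_vectors_derived_rep:
  assumes v: "v \<in> SV"
  shows "d\<pi> X v \<in> SV"
  unfolding smooth_vectors_iff smooth_map_vector_iff
proof clarify
  fix U \<phi> assume U: "(U, \<phi>) \<in> atlas G"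
  note u = topological_atlasD[OF top_atlas U]
  let ?F = "\<lambda>z. \<pi> (inv_into U \<phi> (fst z) \<otimes> uncoords G (snd z)) v"
  have ch: "(U \<times> U0, map_prod \<phi> (coords G)) \<in> prod_atlas (atlas G) (atlas G)"
    unfolding prod_atlas_def using U base_chart by blast
  have "smooth_map (prod_atlas (atlas G) (atlas G)) vector_atlas (\<lambda>z. (\<lambda>x. \<pi> x v) ((\<lambda>(x, y). x \<otimes> y) z))"
    using v by (intro smooth_map_compose[OF fd top_atlas2 top_atlas smooth_mult])
      (auto simp: smooth_vectors_iff topspace_eq)
  then have "smooth_on_open (\<lambda>y. \<pi> ((\<lambda>(x, y). x \<otimes> y) (inv_into (U \<times> U0) (map_prod \<phi> (coords G)) y)) v)
      (map_prod \<phi> (coords G) ` (U \<times> U0))"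
    using ch unfolding smooth_map_vector_iff by blast
  then have sm: "smooth_on_open ?F (map_prod \<phi> (coords G) ` (U \<times> U0))"
    by (rule smooth_on_open_cong) (use inv_into_map_prod[OF u(4) inj_coords] in \<open>auto simp: uncoords_eq\<close>)
  have im: "map_prod \<phi> (coords G) ` (U \<times> U0) = \<phi> ` U \<times> coords G ` U0" by force
  have "smooth_on_open (\<lambda>x. frechet_derivative ?F (at (x, e0)) (0, X)) (\<phi> ` U)"
    using smooth_on_open_partial[OF fd fd sm, of e0 X] e0(1) unfolding im by simp
  then show "smooth_on_open (\<lambda>y. \<pi> (inv_into U \<phi> y) (d\<pi> X v)) (\<phi> ` U)"
  proof (rule smooth_on_open_cong)
    fix x assume x: "x \<in> \<phi> ` U"
    define g where "g = inv_into U \<phi> x"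
    have g: "g \<in> carrier G" unfolding g_def by (rule chart_carrier[OF U x])
    have "(x, e0) \<in> map_prod \<phi> (coords G) ` (U \<times> U0)" unfolding im using x e0(1) by simp
    from partial_derivative(1)[OF smooth_on_open_derivative(1)[OF sm this]]
    have d1: "((\<lambda>y. \<pi> (g \<otimes> uncoords G y) v) has_derivative (\<lambda>w. frechet_derivative ?F (at (x, e0)) (0, w))) (at e0)"
      by (simp add: g_def)
    have "((\<lambda>y. \<pi> g (\<pi> (uncoords G y) v)) has_derivative (\<lambda>X. \<pi> g (d\<pi> X v))) (at e0)"
      using bounded_linear.has_derivative[OF rep_bounded_linear[OF g] has_diff_one_rep[OF v, unfolded has_diff_one_def]] .
    then have "((\<lambda>y. \<pi> (g \<otimes> uncoords G y) v) has_derivative (\<lambda>X. \<pi> g (d\<pi> X v))) (at e0)"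
      by (rule has_derivative_transform_within_open[OF _ open_coords e0(1)])
        (simp add: rep_mult g U0_carrier uncoords_U0)
    from has_derivative_unique[OF d1 this]
    show "frechet_derivative ?F (at (x, e0)) (0, X) = \<pi> (inv_into U \<phi> x) (d\<pi> X v)"
      unfolding g_def by (rule fun_cong)
  qed
qed

lemma derived_rep_conj:
  assumes v: "v \<in> SV" and g: "g \<in> carrier G"
  shows "d\<pi> X (\<pi> g v) = \<pi> g (d\<pi> (Ad G (inv g) X) v)"
proof (rule derived_rep_eqI)
  have "tangent (\<lambda>t. inv g \<otimes> lie_exp G (t *\<^sub>R X) \<otimes> inv (inv g)) (Ad G (inv g) X)"
    using g by (intro tangent_conj tangent_exp) auto
  from bounded_linear.has_vector_derivative[OF rep_bounded_linear[OF g] has_vector_derivative_rep[OF v this]]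
  have "((\<lambda>t. \<pi> g (\<pi> (inv g \<otimes> lie_exp G (t *\<^sub>R X) \<otimes> g) v)) has_vector_derivative
      \<pi> g (d\<pi> (Ad G (inv g) X) v)) (at 0)" using g by simp
  moreover have "\<pi> g (\<pi> (inv g \<otimes> lie_exp G (t *\<^sub>R X) \<otimes> g) v) = \<pi> (lie_exp G (t *\<^sub>R X)) (\<pi> g v)" for t
    using g by (simp add: rep_mult[symmetric] m_assoc cancel_left)
  ultimately show "((\<lambda>t. \<pi> (lie_exp G (t *\<^sub>R X)) (\<pi> g v)) has_vector_derivative \<pi> g (d\<pi> (Ad G (inv g) X) v)) (at 0)"
    by simp
qed

section \<open>Seminorms on smooth vectors\<close>

lemma foldr_smooth: "v \<in> SV \<Longrightarrow> foldr d\<pi> Xs v \<in> SV"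
  by (induction Xs) (auto intro: smooth_vectors_derived_rep)

lemma foldr_add: "v \<in> SV \<Longrightarrow> w \<in> SV \<Longrightarrow> foldr d\<pi> Xs (v + w) = foldr d\<pi> Xs v + foldr d\<pi> Xs w"
  by (induction Xs) (simp_all add: derived_rep_add foldr_smooth)

lemma foldr_scaleC: "v \<in> SV \<Longrightarrow> foldr d\<pi> Xs (c *\<^sub>C v) = c *\<^sub>C foldr d\<pi> Xs v"
  by (induction Xs) (simp_all add: derived_rep_scaleC foldr_smooth)

lemma foldr_scaleR: "v \<in> SV \<Longrightarrow> foldr d\<pi> Xs (c *\<^sub>R v) = c *\<^sub>R foldr d\<pi> Xs v"
  by (simp add: scaleR_scaleC foldr_scaleC)

lemma foldr_diff:
  assumes "v \<in> SV" "w \<in> SV"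
  shows "foldr d\<pi> Xs (v - w) = foldr d\<pi> Xs v - foldr d\<pi> Xs w"
proof -
  have "foldr d\<pi> Xs ((v - w) + w) = foldr d\<pi> Xs (v - w) + foldr d\<pi> Xs w"
    by (rule foldr_add[OF smooth_vectors_diff[OF assms] assms(2)])
  then show ?thesis by simp
qed

lemma foldr_sum:
  assumes "finite I" "\<And>i. i \<in> I \<Longrightarrow> f i \<in> SV"
  shows "foldr d\<pi> Xs (\<Sum>i\<in>I. f i) = (\<Sum>i\<in>I. foldr d\<pi> Xs (f i))"
  using assms
proof (induction I rule: finite_induct)
  case empty
  show ?case using foldr_scaleR[OF smooth_vectors_zero, of Xs 0] by simp
next
  case (insert i I)
  then show ?case by (simp add: foldr_add subspace_sum[OF smooth_vectors_subspace])
qed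

lemma foldr_conj:
  assumes "v \<in> SV" "g \<in> carrier G"
  shows "foldr d\<pi> Xs (\<pi> g v) = \<pi> g (foldr d\<pi> (map (Ad G (inv g)) Xs) v)"
  using assms by (induction Xs) (simp_all add: derived_rep_conj foldr_smooth)

definition words :: "nat \<Rightarrow> 'e list set" where
  "words n = {Xs. set Xs \<subseteq> fin_basis \<and> length Xs = n}"

lemma finite_words: "finite (words n)"
  unfolding words_def by (rule finite_lists_length_eq[OF fin_basis(1)[OF fd]])

lemma words_0: "words 0 = {[]}"
  by (auto simp: words_def)

lemma sum_words_Suc: "(\<Sum>Xs\<in>words (Suc n). f Xs) = (\<Sum>b\<in>fin_basis. \<Sum>Xs\<in>words n. f (b # Xs))"
proof -
  have "words (Suc n) = (\<lambda>(b, Xs). b # Xs) ` (fin_basis \<times> words n)"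
    by (force simp: words_def length_Suc_conv image_iff)
  moreover have "inj_on (\<lambda>(b, Xs). b # Xs) (fin_basis \<times> words n)" by (auto simp: inj_on_def)
  ultimately show ?thesis
    by (simp add: sum.reindex sum.cartesian_product case_prod_unfold)
qed

text \<open>Expanding the elements of the Lie algebra in a basis, one after the other.\<close>

lemma foldr_le_words:
  obtains C where "C > 0" "\<And>As Zs v. v \<in> SV \<Longrightarrow> norm (foldr d\<pi> As (foldr d\<pi> Zs v)) \<le>
    (\<Prod>Z\<leftarrow>Zs. C * norm Z) * (\<Sum>Bs\<in>words (length Zs). norm (foldr d\<pi> (As @ Bs) v))"
proof -
  obtain C where C: "C > 0" "\<And>b x. b \<in> fin_basis \<Longrightarrow> \<bar>coord b (x :: 'e)\<bar> \<le> C * norm x"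
    using coord_le[OF fd] by blast
  have "norm (foldr d\<pi> As (foldr d\<pi> Zs v)) \<le>
    (\<Prod>Z\<leftarrow>Zs. C * norm Z) * (\<Sum>Bs\<in>words (length Zs). norm (foldr d\<pi> (As @ Bs) v))" if v: "v \<in> SV" for As Zs v
  proof (induction Zs arbitrary: As)
    case Nil
    then show ?case by (simp add: words_0)
  next
    case (Cons Z Zs)
    define w where "w = foldr d\<pi> Zs v"
    have w: "w \<in> SV" using v by (simp add: w_def foldr_smooth)
    let ?P = "\<Prod>Z\<leftarrow>Zs. C * norm Z"
    let ?S = "\<lambda>As. \<Sum>Bs\<in>words (length Zs). norm (foldr d\<pi> (As @ Bs) v)"
    have "d\<pi> Z w = (\<Sum>b\<in>fin_basis. coord b Z *\<^sub>R d\<pi> b w)"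
      by (rule linear_eq_sum_coord[OF fd linear_derived_rep_left[OF w]])
    then have "foldr d\<pi> As (d\<pi> Z w) = (\<Sum>b\<in>fin_basis. foldr d\<pi> As (coord b Z *\<^sub>R d\<pi> b w))"
      using fin_basis(1)[OF fd] w
      by (simp only:) (rule foldr_sum; simp add: smooth_vectors_scaleR smooth_vectors_derived_rep)
    also have "\<dots> = (\<Sum>b\<in>fin_basis. coord b Z *\<^sub>R foldr d\<pi> (As @ [b]) w)"
      using w by (simp add: foldr_scaleR smooth_vectors_derived_rep)
    also have "norm \<dots> \<le> (\<Sum>b\<in>fin_basis. (C * norm Z) * (?P * ?S (As @ [b])))"
    proof (rule sum_norm_le)
      fix b :: 'e assume b: "b \<in> fin_basis"
      show "norm (coord b Z *\<^sub>R foldr d\<pi> (As @ [b]) w) \<le> (C * norm Z) * (?P * ?S (As @ [b]))"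
        unfolding norm_scaleR using C(1) Cons.IH[of "As @ [b]"]
        by (intro mult_mono C(2)[OF b]) (auto simp: w_def)
    qed
    also have "\<dots> = (C * norm Z * ?P) * (\<Sum>b\<in>fin_basis. ?S (As @ [b]))"
      by (simp add: sum_distrib_left mult.assoc)
    also have "(\<Sum>b\<in>fin_basis. ?S (As @ [b])) = (\<Sum>Bs\<in>words (Suc (length Zs)). norm (foldr d\<pi> (As @ Bs) v))"
      unfolding sum_words_Suc by simp
    finally show ?case by (simp add: w_def)
  qed
  with C(1) show ?thesis using that by blast
qed

text \<open>These seminorms, with words in a fixed basis, form an increasing sequence that defines the
  topology of the smooth vectors.\<close>

definition seminorm :: "nat \<Rightarrow> 'h \<Rightarrow> real" where
  "seminorm N v = (\<Sum>n\<le>N. \<Sum>Xs\<in>words n. norm (foldr d\<pi> Xs v))"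

lemma seminorm_nonneg: "seminorm N v \<ge> 0"
  by (simp add: seminorm_def sum_nonneg)

lemma seminorm_mono: "M \<le> N \<Longrightarrow> seminorm M v \<le> seminorm N v"
  unfolding seminorm_def by (rule sum_mono2) (auto intro: sum_nonneg)

lemma words_le_seminorm: "n \<le> N \<Longrightarrow> (\<Sum>Xs\<in>words n. norm (foldr d\<pi> Xs v)) \<le> seminorm N v"
  unfolding seminorm_def by (rule member_le_sum) (auto intro: sum_nonneg)

lemma seminorm_scaleC: "v \<in> SV \<Longrightarrow> seminorm N (c *\<^sub>C v) = norm c * seminorm N v"
  by (simp add: seminorm_def foldr_scaleC norm_scaleC sum_distrib_left)

lemma seminorm_scaleR: "v \<in> SV \<Longrightarrow> seminorm N (c *\<^sub>R v) = \<bar>c\<bar> * seminorm N v"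
  by (simp add: scaleR_scaleC seminorm_scaleC)

lemma seminorm_add:
  assumes "v \<in> SV" "w \<in> SV"
  shows "seminorm N (v + w) \<le> seminorm N v + seminorm N w"
  unfolding seminorm_def sum.distrib[symmetric] using assms
  by (intro sum_mono) (simp add: foldr_add norm_triangle_ineq)

lemma foldr_le_seminorm:
  obtains C where "C > 0" "\<And>v. v \<in> SV \<Longrightarrow> norm (foldr d\<pi> Zs v) \<le> C * seminorm (length Zs) v"
proof -
  obtain C where C: "C > 0" "\<And>As Zs v. v \<in> SV \<Longrightarrow> norm (foldr d\<pi> As (foldr d\<pi> Zs v)) \<le>
    (\<Prod>Z\<leftarrow>Zs. C * norm Z) * (\<Sum>Bs\<in>words (length Zs). norm (foldr d\<pi> (As @ Bs) v))"
    using foldr_le_words by blast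
  let ?P = "\<Prod>Z\<leftarrow>Zs. C * norm Z"
  have P: "?P \<ge> 0" using C(1) by (induction Zs) auto
  have "norm (foldr d\<pi> Zs v) \<le> (?P + 1) * seminorm (length Zs) v" if v: "v \<in> SV" for v
  proof -
    have "norm (foldr d\<pi> Zs v) \<le> ?P * (\<Sum>Bs\<in>words (length Zs). norm (foldr d\<pi> Bs v))"
      using C(2)[OF v, of "[]" Zs] by simp
    also have "\<dots> \<le> (?P + 1) * seminorm (length Zs) v"
      using P by (intro mult_mono words_le_seminorm) (auto intro: sum_nonneg)
    finally show ?thesis .
  qed
  moreover have "?P + 1 > 0" using P by simp
  ultimately show ?thesis using that by blast
qed

text \<open>Moving \<open>\<pi>(g)\<close> to the left of at most \<open>N\<close> operators \<open>d\<pi>(X\<^sub>i)\<close> replaces each \<open>X\<^sub>i\<close> by \<open>Ad(g)\<inverse>X\<^sub>i\<close>. The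
  constant is independent of \<open>g\<close>.\<close>

lemma seminorm_translate:
  obtains C where "C > 0" "\<And>v g M A. v \<in> SV \<Longrightarrow> g \<in> carrier G \<Longrightarrow> M \<ge> 0 \<Longrightarrow> A \<ge> 1 \<Longrightarrow>
    (\<And>w. norm (\<pi> g w) \<le> M * norm w) \<Longrightarrow> (\<And>Z. norm (Ad G (inv g) Z) \<le> A * norm Z) \<Longrightarrow>
    seminorm N (\<pi> g v) \<le> C * M * A ^ N * seminorm N v"
proof -
  obtain C where C: "C > 0" "\<And>As Zs v. v \<in> SV \<Longrightarrow> norm (foldr d\<pi> As (foldr d\<pi> Zs v)) \<le>
    (\<Prod>Z\<leftarrow>Zs. C * norm Z) * (\<Sum>Bs\<in>words (length Zs). norm (foldr d\<pi> (As @ Bs) v))"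
    using foldr_le_words by blast
  define K where "K = (\<Sum>n\<le>N. \<Sum>Xs\<in>words n. \<Prod>Z\<leftarrow>Xs. C * norm Z)"
  have Ppos: "(\<Prod>Z\<leftarrow>Xs. C * norm Z) \<ge> 0" for Xs :: "'e list" using C(1) by (induction Xs) auto
  have "K \<ge> 0" unfolding K_def by (intro sum_nonneg Ppos)
  have "seminorm N (\<pi> g v) \<le> (K + 1) * M * A ^ N * seminorm N v"
    if v: "v \<in> SV" and g: "g \<in> carrier G" and M: "M \<ge> 0" and A: "A \<ge> 1"
      and piM: "\<And>w. norm (\<pi> g w) \<le> M * norm w" and AdA: "\<And>Z. norm (Ad G (inv g) Z) \<le> A * norm Z" for v g M A
  proof -
    have b: "norm (foldr d\<pi> Xs (\<pi> g v)) \<le> M * ((\<Prod>Z\<leftarrow>Xs. C * norm Z) * A ^ N * seminorm N v)"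
      if n: "n \<le> N" and Xs: "Xs \<in> words n" for n Xs
    proof -
      let ?Ys = "map (Ad G (inv g)) Xs"
      have len: "length Xs = n" using Xs by (simp add: words_def)
      have prod: "(\<Prod>Z\<leftarrow>map (Ad G (inv g)) Ys. C * norm Z) \<le> (\<Prod>Z\<leftarrow>Ys. C * norm Z) * A ^ length Ys" for Ys
      proof (induction Ys)
        case (Cons Y Ys)
        have "(C * norm (Ad G (inv g) Y)) * (\<Prod>Z\<leftarrow>map (Ad G (inv g)) Ys. C * norm Z) \<le>
            (C * (A * norm Y)) * ((\<Prod>Z\<leftarrow>Ys. C * norm Z) * A ^ length Ys)"
          using C(1) A by (intro mult_mono Cons.IH mult_left_mono AdA Ppos) auto
        then show ?case by (simp add: mult_ac)
      qed simp
      have "norm (foldr d\<pi> Xs (\<pi> g v)) = norm (\<pi> g (foldr d\<pi> ?Ys v))" by (simp add: foldr_conj[OF v g])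
      also have "\<dots> \<le> M * norm (foldr d\<pi> ?Ys v)" by (rule piM)
      also have "norm (foldr d\<pi> ?Ys v) \<le> (\<Prod>Z\<leftarrow>?Ys. C * norm Z) * (\<Sum>Bs\<in>words n. norm (foldr d\<pi> Bs v))"
        using C(2)[OF v, of "[]" ?Ys] len by simp
      also have "\<dots> \<le> ((\<Prod>Z\<leftarrow>Xs. C * norm Z) * A ^ N) * seminorm N v"
      proof (rule mult_mono)
        have "(\<Prod>Z\<leftarrow>?Ys. C * norm Z) \<le> (\<Prod>Z\<leftarrow>Xs. C * norm Z) * A ^ n" using prod[of Xs] len by simp
        also have "\<dots> \<le> (\<Prod>Z\<leftarrow>Xs. C * norm Z) * A ^ N"
          using A n by (intro mult_left_mono power_increasing Ppos) auto
        finally show "(\<Prod>Z\<leftarrow>?Ys. C * norm Z) \<le> (\<Prod>Z\<leftarrow>Xs. C * norm Z) * A ^ N" .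
        show "0 \<le> (\<Prod>Z\<leftarrow>Xs. C * norm Z) * A ^ N" using A by (intro mult_nonneg_nonneg Ppos) auto
      qed (use n in \<open>auto intro: words_le_seminorm sum_nonneg\<close>)
      finally show ?thesis using M by (simp add: mult_left_mono)
    qed
    have "seminorm N (\<pi> g v) \<le> (\<Sum>n\<le>N. \<Sum>Xs\<in>words n. M * ((\<Prod>Z\<leftarrow>Xs. C * norm Z) * A ^ N * seminorm N v))"
      unfolding seminorm_def[of N "\<pi> g v"] by (intro sum_mono b) auto
    also have "\<dots> = K * (M * A ^ N * seminorm N v)"
      unfolding K_def sum_distrib_right by (intro sum.cong refl) (simp add: mult_ac)
    also have "\<dots> \<le> (K + 1) * (M * A ^ N * seminorm N v)"
      using M A seminorm_nonneg by (intro mult_right_mono mult_nonneg_nonneg) auto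
    finally show ?thesis by (simp add: mult.assoc)
  qed
  moreover have "K + 1 > 0" using \<open>K \<ge> 0\<close> by simp
  ultimately show ?thesis using that by blast
qed

lemma seminorm_foldr:
  obtains C where "C > 0" "\<And>v. v \<in> SV \<Longrightarrow> seminorm N (foldr d\<pi> Zs v) \<le> C * seminorm (N + length Zs) v"
proof -
  have "\<forall>Ys. \<exists>C>0. \<forall>v\<in>SV. norm (foldr d\<pi> Ys v) \<le> C * seminorm (length Ys) v"
  proof
    fix Ys
    obtain C where "C > 0" "\<And>v. v \<in> SV \<Longrightarrow> norm (foldr d\<pi> Ys v) \<le> C * seminorm (length Ys) v"
      using foldr_le_seminorm by blast
    then show "\<exists>C>0. \<forall>v\<in>SV. norm (foldr d\<pi> Ys v) \<le> C * seminorm (length Ys) v" by blast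
  qed
  from choice[OF this] obtain C where C: "\<And>Ys. C Ys > 0"
    "\<And>Ys v. v \<in> SV \<Longrightarrow> norm (foldr d\<pi> Ys v) \<le> C Ys * seminorm (length Ys) v"
    by blast
  define K where "K = (\<Sum>n\<le>N. \<Sum>Xs\<in>words n. C (Xs @ Zs))"
  have "K \<ge> 0" unfolding K_def by (intro sum_nonneg less_imp_le C(1))
  have "seminorm N (foldr d\<pi> Zs v) \<le> (K + 1) * seminorm (N + length Zs) v" if v: "v \<in> SV" for v
  proof -
    have "seminorm N (foldr d\<pi> Zs v) \<le> (\<Sum>n\<le>N. \<Sum>Xs\<in>words n. C (Xs @ Zs) * seminorm (N + length Zs) v)"
      unfolding seminorm_def[of N "foldr d\<pi> Zs v"]
    proof (intro sum_mono)
      fix n Xs assume n: "n \<in> {..N}" and Xs: "Xs \<in> words n"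
      have "norm (foldr d\<pi> (Xs @ Zs) v) \<le> C (Xs @ Zs) * seminorm (length (Xs @ Zs)) v" by (rule C(2)[OF v])
      also have "\<dots> \<le> C (Xs @ Zs) * seminorm (N + length Zs) v"
        using n Xs C(1)[of "Xs @ Zs"] by (intro mult_left_mono seminorm_mono) (auto simp: words_def)
      finally show "norm (foldr d\<pi> Xs (foldr d\<pi> Zs v)) \<le> C (Xs @ Zs) * seminorm (N + length Zs) v" by simp
    qed
    also have "\<dots> = K * seminorm (N + length Zs) v" by (simp add: K_def sum_distrib_right)
    also have "\<dots> \<le> (K + 1) * seminorm (N + length Zs) v" using seminorm_nonneg by (intro mult_right_mono) auto
    finally show ?thesis .
  qed
  moreover have "K + 1 > 0" using \<open>K \<ge> 0\<close> by simp
  ultimately show ?thesis using that by blast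
qed

section \<open>The topology of the space of smooth vectors\<close>

lemma topspace_smooth_topology: "topspace (smooth_topology G \<pi>) = SV"
proof -
  have A: "v \<in> \<Union> {{w \<in> SV. norm (foldr d\<pi> Xs (w - v)) < \<epsilon>} | Xs v \<epsilon>. v \<in> SV \<and> \<epsilon> > 0}" if v: "v \<in> SV" for v
  proof (rule UnionI)
    show "v \<in> {w \<in> SV. norm (foldr d\<pi> [] (w - v)) < 1}" using v by simp
    show "{w \<in> SV. norm (foldr d\<pi> [] (w - v)) < 1} \<in>
        {{w \<in> SV. norm (foldr d\<pi> Xs (w - v)) < \<epsilon>} | Xs v \<epsilon>. v \<in> SV \<and> \<epsilon> > 0}"
      using v zero_less_one by blast
  qed
  have B: "\<Union> {{w \<in> SV. norm (foldr d\<pi> Xs (w - v)) < \<epsilon>} | Xs v \<epsilon>. v \<in> SV \<and> \<epsilon> > 0} \<subseteq> SV"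
    by auto
  show ?thesis
    unfolding smooth_topology_def topology_generated_by_topspace by (rule equalityI[OF B subsetI[OF A]])
qed

lemma open_smooth_ball:
  "v \<in> SV \<Longrightarrow> \<epsilon> > 0 \<Longrightarrow> openin (smooth_topology G \<pi>) {w \<in> SV. norm (foldr d\<pi> Xs (w - v)) < \<epsilon>}"
  unfolding smooth_topology_def by (rule topology_generated_by_Basis) blast

lemma continuous_map_foldr_norm:
  "continuous_map (smooth_topology G \<pi>) euclideanreal (\<lambda>v. norm (foldr d\<pi> Xs v))"
  unfolding continuous_map_def
proof (intro conjI allI impI)
  fix O' :: "real set" assume "openin euclideanreal O'"
  then have O': "open O'" by simp
  show "openin (smooth_topology G \<pi>) {v \<in> topspace (smooth_topology G \<pi>). norm (foldr d\<pi> Xs v) \<in> O'}"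
  proof (subst openin_subopen, intro ballI)
    fix v assume "v \<in> {v \<in> topspace (smooth_topology G \<pi>). norm (foldr d\<pi> Xs v) \<in> O'}"
    then have v: "v \<in> SV" "norm (foldr d\<pi> Xs v) \<in> O'" by (auto simp: topspace_smooth_topology)
    obtain \<epsilon> where \<epsilon>: "\<epsilon> > 0" "ball (norm (foldr d\<pi> Xs v)) \<epsilon> \<subseteq> O'" using O' v(2) open_contains_ball by blast
    have "{w \<in> SV. norm (foldr d\<pi> Xs (w - v)) < \<epsilon>} \<subseteq> {v \<in> topspace (smooth_topology G \<pi>). norm (foldr d\<pi> Xs v) \<in> O'}"
    proof
      fix w assume w: "w \<in> {w \<in> SV. norm (foldr d\<pi> Xs (w - v)) < \<epsilon>}"
      then have "norm (foldr d\<pi> Xs w - foldr d\<pi> Xs v) < \<epsilon>" using foldr_diff[of w v Xs] v(1) by simp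
      then have "\<bar>norm (foldr d\<pi> Xs w) - norm (foldr d\<pi> Xs v)\<bar> < \<epsilon>"
        using norm_triangle_ineq3[of "foldr d\<pi> Xs w" "foldr d\<pi> Xs v"] by linarith
      then have "norm (foldr d\<pi> Xs w) \<in> ball (norm (foldr d\<pi> Xs v)) \<epsilon>" by (simp add: dist_real_def abs_minus_commute)
      then show "w \<in> {v \<in> topspace (smooth_topology G \<pi>). norm (foldr d\<pi> Xs v) \<in> O'}"
        using w \<epsilon>(2) by (auto simp: topspace_smooth_topology)
    qed
    moreover have "v \<in> {w \<in> SV. norm (foldr d\<pi> Xs (w - v)) < \<epsilon>}"
      using v(1) \<epsilon>(1) foldr_diff[OF v(1) v(1), of Xs] by simp
    ultimately show "\<exists>S. openin (smooth_topology G \<pi>) S \<and> v \<in> S \<and>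
        S \<subseteq> {v \<in> topspace (smooth_topology G \<pi>). norm (foldr d\<pi> Xs v) \<in> O'}"
      using open_smooth_ball[OF v(1) \<epsilon>(1)] by (intro exI[of _ "{w \<in> SV. norm (foldr d\<pi> Xs (w - v)) < \<epsilon>}"]) simp
  qed
qed simp

lemma continuous_seminorm_seminorm:
  assumes "c \<ge> 0"
  shows "continuous_seminorm G \<pi> (\<lambda>v. c * seminorm N v)"
  unfolding continuous_seminorm_def
proof (intro conjI ballI allI)
  show "continuous_map (smooth_topology G \<pi>) euclideanreal (\<lambda>v. c * seminorm N v)"
    unfolding seminorm_def
    by (intro continuous_map_real_mult_left continuous_map_sum finite_atMost finite_words continuous_map_foldr_norm)
  fix v w d assume "v \<in> SV" "w \<in> SV"
  then show "c * seminorm N (v + w) \<le> c * seminorm N v + c * seminorm N w"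
    using mult_left_mono[OF seminorm_add assms] by (simp add: distrib_left)
qed (use assms in \<open>auto simp: seminorm_nonneg seminorm_scaleC\<close>)

text \<open>The subbasis of the topology involves arbitrary elements of the Lie algebra; a single
  seminorm of sufficiently high order dominates finitely many of them.\<close>

lemma smooth_topology_neighbourhood:
  assumes "openin (smooth_topology G \<pi>) S" "x \<in> S"
  shows "\<exists>N. \<exists>\<delta>>0. {w \<in> SV. seminorm N (w - x) < \<delta>} \<subseteq> S"
proof -
  let ?B = "{{w \<in> SV. norm (foldr d\<pi> Xs (w - v)) < \<epsilon>} | Xs v \<epsilon>. v \<in> SV \<and> \<epsilon> > 0}"
  have "generate_topology_on ?B S"
    using assms(1) unfolding smooth_topology_def openin_topology_generated_by_iff .
  then show ?thesis
    using assms(2)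
  proof (induction arbitrary: x rule: generate_topology_on.induct)
    case (Int a b)
    then obtain M \<delta> N \<epsilon> where *: "\<delta> > 0" "{w \<in> SV. seminorm M (w - x) < \<delta>} \<subseteq> a"
      "\<epsilon> > 0" "{w \<in> SV. seminorm N (w - x) < \<epsilon>} \<subseteq> b" by (meson IntD1 IntD2)
    have "{w \<in> SV. seminorm (max M N) (w - x) < min \<delta> \<epsilon>} \<subseteq> a \<inter> b"
    proof
      fix w assume w: "w \<in> {w \<in> SV. seminorm (max M N) (w - x) < min \<delta> \<epsilon>}"
      then have "seminorm M (w - x) < \<delta>" "seminorm N (w - x) < \<epsilon>"
        using seminorm_mono[of M "max M N" "w - x"] seminorm_mono[of N "max M N" "w - x"] by auto
      with w * show "w \<in> a \<inter> b" by blast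
    qed
    with * show ?case by (intro exI[of _ "max M N"] exI[of _ "min \<delta> \<epsilon>"]) auto
  next
    case (UN F)
    then obtain k where "k \<in> F" "x \<in> k" by auto
    from UN.IH[OF this] obtain N \<delta> where "\<delta> > 0" "{w \<in> SV. seminorm N (w - x) < \<delta>} \<subseteq> k" by auto
    with \<open>k \<in> F\<close> show ?case by blast
  next
    case (Basis S)
    then obtain Xs v \<epsilon> where S: "S = {w \<in> SV. norm (foldr d\<pi> Xs (w - v)) < \<epsilon>}" "v \<in> SV" "\<epsilon> > 0" by auto
    obtain C where C: "C > 0" "\<And>v. v \<in> SV \<Longrightarrow> norm (foldr d\<pi> Xs v) \<le> C * seminorm (length Xs) v"
      using foldr_le_seminorm by blast
    have x: "x \<in> SV" "norm (foldr d\<pi> Xs (x - v)) < \<epsilon>" using Basis S by auto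
    define \<delta> where "\<delta> = (\<epsilon> - norm (foldr d\<pi> Xs (x - v))) / C"
    have "{w \<in> SV. seminorm (length Xs) (w - x) < \<delta>} \<subseteq> S"
    proof
      fix w assume w: "w \<in> {w \<in> SV. seminorm (length Xs) (w - x) < \<delta>}"
      then have wx: "w - x \<in> SV" "x - v \<in> SV" using x S smooth_vectors_diff by auto
      have "C * seminorm (length Xs) (w - x) < C * \<delta>" using w C(1) by simp
      also have "C * \<delta> = \<epsilon> - norm (foldr d\<pi> Xs (x - v))" using C(1) by (simp add: \<delta>_def)
      finally have "norm (foldr d\<pi> Xs (w - x)) < \<epsilon> - norm (foldr d\<pi> Xs (x - v))"
        using C(2)[OF wx(1)] by simp
      moreover have "foldr d\<pi> Xs (w - v) = foldr d\<pi> Xs (w - x) + foldr d\<pi> Xs (x - v)"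
        using foldr_add[OF wx, of Xs] by simp
      ultimately have "norm (foldr d\<pi> Xs (w - v)) < \<epsilon>"
        using norm_triangle_ineq[of "foldr d\<pi> Xs (w - x)" "foldr d\<pi> Xs (x - v)"] by simp
      then show "w \<in> S" using w by (simp add: S)
    qed
    moreover have "\<delta> > 0" using x C by (simp add: \<delta>_def)
    ultimately show ?case by blast
  qed simp
qed

text \<open>On a neighbourhood \<open>{seminorm N < \<delta>}\<close> of \<open>0\<close> the functional is bounded by \<open>1\<close>; the rest is
  homogeneity. As the seminorm of \<open>v\<close> may vanish, \<open>v\<close> is rescaled by a slightly larger number.\<close>

lemma continuous_functional_bound:
  fixes l :: "'h \<Rightarrow> complex"
  assumes lin: "\<And>c v. v \<in> SV \<Longrightarrow> l (c *\<^sub>C v) = c * l v"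
    and cont: "continuous_map (smooth_topology G \<pi>) euclidean l"
  obtains N C where "C > 0" "\<And>v. v \<in> SV \<Longrightarrow> norm (l v) \<le> C * seminorm N v"
proof -
  let ?S = "{v \<in> topspace (smooth_topology G \<pi>). l v \<in> ball 0 1}"
  have op: "openin (smooth_topology G \<pi>) ?S" by (rule openin_continuous_map_preimage[OF cont]) simp
  have "l 0 = 0" using lin[OF smooth_vectors_zero, of 0] scaleR_scaleC[of 0 "0 :: 'h"] by simp
  then have "0 \<in> ?S" by (simp add: topspace_smooth_topology smooth_vectors_zero)
  from smooth_topology_neighbourhood[OF op this] obtain N \<delta> where \<delta>: "\<delta> > 0"
    and sub: "{w \<in> SV. seminorm N (w - 0) < \<delta>} \<subseteq> ?S" by blast
  have "norm (l v) \<le> (1 / \<delta>) * seminorm N v" if v: "v \<in> SV" for v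
  proof (rule field_le_epsilon)
    fix e :: real assume "e > 0"
    define t where "t = seminorm N v + e * \<delta>"
    have t: "t > 0" using seminorm_nonneg[of N v] \<open>e > 0\<close> \<delta> by (simp add: t_def add_nonneg_pos)
    let ?w = "(\<delta> / t) *\<^sub>R v"
    have "seminorm N ?w = \<delta> * (seminorm N v / t)" using t \<delta> v by (simp add: seminorm_scaleR)
    also have "\<dots> < \<delta> * 1"
      using t \<delta> \<open>e > 0\<close> by (intro mult_strict_left_mono) (auto simp: t_def divide_less_eq)
    finally have "?w \<in> {w \<in> SV. seminorm N (w - 0) < \<delta>}" using smooth_vectors_scaleR[OF v] by simp
    then have "?w \<in> ?S" using sub by blast
    then have "norm (l ?w) < 1" by simp
    moreover have "l ?w = of_real (\<delta> / t) * l v" using lin[OF v] by (simp add: scaleR_scaleC)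
    ultimately have "\<delta> / t * norm (l v) < 1" using t \<delta> by (simp add: norm_mult norm_divide)
    then have "norm (l v) < t / \<delta>" using t \<delta> by (simp add: field_simps)
    then show "norm (l v) \<le> 1 / \<delta> * seminorm N v + e" using \<delta> by (simp add: t_def field_simps)
  qed
  with \<delta> show ?thesis using that[of "1 / \<delta>" N] by simp
qed

end

section \<open>Derivatives of functionals along one-parameter groups\<close>

lemma has_vector_derivative_at_iff_quotient:
  "(f has_vector_derivative D) (at 0) \<longleftrightarrow> ((\<lambda>t. (f t - f 0) /\<^sub>R t) \<longlongrightarrow> D) (at (0 :: real))"
proof -
  have "norm (f h - f 0 - h *\<^sub>R D) / norm h = norm ((f h - f 0) /\<^sub>R h - D)" if "h \<noteq> 0" for h
  proof -
    have "(f h - f 0) /\<^sub>R h - D = (f h - f 0 - h *\<^sub>R D) /\<^sub>R h" using that by (simp add: scaleR_diff_right)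
    then show ?thesis by (simp add: divide_inverse mult.commute)
  qed
  then have "((\<lambda>h. norm (f h - f 0 - h *\<^sub>R D) / norm h) \<longlongrightarrow> 0) (at 0) \<longleftrightarrow>
      ((\<lambda>h. norm ((f h - f 0) /\<^sub>R h - D)) \<longlongrightarrow> 0) (at 0)"
    by (intro Lim_cong_within) auto
  then show ?thesis
    by (simp add: has_vector_derivative_def has_derivative_at bounded_linear_scaleR_left
        tendsto_norm_zero_iff LIM_zero_iff)
qed

context lie_rep
begin

lemma rep_exp_continuous: "continuous_on UNIV (\<lambda>t. \<pi> (lie_exp G (t *\<^sub>R Y)) v)"
proof -
  have "continuous_map euclideanreal (prod_topology T euclidean) (\<lambda>t. (lie_exp G (t *\<^sub>R Y), v))"
    by (intro continuous_map_pairedI continuous_exp) simp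
  from continuous_map_compose[OF this rep_continuous] show ?thesis by (simp add: o_def)
qed

lemma has_vector_derivative_rep_exp:
  assumes "v \<in> SV"
  shows "((\<lambda>t. \<pi> (lie_exp G (t *\<^sub>R Y)) v) has_vector_derivative \<pi> (lie_exp G (t *\<^sub>R Y)) (d\<pi> Y v)) (at t)"
proof -
  from bounded_linear.has_vector_derivative[OF rep_bounded_linear[OF exp_carrier] has_vector_derivative_rep[OF assms tangent_exp]]
  have "((\<lambda>h. \<pi> (lie_exp G ((t + h) *\<^sub>R Y)) v) has_vector_derivative \<pi> (lie_exp G (t *\<^sub>R Y)) (d\<pi> Y v)) (at 0)"
    by (simp add: exp_scale_add rep_mult)
  then show ?thesis using has_vector_derivative_shift[of "\<lambda>t. \<pi> (lie_exp G (t *\<^sub>R Y)) v" t] by simp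
qed

text \<open>Integrating \<open>d\<pi>(Y) f(t) \<approx> g\<close> along the group generated by \<open>Y\<close> compares the orbit of
  \<open>f(t)\<close> with its expected linear part, up to errors that are uniform in \<open>t\<close>. This survives the
  limit and shows that \<open>g\<close> is the derivative of the orbit of \<open>v\<close>.\<close>

lemma derived_rep_closed:
  assumes F: "F \<noteq> bot" and f: "\<And>t. f t \<in> SV" and "(f \<longlongrightarrow> v) F" and "((\<lambda>t. d\<pi> Y (f t)) \<longlongrightarrow> g) F"
  shows "d\<pi> Y v = g"
proof (rule derived_rep_eqI)
  let ?p = "\<lambda>s. \<pi> (lie_exp G (s *\<^sub>R Y))"
  obtain M c where Mc: "M \<ge> 0" "c \<ge> 0" "\<And>t v. norm (?p t v) \<le> M * exp (c * \<bar>t\<bar>) * norm v"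
    using rep.action_exp_bound[of Y] by blast
  define N where "N = M * exp c"
  have N: "norm (?p s v) \<le> N * norm v" if "\<bar>s\<bar> \<le> 1" for s v
  proof -
    have "M * exp (c * \<bar>s\<bar>) * norm v \<le> M * exp c * norm v"
      using Mc(1,2) that by (intro mult_right_mono mult_left_mono) (auto simp: mult_left_le)
    then show ?thesis using Mc(3)[of s v] by (simp add: N_def)
  qed
  have bl: "bounded_linear (?p s)" for s by (rule rep_bounded_linear) simp
  have lim: "norm (?p s v - v - s *\<^sub>R g) \<le> \<bar>s\<bar> * e"
    if s: "\<bar>s\<bar> \<le> 1" and e: "\<And>r. \<bar>r\<bar> \<le> \<bar>s\<bar> \<Longrightarrow> norm (?p r g - g) \<le> e" for s e
  proof -
    have est: "norm (?p s (f t) - f t - s *\<^sub>R g) \<le> (N * norm (d\<pi> Y (f t) - g) + e) * \<bar>s\<bar>" for t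
    proof -
      let ?h = "\<lambda>r. ?p r (f t) - r *\<^sub>R g"
      have "norm (?h s - ?h 0) \<le> (N * norm (d\<pi> Y (f t) - g) + e) * norm (s - 0)"
      proof (rule differentiable_bound[of "{-\<bar>s\<bar>..\<bar>s\<bar>}"])
        fix r assume r: "r \<in> {-\<bar>s\<bar>..\<bar>s\<bar>}"
        have "(?h has_vector_derivative (?p r (d\<pi> Y (f t)) - 1 *\<^sub>R g)) (at r)"
          by (intro has_vector_derivative_diff has_vector_derivative_rep_exp f)
            (auto intro!: derivative_eq_intros)
        then show "(?h has_derivative (\<lambda>h. h *\<^sub>R (?p r (d\<pi> Y (f t)) - g))) (at r within {-\<bar>s\<bar>..\<bar>s\<bar>})"
          by (auto simp: has_vector_derivative_def intro: has_derivative_at_withinI)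
        show "onorm (\<lambda>h. h *\<^sub>R (?p r (d\<pi> Y (f t)) - g)) \<le> N * norm (d\<pi> Y (f t) - g) + e"
        proof (rule onorm_le)
          fix h :: real
          have "?p r (d\<pi> Y (f t)) - g = ?p r (d\<pi> Y (f t) - g) + (?p r g - g)"
            by (simp add: linear_diff[OF bounded_linear.linear[OF bl]])
          also have "norm \<dots> \<le> N * norm (d\<pi> Y (f t) - g) + e"
            using r s by (intro norm_triangle_le add_mono N e) auto
          finally show "norm (h *\<^sub>R (?p r (d\<pi> Y (f t)) - g)) \<le> (N * norm (d\<pi> Y (f t) - g) + e) * norm h"
            by (simp add: mult.commute[of _ "\<bar>h\<bar>"] mult_left_mono)
        qed
      qed auto
      moreover have "?h s - ?h 0 = ?p s (f t) - f t - s *\<^sub>R g" by (simp add: rep_one)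
      ultimately show ?thesis by (simp only: diff_0_right real_norm_def)
    qed
    have lower: "((\<lambda>t. norm (?p s (f t) - f t - s *\<^sub>R g)) \<longlongrightarrow> norm (?p s v - v - s *\<^sub>R g)) F"
      by (intro tendsto_norm tendsto_diff bounded_linear.tendsto[OF bl] assms tendsto_const)
    have upper: "((\<lambda>t. (N * norm (d\<pi> Y (f t) - g) + e) * \<bar>s\<bar>) \<longlongrightarrow> (N * norm (g - g) + e) * \<bar>s\<bar>) F"
      by (intro tendsto_intros assms)
    have "norm (?p s v - v - s *\<^sub>R g) \<le> (N * norm (g - g) + e) * \<bar>s\<bar>"
      by (rule tendsto_le[OF F upper lower]) (simp add: est)
    then show ?thesis by (simp add: mult.commute)
  qed
  show "((\<lambda>t. ?p t v) has_vector_derivative g) (at 0)"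
    unfolding has_vector_derivative_def has_derivative_at_alt
  proof (intro conjI allI impI)
    show "bounded_linear (\<lambda>h. h *\<^sub>R g)" by (rule bounded_linear_scaleR_left)
    fix e :: real assume "e > 0"
    have "isCont (\<lambda>t. ?p t g) 0" using rep_exp_continuous by (simp add: continuous_on_eq_continuous_at)
    then obtain d where d: "d > 0" "\<And>r. dist r 0 < d \<Longrightarrow> dist (?p r g) (?p 0 g) < e"
      using \<open>e > 0\<close> unfolding continuous_at_eps_delta by blast
    have "norm (?p s v - ?p 0 v - (s - 0) *\<^sub>R g) \<le> e * norm (s - 0)" if "norm (s - 0) < min d 1" for s
    proof -
      have "norm (?p r g - g) \<le> e" if "\<bar>r\<bar> \<le> \<bar>s\<bar>" for r
        using d(2)[of r] that \<open>norm (s - 0) < min d 1\<close> by (simp add: dist_norm rep_one)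
      with lim[of s e] that show ?thesis by (simp add: rep_one mult.commute)
    qed
    moreover have "min d 1 > 0" using d(1) by simp
    ultimately show "\<exists>d>0. \<forall>y. norm (y - 0) < d \<longrightarrow> norm (?p y v - ?p 0 v - (y - 0) *\<^sub>R g) \<le> e * norm (y - 0)"
      by blast
  qed
qed

text \<open>A class of curves that is stable under \<open>d\<pi>(Z(t))\<close> for differentiable \<open>Z\<close>, and whose members stay
  differentiable when \<open>\<pi>(exp tX)\<close> is applied to them.\<close>

inductive_set comb :: "(real \<Rightarrow> 'h) set" where
  comb_zero: "(\<lambda>t. 0) \<in> comb"
| comb_add_term: "f \<in> comb \<Longrightarrow> c differentiable (at (0 :: real)) \<Longrightarrow> w \<in> SV \<Longrightarrow>
    (\<lambda>t. f t + (c t :: real) *\<^sub>R w) \<in> comb"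

lemma comb_smooth: "f \<in> comb \<Longrightarrow> f t \<in> SV"
  by (induction rule: comb.induct) (auto intro: smooth_vectors_zero smooth_vectors_add smooth_vectors_scaleR)

lemma comb_add:
  assumes "f \<in> comb" "g \<in> comb"
  shows "(\<lambda>t. f t + g t) \<in> comb"
  using assms(2)
proof (induction rule: comb.induct)
  case comb_zero
  then show ?case using assms(1) by simp
next
  case (comb_add_term g c w)
  from comb.comb_add_term[OF comb_add_term.IH comb_add_term.hyps(2,3)]
  show ?case by (simp add: add.assoc)
qed

lemma comb_sum: "finite I \<Longrightarrow> (\<And>i. i \<in> I \<Longrightarrow> f i \<in> comb) \<Longrightarrow> (\<lambda>t. \<Sum>i\<in>I. f i t) \<in> comb"
  by (induction I rule: finite_induct) (auto intro: comb_zero comb_add)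

lemma comb_term:
  assumes "c differentiable (at (0 :: real))" "w \<in> SV"
  shows "(\<lambda>t. (c t :: real) *\<^sub>R w) \<in> comb"
  using comb_add_term[OF comb_zero assms] by simp

lemma comb_derived_rep:
  assumes "f \<in> comb" and Z: "\<And>b. (\<lambda>t. coord b (Z t)) differentiable (at (0 :: real))"
  shows "(\<lambda>t. d\<pi> (Z t) (f t)) \<in> comb"
  using assms(1)
proof (induction rule: comb.induct)
  case comb_zero
  have "d\<pi> X 0 = 0" for X using derived_rep_scaleR[OF smooth_vectors_zero, of X 0] by simp
  then show ?case by (simp add: comb.comb_zero)
next
  case (comb_add_term f c w)
  have "(\<lambda>t. \<Sum>b\<in>fin_basis. (c t * coord b (Z t)) *\<^sub>R d\<pi> b w) \<in> comb"
    by (intro comb_sum comb_term differentiable_mult Z comb_add_term.hyps smooth_vectors_derived_rep fin_basis(1)[OF fd])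
  from comb_add[OF comb_add_term.IH this]
  have "(\<lambda>t. d\<pi> (Z t) (f t) + (\<Sum>b\<in>fin_basis. (c t * coord b (Z t)) *\<^sub>R d\<pi> b w)) \<in> comb" .
  moreover have "d\<pi> (Z t) (f t + c t *\<^sub>R w) =
      d\<pi> (Z t) (f t) + (\<Sum>b\<in>fin_basis. (c t * coord b (Z t)) *\<^sub>R d\<pi> b w)" for t
  proof -
    have "d\<pi> (Z t) w = (\<Sum>b\<in>fin_basis. coord b (Z t) *\<^sub>R d\<pi> b w)"
      by (rule linear_eq_sum_coord[OF fd linear_derived_rep_left[OF comb_add_term.hyps(3)]])
    then show ?thesis
      using comb_add_term.hyps comb_smooth
      by (simp add: derived_rep_add smooth_vectors_scaleR derived_rep_scaleR scaleR_sum_right)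
  qed
  ultimately show ?case by simp
qed

lemma comb_rep_differentiable:
  assumes "f \<in> comb"
  shows "\<exists>g. ((\<lambda>t. \<pi> (lie_exp G (t *\<^sub>R X)) (f t)) has_vector_derivative g) (at 0)"
  using assms
proof (induction rule: comb.induct)
  case comb_zero
  show ?case by (rule exI[of _ 0]) (simp add: linear_0[OF rep_linear])
next
  case (comb_add_term f c w)
  from comb_add_term.IH obtain g where
    g: "((\<lambda>t. \<pi> (lie_exp G (t *\<^sub>R X)) (f t)) has_vector_derivative g) (at 0)" by blast
  obtain c' where "(c has_real_derivative c') (at 0)"
    using comb_add_term.hyps(2) real_differentiable_def by blast
  from has_vector_derivative_add[OF g has_vector_derivative_scaleR[OF this
      has_vector_derivative_rep[OF comb_add_term.hyps(3) tangent_exp]]]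
  show ?case by (intro exI) (simp add: rep_add rep_scaleR)
qed

text \<open>The operators \<open>d\<pi>(Y)\<close> do not commute with differentiation along \<open>exp(tX)\<close> for free, since
  the topology of the smooth vectors is finer than that of the Hilbert space. Moving \<open>\<pi>(exp tX)\<close>
  to the left through the \<open>d\<pi>(Y\<^sub>i)\<close> shows that a derivative exists; that it is the expected one
  follows since the \<open>d\<pi>(Y\<^sub>i)\<close> are closed.\<close>

lemma has_vector_derivative_foldr_rep:
  assumes w: "w \<in> SV"
  shows "((\<lambda>t. foldr d\<pi> Ys (\<pi> (lie_exp G (t *\<^sub>R X)) w)) has_vector_derivative foldr d\<pi> Ys (d\<pi> X w)) (at 0)"
proof (induction Ys)
  case Nil
  then show ?case using has_vector_derivative_rep[OF w tangent_exp] by simp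
next
  case (Cons Y Ys)
  let ?p = "\<lambda>t. \<pi> (lie_exp G (t *\<^sub>R X))"
  have comb: "(\<lambda>t. foldr d\<pi> (map (Ad G (inv (lie_exp G (t *\<^sub>R X)))) Zs) w) \<in> comb" for Zs
  proof (induction Zs)
    case Nil
    have "(\<lambda>t. 1 *\<^sub>R w) \<in> comb" by (rule comb_term[OF _ w]) simp
    then show ?case by simp
  next
    case (Cons Z Zs)
    have "(\<lambda>t. coord b (Ad G (lie_exp G (t *\<^sub>R (- X))) Z)) differentiable (at 0)" for b
      using bounded_linear.has_vector_derivative[OF bounded_linear_coord[OF fd] has_vector_derivative_Ad_exp[of "- X" Z 0]]
      by (rule differentiableI_vector)
    then have "(\<lambda>t. coord b (Ad G (inv (lie_exp G (t *\<^sub>R X))) Z)) differentiable (at 0)" for b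
      by (simp add: exp_minus)
    from comb_derived_rep[OF Cons.IH this] show ?case by simp
  qed
  from comb_rep_differentiable[OF comb[of "Y # Ys"], of X]
  obtain g where "((\<lambda>t. ?p t (foldr d\<pi> (map (Ad G (inv (lie_exp G (t *\<^sub>R X)))) (Y # Ys)) w))
      has_vector_derivative g) (at 0)" by blast
  then have g: "((\<lambda>t. foldr d\<pi> (Y # Ys) (?p t w)) has_vector_derivative g) (at 0)"
    unfolding foldr_conj[OF w exp_carrier] .
  define f where "f t = foldr d\<pi> Ys ((?p t w - w) /\<^sub>R t)" for t
  have pw: "?p t w \<in> SV" for t by (rule smooth_vectors_rep[OF w]) simp
  have quot: "foldr d\<pi> Zs ((?p t w - w) /\<^sub>R t) = (foldr d\<pi> Zs (?p t w) - foldr d\<pi> Zs (?p 0 w)) /\<^sub>R t" for Zs t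
    using pw w by (simp add: foldr_scaleR foldr_diff smooth_vectors_diff rep_one)
  have lim: "((\<lambda>t. foldr d\<pi> Zs ((?p t w - w) /\<^sub>R t)) \<longlongrightarrow> u) (at 0)"
    if "((\<lambda>t. foldr d\<pi> Zs (?p t w)) has_vector_derivative u) (at 0)" for Zs u
    using that unfolding quot has_vector_derivative_at_iff_quotient .
  have "d\<pi> Y (foldr d\<pi> Ys (d\<pi> X w)) = g"
  proof (rule derived_rep_closed[of "at 0" f])
    show "f t \<in> SV" for t
      unfolding f_def using pw w by (intro foldr_smooth smooth_vectors_scaleR smooth_vectors_diff)
    show "(f \<longlongrightarrow> foldr d\<pi> Ys (d\<pi> X w)) (at 0)" unfolding f_def by (rule lim[OF Cons.IH])
    show "((\<lambda>t. d\<pi> Y (f t)) \<longlongrightarrow> g) (at 0)" using lim[OF g] by (simp add: f_def)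
  qed simp
  then show ?case using g by simp
qed

lemma has_vector_derivative_functional:
  fixes l :: "'h \<Rightarrow> complex"
  assumes add: "\<And>v w. v \<in> SV \<Longrightarrow> w \<in> SV \<Longrightarrow> l (v + w) = l v + l w"
    and scale: "\<And>c v. v \<in> SV \<Longrightarrow> l (c *\<^sub>C v) = c * l v"
    and cont: "continuous_map (smooth_topology G \<pi>) euclidean l"
    and w: "w \<in> SV"
  shows "((\<lambda>t. l (\<pi> (lie_exp G (t *\<^sub>R X)) w)) has_vector_derivative l (d\<pi> X w)) (at 0)"
proof -
  let ?p = "\<lambda>t. \<pi> (lie_exp G (t *\<^sub>R X))"
  obtain N C where C: "C > 0" "\<And>v. v \<in> SV \<Longrightarrow> norm (l v) \<le> C * seminorm N v"
    using continuous_functional_bound[OF scale cont] by blast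
  have pw: "?p t w \<in> SV" for t by (rule smooth_vectors_rep[OF w]) simp
  have Xw: "d\<pi> X w \<in> SV" by (rule smooth_vectors_derived_rep[OF w])
  define u where "u t = (?p t w - w) /\<^sub>R t - d\<pi> X w" for t
  have u: "u t \<in> SV" for t
    unfolding u_def by (intro smooth_vectors_diff smooth_vectors_scaleR pw w Xw)
  have lR: "l (c *\<^sub>R v) = c *\<^sub>R l v" if "v \<in> SV" for c v
    using scale[OF that, of "of_real c"] by (simp add: scaleR_scaleC scaleR_conv_of_real)
  have ldiff: "l (v - w) = l v - l w" if "v \<in> SV" "w \<in> SV" for v w
    using add[OF smooth_vectors_diff[OF that] that(2)] by simp
  have "((\<lambda>t. foldr d\<pi> Ys (u t)) \<longlongrightarrow> 0) (at 0)" for Ys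
  proof -
    have "foldr d\<pi> Ys (u t) = (foldr d\<pi> Ys (?p t w) - foldr d\<pi> Ys (?p 0 w)) /\<^sub>R t - foldr d\<pi> Ys (d\<pi> X w)" for t
      unfolding u_def using pw w Xw
      by (simp add: foldr_scaleR foldr_diff smooth_vectors_diff smooth_vectors_scaleR rep_one)
    moreover have "((\<lambda>t. (foldr d\<pi> Ys (?p t w) - foldr d\<pi> Ys (?p 0 w)) /\<^sub>R t - foldr d\<pi> Ys (d\<pi> X w)) \<longlongrightarrow>
        foldr d\<pi> Ys (d\<pi> X w) - foldr d\<pi> Ys (d\<pi> X w)) (at 0)"
      using has_vector_derivative_foldr_rep[OF w, of Ys X]
      unfolding has_vector_derivative_at_iff_quotient by (intro tendsto_diff tendsto_const)
    ultimately show ?thesis by simp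
  qed
  from tendsto_norm_zero[OF this] have "((\<lambda>t. seminorm N (u t)) \<longlongrightarrow> (\<Sum>n\<le>N. \<Sum>Xs\<in>words n. 0)) (at 0)"
    unfolding seminorm_def by (intro tendsto_sum)
  then have "((\<lambda>t. C * seminorm N (u t)) \<longlongrightarrow> 0) (at 0)" using tendsto_mult_right_zero by simp
  then have lu: "((\<lambda>t. l (u t)) \<longlongrightarrow> 0) (at 0)"
    by (rule Lim_null_comparison[rotated]) (simp add: C(2) u)
  have "l (u t) = (l (?p t w) - l (?p 0 w)) /\<^sub>R t - l (d\<pi> X w)" for t
    unfolding u_def using pw w Xw by (simp add: lR ldiff smooth_vectors_diff smooth_vectors_scaleR rep_one)
  with lu have "((\<lambda>t. (l (?p t w) - l (?p 0 w)) /\<^sub>R t - l (d\<pi> X w)) \<longlongrightarrow> 0) (at 0)" by simp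
  then have "((\<lambda>t. (l (?p t w) - l (?p 0 w)) /\<^sub>R t) \<longlongrightarrow> l (d\<pi> X w)) (at 0)" by (simp add: LIM_zero_iff)
  then show ?thesis unfolding has_vector_derivative_at_iff_quotient .
qed

text \<open>If \<open>l\<close> is not zero, the differentiability of \<open>t \<mapsto> \<psi>(exp tX)\<close> at \<open>0\<close> is a consequence of
  the equivariance of \<open>l\<close>.\<close>

lemma whittaker_functional_derived_rep:
  assumes l: "l \<in> whittaker_functionals G N \<psi> \<pi>" and X: "\<And>t. lie_exp G (t *\<^sub>R X) \<in> N" and w: "w \<in> SV"
  shows "l (d\<pi> X w) = character_derivative G \<psi> X * l w"
proof -
  have add: "\<And>v w. v \<in> SV \<Longrightarrow> w \<in> SV \<Longrightarrow> l (v + w) = l v + l w"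
    and scale: "\<And>c v. v \<in> SV \<Longrightarrow> l (c *\<^sub>C v) = c * l v"
    and equi: "\<And>x v. v \<in> SV \<Longrightarrow> x \<in> N \<Longrightarrow> l (\<pi> x v) = \<psi> x * l v"
    and cont: "continuous_map (smooth_topology G \<pi>) euclidean l"
    using l unfolding whittaker_functionals_def by auto
  have d: "((\<lambda>t. \<psi> (lie_exp G (t *\<^sub>R X)) * l v) has_vector_derivative l (d\<pi> X v)) (at 0)" if "v \<in> SV" for v
    using has_vector_derivative_functional[OF add scale cont that, of X] equi[OF that X] by simp
  show ?thesis
  proof (cases "l w = 0")
    case True
    then have "((\<lambda>t. 0) has_vector_derivative l (d\<pi> X w)) (at (0 :: real))" using d[OF w] by simp
    then have "l (d\<pi> X w) = 0" using vector_derivative_unique_at has_vector_derivative_const by blast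
    then show ?thesis using True by simp
  next
    case False
    have "((\<lambda>t. \<psi> (lie_exp G (t *\<^sub>R X)) * l w * inverse (l w)) has_vector_derivative l (d\<pi> X w) * inverse (l w)) (at 0)"
      by (rule bounded_linear.has_vector_derivative[OF bounded_linear_mult_left d[OF w]])
    then have "((\<lambda>t. \<psi> (lie_exp G (t *\<^sub>R X))) has_vector_derivative l (d\<pi> X w) * inverse (l w)) (at 0)"
      using False by (simp add: mult.assoc)
    then have "character_derivative G \<psi> X = l (d\<pi> X w) * inverse (l w)"
      unfolding character_derivative_def by (rule vector_derivative_at)
    then show ?thesis using False by simp
  qed
qed

end

section \<open>The exponential map on the symmetric part\<close>

context reductive_group_with_cartan
begin

abbreviation "d\<theta> \<equiv> diff_one G \<theta>"
abbreviation "\<pp> \<equiv> cartan_p G \<theta>"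

lemma theta_carrier: "x \<in> carrier G \<Longrightarrow> \<theta> x \<in> carrier G"
  using theta_hom by (auto simp: hom_def)

lemma theta_mult: "x \<in> carrier G \<Longrightarrow> y \<in> carrier G \<Longrightarrow> \<theta> (x \<otimes> y) = \<theta> x \<otimes> \<theta> y"
  using theta_hom by (rule hom_mult)

lemma theta_one: "\<theta> \<one> = \<one>"
  using hom_one[OF theta_hom is_group is_group] .

lemma theta_inv: "x \<in> carrier G \<Longrightarrow> \<theta> (inv x) = inv (\<theta> x)"
  using theta_mult[of "inv x" x] theta_one theta_carrier by (intro inv_equality[symmetric]) auto

lemma linear_dtheta: "linear d\<theta>"
  by (rule linear_diff_one[OF theta_smooth theta_one])

lemma tangent_theta: "tangent \<gamma> X \<Longrightarrow> tangent (\<lambda>t. \<theta> (\<gamma> t)) (d\<theta> X)"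
  using theta_carrier by (intro tangent_smooth theta_smooth theta_one) auto

lemma dtheta_dtheta: "d\<theta> (d\<theta> X) = X"
proof -
  have "tangent (\<lambda>t. \<theta> (\<theta> (lie_exp G (t *\<^sub>R X)))) (d\<theta> (d\<theta> X))"
    by (intro tangent_theta tangent_exp)
  then have "tangent (\<lambda>t. lie_exp G (t *\<^sub>R X)) (d\<theta> (d\<theta> X))" by (simp add: theta_involutive)
  then show ?thesis using tangent_exp tangent_unique by blast
qed

lemma theta_exp: "\<theta> (lie_exp G X) = lie_exp G (d\<theta> X)"
  by (rule hom_exp[OF theta_hom theta_smooth])

lemma dtheta_Ad:
  assumes "g \<in> carrier G"
  shows "d\<theta> (Ad G g X) = Ad G (\<theta> g) (d\<theta> X)"
proof -
  have "tangent (\<lambda>t. \<theta> (g \<otimes> lie_exp G (t *\<^sub>R X) \<otimes> inv g)) (d\<theta> (Ad G g X))"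
    using assms by (intro tangent_theta tangent_conj tangent_exp)
  moreover have "tangent (\<lambda>t. \<theta> g \<otimes> \<theta> (lie_exp G (t *\<^sub>R X)) \<otimes> inv (\<theta> g)) (Ad G (\<theta> g) (d\<theta> X))"
    using assms by (intro tangent_conj tangent_theta tangent_exp theta_carrier)
  moreover have "\<theta> (g \<otimes> lie_exp G (t *\<^sub>R X) \<otimes> inv g) = \<theta> g \<otimes> \<theta> (lie_exp G (t *\<^sub>R X)) \<otimes> inv (\<theta> g)" for t
    using assms by (simp add: theta_mult theta_inv)
  ultimately show ?thesis using tangent_unique by simp
qed

lemma mem_p: "X \<in> \<pp> \<longleftrightarrow> d\<theta> X = - X"
  by (simp add: cartan_p_def)

lemma subspace_p: "subspace \<pp>"
  using linear_dtheta by (auto simp: subspace_def mem_p linear_0 linear_add linear_scale)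

lemma B_linear:
  "B (X + Y) Z = B X Z + B Y Z" "B Z (X + Y) = B Z X + B Z Y"
  "B (c *\<^sub>R X) Z = c * B X Z" "B Z (c *\<^sub>R X) = c * B Z X" "B (- X) Z = - B X Z" "B Z (- X) = - B Z X"
  "B (X - Y) Z = B X Z - B Y Z" "B Z (X - Y) = B Z X - B Z Y"
  using form_bilinear
  by (simp_all add: bilinear_ladd bilinear_radd bilinear_lmul bilinear_rmul bilinear_lneg bilinear_rneg
      bilinear_lsub bilinear_rsub)

text \<open>\<open>-B(X, \<theta>X)\<close> is the sum of the values of \<open>-B\<close> and \<open>B\<close> at the components of \<open>X\<close>: these are
  orthogonal for \<open>B\<close>, as \<open>\<theta>\<close> preserves \<open>B\<close> and acts on them by different signs.\<close>

lemma form_theta_nonneg: "- B X (d\<theta> X) \<ge> 0"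
  and form_theta_pos: "- B X (d\<theta> X) = 0 \<Longrightarrow> X = 0"
proof -
  define k where "k = (1 / 2) *\<^sub>R (X + d\<theta> X)"
  define p where "p = (1 / 2) *\<^sub>R (X - d\<theta> X)"
  have k: "d\<theta> k = k" and p: "d\<theta> p = - p"
    using linear_dtheta by (simp_all add: k_def p_def linear_add linear_scale linear_diff dtheta_dtheta
        add.commute flip: scaleR_minus_right)
  have X: "X = k + p" by (simp add: k_def p_def scaleR_add_right scaleR_diff_right flip: scaleR_add_left)
  have "B k p = 0" using form_theta[of k p] k p by (simp add: B_linear)
  then have "B p k = 0" using form_symmetric by metis
  have dX: "d\<theta> X = k - p" using linear_dtheta k p by (simp add: X linear_add)
  have eq: "- B X (d\<theta> X) = - B k k + B p p"
    unfolding dX unfolding X using \<open>B k p = 0\<close> \<open>B p k = 0\<close> by (simp add: B_linear)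
  have "k = 0 \<or> B k k < 0" using form_negative[of k] k by (auto simp: cartan_k_def)
  moreover have "p = 0 \<or> B p p > 0" using form_positive[of p] p by (auto simp: cartan_p_def)
  moreover have "B 0 0 = 0" using B_linear(3)[of 0 0 0] by simp
  ultimately have "- B k k + B p p \<ge> 0" "- B k k + B p p = 0 \<Longrightarrow> k = 0 \<and> p = 0" by auto
  then show "- B X (d\<theta> X) \<ge> 0" "- B X (d\<theta> X) = 0 \<Longrightarrow> X = 0"
    unfolding eq using X by auto
qed

lemma Ad_exp_p_symmetric:
  assumes "Z \<in> \<pp>"
  shows "B (Ad G (lie_exp G Z) X) (d\<theta> Y) = B X (d\<theta> (Ad G (lie_exp G Z) Y))"
proof -
  have "\<theta> (lie_exp G Z) = inv (lie_exp G Z)" using assms by (simp add: theta_exp mem_p exp_minus)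
  then have "d\<theta> (Ad G (lie_exp G Z) Y) = Ad G (inv (lie_exp G Z)) (d\<theta> Y)" by (simp add: dtheta_Ad)
  moreover have "B (Ad G (lie_exp G Z) X) (d\<theta> Y) =
      B (Ad G (inv (lie_exp G Z)) (Ad G (lie_exp G Z) X)) (Ad G (inv (lie_exp G Z)) (d\<theta> Y))"
    by (rule form_Ad[symmetric]) simp
  moreover have "Ad G (inv (lie_exp G Z)) (Ad G (lie_exp G Z) X) = X"
    by (simp add: Ad_mult[symmetric] Ad_one)
  ultimately show ?thesis by simp
qed

text \<open>\<open>Ad(exp(Z/2))\<close> is positive definite, being the square of the symmetric operator
  \<open>Ad(exp(Z/4))\<close>. If its own square is the identity, then so is it itself.\<close>

lemma Ad_exp_half:
  assumes Z: "Z \<in> \<pp>" and id: "\<And>X. Ad G (lie_exp G Z) X = X"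
  shows "Ad G (lie_exp G ((1 / 2) *\<^sub>R Z)) X = X"
proof -
  let ?S = "Ad G (lie_exp G ((1 / 2) *\<^sub>R Z))" and ?R = "Ad G (lie_exp G ((1 / 4) *\<^sub>R Z))"
  have S: "?S (?S X) = X" for X
    using id exp_scale_add[of "1 / 2" "1 / 2" Z] by (simp add: Ad_mult[symmetric])
  have R: "?R (?R X) = ?S X" for X
    using exp_scale_add[of "1 / 4" "1 / 4" Z] by (simp add: Ad_mult[symmetric])
  define Y where "Y = ?S X - X"
  have "?S Y = - Y" by (simp add: Y_def linear_diff[OF linear_Ad] S)
  have "- B (?S Y) (d\<theta> Y) = - B (?R Y) (d\<theta> (?R Y))"
    unfolding R[symmetric] using Z subspace_p by (subst Ad_exp_p_symmetric) (auto simp: subspace_scale)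
  then have "- B (?S Y) (d\<theta> Y) \<ge> 0" using form_theta_nonneg by simp
  then have "- B Y (d\<theta> Y) \<le> 0" unfolding \<open>?S Y = - Y\<close> by (simp add: B_linear)
  then have "- B Y (d\<theta> Y) = 0" using form_theta_nonneg[of Y] by simp
  then show ?thesis using form_theta_pos[of Y] by (simp add: Y_def)
qed

text \<open>Halving repeatedly, \<open>Ad(exp tZ)\<close> is the identity for the times \<open>t = 2\<^sup>-\<^sup>n\<close>, which tend to \<open>0\<close>; so
  its derivative at \<open>0\<close> vanishes.\<close>

lemma exp_p_trivial_central:
  assumes Z: "Z \<in> \<pp>" and one: "lie_exp G Z = \<one>"
  shows "bracket G Z X = 0"
proof -
  have "(\<forall>X. Ad G (lie_exp G ((1 / 2 ^ n) *\<^sub>R Z)) X = X)" for n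
  proof (induction n)
    case 0
    then show ?case by (simp add: one Ad_one)
  next
    case (Suc n)
    have "(1 / 2 ^ n) *\<^sub>R Z \<in> \<pp>" using Z subspace_p by (simp add: subspace_scale)
    from Ad_exp_half[OF this] Suc.IH show ?case by simp
  qed
  then have h: "Ad G (lie_exp G ((1 / 2 ^ n) *\<^sub>R Z)) X = X" for n by blast
  let ?f = "\<lambda>t. Ad G (lie_exp G (t *\<^sub>R Z)) X"
  have "((\<lambda>t. (?f t - ?f 0) /\<^sub>R t) \<longlongrightarrow> bracket G Z X) (at 0)"
    using has_vector_derivative_Ad_exp[of Z X 0]
    by (simp add: has_vector_derivative_at_iff_quotient Ad_one)
  moreover have "filterlim (\<lambda>n :: nat. 1 / 2 ^ n :: real) (at 0) sequentially"
    unfolding filterlim_at using LIMSEQ_divide_realpow_zero[of 2 1] by simp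
  ultimately have "(\<lambda>n. (?f (1 / 2 ^ n) - ?f 0) /\<^sub>R (1 / 2 ^ n)) \<longlonglongrightarrow> bracket G Z X"
    by (rule filterlim_compose)
  then have "(\<lambda>n :: nat. 0 :: 'e) \<longlonglongrightarrow> bracket G Z X" by (simp add: h Ad_one)
  then show ?thesis using LIMSEQ_unique tendsto_const by blast
qed

lemma exp_int:
  assumes "lie_exp G Z = \<one>"
  shows "lie_exp G (of_int k *\<^sub>R Z) = \<one>"
proof -
  have nat: "lie_exp G (real n *\<^sub>R Z) = \<one>" for n
    using one_parameter_subgroup_pow[OF one_parameter_subgroup_exp[of Z], of n 1] assms by simp
  show ?thesis
  proof (cases k)
    case (nonneg n)
    then show ?thesis using nat[of n] by simp
  next
    case (neg n)
    then have "(of_int k :: real) = - real (Suc n)" by simp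
    then have "lie_exp G (of_int k *\<^sub>R Z) = inv (lie_exp G (real (Suc n) *\<^sub>R Z))"
      by (simp only: scaleR_minus_left exp_minus)
    then show ?thesis by (simp only: nat inv_one)
  qed
qed

text \<open>The elements \<open>Z\<close> of \<open>\<pp>\<close> with \<open>exp Z = 1\<close> are central, so that the exponential of their
  span \<open>V\<close> is a compact torus. It is normalized by \<open>K\<close>, hence contained in \<open>K\<close> by maximality; but
  \<open>\<theta>\<close> fixes \<open>K\<close> and acts on \<open>V\<close> by \<open>-1\<close>.\<close>

lemma exp_p_trivial:
  assumes "Z \<in> \<pp>" "lie_exp G Z = \<one>"
  shows "Z = 0"
proof -
  define L where "L = {Z \<in> \<pp>. lie_exp G Z = \<one>}"
  define E where "E = lie_exp G ` span L"
  have subK: "subgroup K G" and compK: "compactin T K"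
    and maxK: "\<And>H. subgroup H G \<Longrightarrow> compactin T H \<Longrightarrow> K \<subseteq> H \<Longrightarrow> H = K"
    using K by (auto simp: maximal_compact_subgroup_def)
  have Kc: "k \<in> carrier G" if "k \<in> K" for k using subgroup.subset[OF subK] that by blast
  have central: "bracket G Y X = 0" if "Y \<in> span L" for X Y
    using that
  proof (induction rule: span_induct)
    case base
    show ?case
      by (auto simp: subspace_def linear_0[OF linear_bracket_left] linear_add[OF linear_bracket_left]
          linear_scale[OF linear_bracket_left])
  next
    case (step x)
    then show ?case by (intro exp_p_trivial_central) (auto simp: L_def)
  qed
  have Ad_id: "Ad G (lie_exp G (t *\<^sub>R Y)) X = X" if "Y \<in> span L" for t X Y
    using Ad_exp_eigenvector[of "t *\<^sub>R Y" X 0] central[OF span_scale[OF that]] by simp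
  have exp_add: "lie_exp G (Y + X) = lie_exp G Y \<otimes> lie_exp G X" if "Y \<in> span L" for X Y
    by (rule exp_add_commuting) (rule Ad_id[OF that])
  have compE: "compactin T (lie_exp G ` span F)" if "finite F" "F \<subseteq> L" for F
    using that
  proof (induction F rule: finite_induct)
    case empty
    then show ?case by (simp add: topspace_eq)
  next
    case (insert Z F)
    have Z: "lie_exp G Z = \<one>" "Z \<in> span L" using insert.prems by (auto simp: L_def span_base)
    have "compactin T ((\<lambda>t. lie_exp G (t *\<^sub>R Z)) ` {0..1})"
      by (rule image_compactin[OF _ continuous_exp]) simp
    moreover have "compactin T (lie_exp G ` span F)" using insert by auto
    ultimately have "compactin (prod_topology T T) ((\<lambda>t. lie_exp G (t *\<^sub>R Z)) ` {0..1} \<times> lie_exp G ` span F)"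
      by (simp add: compactin_Times)
    from image_compactin[OF this continuous_mult]
    have "compactin T ((\<lambda>(x, y). x \<otimes> y) ` ((\<lambda>t. lie_exp G (t *\<^sub>R Z)) ` {0..1} \<times> lie_exp G ` span F))" .
    also have "(\<lambda>(x, y). x \<otimes> y) ` ((\<lambda>t. lie_exp G (t *\<^sub>R Z)) ` {0..1} \<times> lie_exp G ` span F) =
        lie_exp G ` span (insert Z F)" (is "?X = ?Y")
    proof (intro equalityI subsetI)
      fix g assume "g \<in> ?X"
      then obtain t W where "W \<in> span F" "g = lie_exp G (t *\<^sub>R Z) \<otimes> lie_exp G W" by auto
      then have "g = lie_exp G (t *\<^sub>R Z + W)" using exp_add[OF span_scale[OF Z(2)]] by simp
      moreover have "t *\<^sub>R Z + W \<in> span (insert Z F)"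
        using \<open>W \<in> span F\<close> by (intro span_add span_scale) (auto intro: span_base span_mono[THEN subsetD])
      ultimately show "g \<in> ?Y" by blast
    next
      fix g assume "g \<in> ?Y"
      then obtain Y where Y: "Y \<in> span (insert Z F)" "g = lie_exp G Y" by blast
      then obtain k where k: "Y - k *\<^sub>R Z \<in> span F" by (auto simp: span_breakdown_eq)
      \<comment> \<open>As \<open>exp Z = 1\<close>, coefficients of \<open>Z\<close> matter modulo \<open>1\<close> only; this gives compactness.\<close>
      have "lie_exp G (k *\<^sub>R Z) = lie_exp G (of_int \<lfloor>k\<rfloor> *\<^sub>R Z) \<otimes> lie_exp G (frac k *\<^sub>R Z)"
        unfolding exp_scale_add[symmetric] by (simp add: frac_def)
      then have "lie_exp G (k *\<^sub>R Z) = lie_exp G (frac k *\<^sub>R Z)" by (simp add: exp_int[OF Z(1)])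
      then have "g = lie_exp G (frac k *\<^sub>R Z) \<otimes> lie_exp G (Y - k *\<^sub>R Z)"
        using exp_add[OF span_scale[OF Z(2), of k], of "Y - k *\<^sub>R Z"] Y by simp
      moreover have "frac k \<in> {0..1}" using frac_ge_0[of k] frac_lt_1[of k] by simp
      ultimately show "g \<in> ?X" using k by (intro image_eqI[of _ _ "(lie_exp G (frac k *\<^sub>R Z), lie_exp G (Y - k *\<^sub>R Z))"]) auto
    qed
    finally show ?case .
  qed
  obtain F where F: "F \<subseteq> L" "independent F" "L \<subseteq> span F" using maximal_independent_subset by blast
  have "finite F"
    using independent_span_bound[OF fin_basis(1)[OF fd] F(2)] fin_basis(3)[OF fd] by simp
  moreover have "span F = span L"
    using F by (metis span_mono span_span subset_antisym)
  ultimately have "compactin T E" using compE[of F] F(1) by (simp add: E_def)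
  define H where "H = (\<lambda>(k, x). k \<otimes> x) ` (K \<times> E)"
  have "compactin T H"
    unfolding H_def
    by (rule image_compactin[OF _ continuous_mult]) (simp add: compactin_Times compK \<open>compactin T E\<close>)
  have conjE: "inv k \<otimes> x \<otimes> k \<in> E" if k: "k \<in> K" and x: "x \<in> E" for k x
  proof -
    have ik: "inv k \<in> K" using subgroup.m_inv_closed[OF subK k] .
    then have "inv k \<in> {x \<in> carrier G. \<theta> x = x}" unfolding theta_fixed .
    then have ti: "\<theta> (inv k) = inv k" by simp
    obtain Y where Y: "Y \<in> span L" "x = lie_exp G Y" using x by (auto simp: E_def)
    have "inv k \<otimes> x \<otimes> k = lie_exp G (Ad G (inv k) Y)"
      using Ad_exp[of "inv k" Y] Kc[OF k] Y by simp
    moreover have "Ad G (inv k) ` L \<subseteq> L"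
    proof clarify
      fix Z assume "Z \<in> L"
      then have Z: "d\<theta> Z = - Z" "lie_exp G Z = \<one>" by (auto simp: L_def mem_p)
      have "d\<theta> (Ad G (inv k) Z) = - Ad G (inv k) Z"
        using Kc[OF k] by (simp add: dtheta_Ad ti Z linear_neg[OF linear_Ad])
      moreover have "lie_exp G (Ad G (inv k) Z) = \<one>"
        using Ad_exp[of "inv k" Z] Kc[OF k] Z by simp
      ultimately show "Ad G (inv k) Z \<in> L" by (simp add: L_def mem_p)
    qed
    then have "span (Ad G (inv k) ` L) \<subseteq> span L" by (rule span_mono)
    then have "Ad G (inv k) ` span L \<subseteq> span L"
      using linear_span_image[OF linear_Ad, of "inv k" L] Kc[OF k] by simp
    ultimately show ?thesis using Y(1) by (auto simp: E_def)
  qed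
  have E_carrier: "x \<in> carrier G" if "x \<in> E" for x using that by (auto simp: E_def)
  have E_mult: "x \<otimes> y \<in> E" if xy: "x \<in> E" "y \<in> E" for x y
  proof -
    obtain X Y where "X \<in> span L" "x = lie_exp G X" "Y \<in> span L" "y = lie_exp G Y" using xy by (auto simp: E_def)
    then show ?thesis
      unfolding E_def by (intro image_eqI[of _ _ "X + Y"]) (auto simp: exp_add span_add)
  qed
  have E_inv: "inv x \<in> E" if x: "x \<in> E" for x
  proof -
    obtain X where "X \<in> span L" "x = lie_exp G X" using x by (auto simp: E_def)
    then show ?thesis
      unfolding E_def by (intro image_eqI[of _ _ "- X"]) (auto simp: exp_minus span_neg)
  qed
  have E_one: "\<one> \<in> E" unfolding E_def by (intro image_eqI[of _ _ 0]) (auto simp: span_zero)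
  have HI: "k \<otimes> x \<in> H" if "k \<in> K" "x \<in> E" for k x
    using that unfolding H_def by (intro image_eqI[of _ _ "(k, x)"]) auto
  have "subgroup H G"
  proof (rule subgroupI)
    show "H \<subseteq> carrier G" using Kc E_carrier by (auto simp: H_def)
    show "H \<noteq> {}" using HI[OF subgroup.one_closed[OF subK] E_one] by blast
  next
    fix g assume "g \<in> H"
    then obtain k x where g: "k \<in> K" "x \<in> E" "g = k \<otimes> x" by (auto simp: H_def)
    note c = Kc[OF g(1)] E_carrier[OF g(2)] and ik = subgroup.m_inv_closed[OF subK g(1)]
    have "inv g = inv k \<otimes> (inv (inv k) \<otimes> inv x \<otimes> inv k)"
      using c by (simp add: g inv_mult_group m_assoc cancel_left)
    then show "inv g \<in> H" using HI[OF ik conjE[OF ik E_inv[OF g(2)]]] by simp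
  next
    fix g h assume "g \<in> H" "h \<in> H"
    then obtain k x j y where g: "k \<in> K" "x \<in> E" "g = k \<otimes> x" "j \<in> K" "y \<in> E" "h = j \<otimes> y" by (auto simp: H_def)
    note c = Kc[OF g(1)] E_carrier[OF g(2)] Kc[OF g(4)] E_carrier[OF g(5)]
    have "g \<otimes> h = (k \<otimes> j) \<otimes> ((inv j \<otimes> x \<otimes> j) \<otimes> y)"
      using c by (simp add: g m_assoc cancel_left)
    then show "g \<otimes> h \<in> H"
      using HI[OF subgroup.m_closed[OF subK g(1,4)] E_mult[OF conjE[OF g(4,2)] g(5)]] by simp
  qed
  moreover have "K \<subseteq> H"
  proof
    fix k assume "k \<in> K"
    from HI[OF this E_one] Kc[OF this] show "k \<in> H" by simp
  qed
  ultimately have "H = K" using maxK \<open>compactin T H\<close> by blast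
  have fixed: "\<theta> (lie_exp G (t *\<^sub>R Z)) = lie_exp G (t *\<^sub>R Z)" for t
  proof -
    have "Z \<in> span L" using assms by (auto simp: L_def intro: span_base)
    then have "lie_exp G (t *\<^sub>R Z) \<in> E" unfolding E_def by (intro imageI span_scale)
    then have "\<one> \<otimes> lie_exp G (t *\<^sub>R Z) \<in> H" by (rule HI[OF subgroup.one_closed[OF subK]])
    then have "lie_exp G (t *\<^sub>R Z) \<in> K" using \<open>H = K\<close> by simp
    then have "lie_exp G (t *\<^sub>R Z) \<in> {x \<in> carrier G. \<theta> x = x}" unfolding theta_fixed .
    then show ?thesis by simp
  qed
  from tangent_theta[OF tangent_exp[of Z]] have "tangent (\<lambda>t. lie_exp G (t *\<^sub>R Z)) (d\<theta> Z)"
    unfolding fixed .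
  then have "d\<theta> Z = Z" using tangent_exp tangent_unique by blast
  then have "Z = - Z" using assms(1) by (simp add: mem_p)
  then have "2 *\<^sub>R Z = 0" by (simp add: scaleR_2 eq_neg_iff_add_eq_0)
  then show ?thesis by simp
qed

end

section \<open>The split part of an Iwasawa decomposition\<close>

context iwasawa
begin

lemma a_subspace: "subspace a" and a_p: "H \<in> a \<Longrightarrow> H \<in> \<pp>" and a_abelian: "H \<in> a \<Longrightarrow> Z \<in> a \<Longrightarrow> bracket G H Z = 0"
  using a unfolding maximal_abelian_in_def Let_def by auto

lemma exp_add_a:
  assumes "H \<in> a" "Z \<in> a"
  shows "lie_exp G (H + Z) = lie_exp G H \<otimes> lie_exp G Z"
proof (rule exp_add_commuting)
  fix t
  have "bracket G (t *\<^sub>R H) Z = 0 *\<^sub>R Z"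
    using a_abelian[OF subspace_scale[OF a_subspace assms(1)] assms(2)] by simp
  from Ad_exp_eigenvector[OF this] show "Ad G (lie_exp G (t *\<^sub>R H)) Z = Z" by simp
qed

text \<open>This makes \<open>lie_log\<close> the inverse of the exponential map on \<open>a\<close>.\<close>

lemma inj_exp_a: "inj_on (lie_exp G) a"
proof (rule inj_onI)
  fix H Z assume H: "H \<in> a" and Z: "Z \<in> a" and eq: "lie_exp G H = lie_exp G Z"
  have "lie_exp G (H + - Z) = lie_exp G H \<otimes> lie_exp G (- Z)"
    by (rule exp_add_a[OF H subspace_neg[OF a_subspace Z]])
  also have "\<dots> = \<one>" by (simp add: eq exp_minus)
  finally have "H + - Z = 0"
    using H Z a_subspace by (intro exp_p_trivial a_p) (simp add: subspace_diff)
  then show "H = Z" by simp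
qed

lemma lie_log_exp: "H \<in> a \<Longrightarrow> lie_log G a (lie_exp G H) = H"
  unfolding lie_log_def by (rule inv_into_f_f[OF inj_exp_a])

lemma cartan_norm_le:
  obtains C where "C \<ge> 0" "\<And>H. H \<in> a \<Longrightarrow> cartan_norm G \<theta> B H \<le> C * norm H"
proof -
  obtain M where M: "M \<ge> 0" "\<And>x y. norm (B x y) \<le> M * norm x * norm y"
    using bilinear_bounded_fin_dim[OF fd form_bilinear] by blast
  have "cartan_norm G \<theta> B H \<le> sqrt M * norm H" if H: "H \<in> a" for H
  proof -
    have "- B H (d\<theta> H) = B H H" using a_p[OF H] by (simp add: mem_p B_linear)
    also have "\<dots> \<le> M * (norm H)\<^sup>2" using M(2)[of H H] by (simp add: power2_eq_square mult.assoc)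
    finally have "cartan_norm G \<theta> B H \<le> sqrt (M * (norm H)\<^sup>2)"
      unfolding cartan_norm_def by (rule real_sqrt_le_mono)
    then show ?thesis by (simp add: real_sqrt_mult)
  qed
  then show ?thesis using that[of "sqrt M"] M(1) by simp
qed

lemma simple_root_linear:
  assumes "\<alpha> \<in> simple_roots a P"
  obtains f where "linear f" "\<And>H. H \<in> a \<Longrightarrow> \<alpha> H = f H"
proof -
  have "\<alpha> \<in> dual_on a"
    using assms P by (auto simp: simple_roots_def positive_system_def restricted_roots_def)
  then obtain f where "linear f" "\<alpha> = restrict f a" by (auto simp: dual_on_def)
  then show ?thesis using that[of f] by simp
qed

text \<open>The closed chamber is cut out by the weak inequalities: adding a small multiple of an
  element on which all positive roots are positive makes them strict.\<close>

lemma closure_positive_chamber: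
  assumes H: "H \<in> a" and nonneg: "\<And>\<alpha>. \<alpha> \<in> simple_roots a P \<Longrightarrow> \<alpha> H \<ge> 0"
  shows "H \<in> closure (positive_chamber a P)"
proof -
  obtain H0 where H0: "H0 \<in> a" "P = {\<alpha> \<in> restricted_roots G a. \<alpha> H0 > 0}"
    using P by (auto simp: positive_system_def)
  show ?thesis
    unfolding closure_approachable
  proof (intro allI impI)
    fix e :: real assume "e > 0"
    define \<epsilon> where "\<epsilon> = (e / 2) / (norm H0 + 1)"
    have \<epsilon>: "\<epsilon> > 0" using \<open>e > 0\<close> by (simp add: \<epsilon>_def add_nonneg_pos)
    have "H + \<epsilon> *\<^sub>R H0 \<in> positive_chamber a P"
      unfolding positive_chamber_def
    proof (intro CollectI conjI ballI)
      show ha: "H + \<epsilon> *\<^sub>R H0 \<in> a" using H H0(1) a_subspace by (simp add: subspace_add subspace_scale)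
      fix \<alpha> assume \<alpha>: "\<alpha> \<in> simple_roots a P"
      obtain f where f: "linear f" "\<And>H. H \<in> a \<Longrightarrow> \<alpha> H = f H" using simple_root_linear[OF \<alpha>] by blast
      have "\<alpha> (H + \<epsilon> *\<^sub>R H0) = \<alpha> H + \<epsilon> * \<alpha> H0"
        using f H H0(1) ha by (simp add: linear_add linear_scale)
      moreover have "\<alpha> H0 > 0" using \<alpha> H0(2) by (auto simp: simple_roots_def)
      ultimately show "\<alpha> (H + \<epsilon> *\<^sub>R H0) > 0" using nonneg[OF \<alpha>] \<epsilon> by (simp add: add_nonneg_pos)
    qed
    moreover have "dist (H + \<epsilon> *\<^sub>R H0) H < e"
    proof -
      have "dist (H + \<epsilon> *\<^sub>R H0) H = \<epsilon> * norm H0" using \<epsilon> by (simp add: dist_norm)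
      also have "\<dots> \<le> \<epsilon> * (norm H0 + 1)" using \<epsilon> by simp
      also have "\<dots> = e / 2"
      proof -
        have "norm H0 + 1 \<noteq> 0" using norm_ge_zero[of H0] by linarith
        then show ?thesis using nonzero_eq_divide_eq[of "norm H0 + 1" \<epsilon> "e / 2"] \<epsilon>_def by blast
      qed
      also have "\<dots> < e" using \<open>e > 0\<close> by simp
      finally show ?thesis .
    qed
    ultimately show "\<exists>y\<in>positive_chamber a P. dist y H < e" by blast
  qed
qed

text \<open>By compactness of the unit sphere of \<open>\<Gamma>\<close>, finitely many simple roots suffice, and the
  negative values are bounded away from \<open>0\<close>.\<close>

lemma cone_negative_roots:
  assumes "\<Gamma> \<subseteq> a" "closed \<Gamma>" "cone \<Gamma>" "\<Gamma> \<inter> (closure (positive_chamber a P) - {0}) = {}"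
  obtains A \<delta> where "finite A" "A \<subseteq> simple_roots a P" "\<delta> > 0"
    "\<And>H. H \<in> \<Gamma> \<Longrightarrow> H \<noteq> 0 \<Longrightarrow> \<exists>\<alpha>\<in>A. \<alpha> H \<le> - \<delta> * norm H"
proof -
  define S where "S = \<Gamma> \<inter> {H. norm H = 1}"
  have "compact S"
  proof (rule compact_fin_dim[OF fd])
    show "bounded S" by (rule boundedI[of _ 1]) (simp add: S_def)
    show "closed S" unfolding S_def by (intro closed_Int assms(2) closed_Collect_eq continuous_intros)
  qed
  have neg: "\<exists>\<alpha>. \<alpha> \<in> simple_roots a P \<and> \<alpha> H < 0" if H: "H \<in> S" for H
  proof (rule ccontr)
    assume "\<not> ?thesis"
    then have "\<And>\<alpha>. \<alpha> \<in> simple_roots a P \<Longrightarrow> \<alpha> H \<ge> 0" by (meson not_less)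
    then have "H \<in> closure (positive_chamber a P)"
      using H assms(1) by (intro closure_positive_chamber) (auto simp: S_def)
    moreover have "H \<noteq> 0" using H by (auto simp: S_def)
    ultimately show False using H assms(4) by (auto simp: S_def)
  qed
  have "\<forall>H. \<exists>\<alpha> f. H \<in> S \<longrightarrow> \<alpha> \<in> simple_roots a P \<and> \<alpha> H < 0 \<and> linear f \<and> (\<forall>Z\<in>a. \<alpha> Z = f Z)"
  proof
    fix H
    show "\<exists>\<alpha> f. H \<in> S \<longrightarrow> \<alpha> \<in> simple_roots a P \<and> \<alpha> H < 0 \<and> linear f \<and> (\<forall>Z\<in>a. \<alpha> Z = f Z)"
    proof (cases "H \<in> S")
      case True
      then obtain \<alpha> where \<alpha>: "\<alpha> \<in> simple_roots a P" "\<alpha> H < 0" using neg by blast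
      obtain f where "linear f" "\<And>Z. Z \<in> a \<Longrightarrow> \<alpha> Z = f Z" using simple_root_linear[OF \<alpha>(1)] by blast
      with \<alpha> show ?thesis by blast
    qed simp
  qed
  from choice[OF this] obtain \<alpha> where
    "\<forall>H. \<exists>f. H \<in> S \<longrightarrow> \<alpha> H \<in> simple_roots a P \<and> \<alpha> H H < 0 \<and> linear f \<and> (\<forall>Z\<in>a. \<alpha> H Z = f Z)" by blast
  from choice[OF this] obtain f where
    af: "\<And>H. H \<in> S \<Longrightarrow> \<alpha> H \<in> simple_roots a P \<and> \<alpha> H H < 0 \<and> linear (f H) \<and> (\<forall>Z\<in>a. \<alpha> H Z = f H Z)" by blast
  have Sa: "H \<in> a" if "H \<in> S" for H using that assms(1) by (auto simp: S_def)
  have "open (f H -` {..<\<alpha> H H / 2})" if "H \<in> S" for H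
    using af[OF that] bounded_linear_fin_dim[OF fd] by (intro open_vimage) (auto intro: linear_continuous_on)
  moreover have "S \<subseteq> (\<Union>H\<in>S. f H -` {..<\<alpha> H H / 2})"
  proof
    fix H assume H: "H \<in> S"
    have "f H H = \<alpha> H H" "\<alpha> H H < 0" using af[OF H] Sa[OF H] by auto
    then have "H \<in> f H -` {..<\<alpha> H H / 2}" by simp
    then show "H \<in> (\<Union>H\<in>S. f H -` {..<\<alpha> H H / 2})" using H by blast
  qed
  ultimately obtain C where C: "C \<subseteq> S" "finite C" "S \<subseteq> (\<Union>H\<in>C. f H -` {..<\<alpha> H H / 2})"
    using compactE_image[OF \<open>compact S\<close>, of S "\<lambda>H. f H -` {..<\<alpha> H H / 2}"] by blast
  define \<delta> where "\<delta> = Min (insert 1 ((\<lambda>H. - \<alpha> H H / 2) ` C))"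
  have "\<delta> > 0" unfolding \<delta>_def using C af by (subst Min_gr_iff) auto
  have \<delta>: "\<alpha> Y Y / 2 \<le> - \<delta>" if "Y \<in> C" for Y
  proof -
    have "\<delta> \<le> - \<alpha> Y Y / 2" unfolding \<delta>_def using C(2) that by (intro Min_le) auto
    then show ?thesis by linarith
  qed
  have "\<exists>\<beta>\<in>\<alpha> ` C. \<beta> H \<le> - \<delta> * norm H" if H: "H \<in> \<Gamma>" "H \<noteq> 0" for H
  proof -
    have "inverse (norm H) *\<^sub>R H \<in> S"
      using H assms(3) by (auto simp: S_def cone_def)
    then obtain Y where Y: "Y \<in> C" "f Y (inverse (norm H) *\<^sub>R H) < \<alpha> Y Y / 2" using C(3) by auto
    have YS: "Y \<in> S" using Y C(1) by blast
    have "f Y (inverse (norm H) *\<^sub>R H) = inverse (norm H) * \<alpha> Y H"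
      using af[OF YS] H(1) assms(1) by (auto simp: linear_scale)
    then have "inverse (norm H) * \<alpha> Y H \<le> - \<delta>" using Y(2) \<delta>[OF Y(1)] by simp
    then have "norm H * (inverse (norm H) * \<alpha> Y H) \<le> norm H * (- \<delta>)" by (intro mult_left_mono) auto
    moreover have "norm H * (inverse (norm H) * \<alpha> Y H) = \<alpha> Y H" using H(2) by (simp flip: mult.assoc)
    ultimately have "\<alpha> Y H \<le> - \<delta> * norm H" by (simp add: mult.commute)
    then show ?thesis using Y(1) by blast
  qed
  moreover have "\<alpha> ` C \<subseteq> simple_roots a P" using C af by blast
  ultimately show ?thesis using that[of "\<alpha> ` C" \<delta>] C(2) \<open>\<delta> > 0\<close> by blast
qed

lemma exp_root_vector:
  assumes "\<alpha> \<in> simple_roots a P" "X \<in> root_space G a \<alpha>"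
  shows "lie_exp G (t *\<^sub>R X) \<in> iwasawa_N G a P"
proof -
  have "\<alpha> \<in> P" using assms(1) by (simp add: simple_roots_def)
  then have "t *\<^sub>R X \<in> iwasawa_n G a P"
    unfolding iwasawa_n_def using assms(2) by (intro span_scale span_base) auto
  then show ?thesis unfolding iwasawa_N_def analytic_subgroup_def by (intro generate.incl imageI)
qed

end

section \<open>Decay of Whittaker coefficients\<close>

locale iwasawa_rep = iwasawa G K \<theta> B a P + lie_rep G \<pi>
  for G :: "('a, 'e::real_normed_vector, 'm) lie_group_scheme" (structure)
    and K :: "'a set" and \<theta> :: "'a \<Rightarrow> 'a" and B :: "'e \<Rightarrow> 'e \<Rightarrow> real"
    and a :: "'e set" and P :: "('e \<Rightarrow> real) set"
    and \<pi> :: "'a \<Rightarrow> 'h::complex_hilbert_space \<Rightarrow> 'h"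
begin

lemma seminorm_a_growth:
  obtains C \<kappa> where "C \<ge> 0" "\<kappa> \<ge> 0"
    "\<And>H v. H \<in> a \<Longrightarrow> v \<in> SV \<Longrightarrow> seminorm N (\<pi> (inv (lie_exp G H)) v) \<le> C * exp (\<kappa> * norm H) * seminorm N v"
proof -
  obtain M c where M: "M \<ge> 0" "c \<ge> 0"
    "\<And>H v. H \<in> a \<Longrightarrow> norm (\<pi> (lie_exp G H) v) \<le> M * exp (c * norm H) * norm v"
    using rep.action_exp_commuting_bound[OF a_subspace exp_add_a] by blast
  obtain A d where A: "A \<ge> 0" "d \<ge> 0"
    "\<And>H Z. H \<in> a \<Longrightarrow> norm (Ad G (lie_exp G H) Z) \<le> A * exp (d * norm H) * norm Z"
    using Ad.action_exp_commuting_bound[OF a_subspace exp_add_a] by blast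
  obtain C where C: "C > 0" "\<And>v g M A. v \<in> SV \<Longrightarrow> g \<in> carrier G \<Longrightarrow> M \<ge> 0 \<Longrightarrow> A \<ge> 1 \<Longrightarrow>
    (\<And>w. norm (\<pi> g w) \<le> M * norm w) \<Longrightarrow> (\<And>Z. norm (Ad G (inv g) Z) \<le> A * norm Z) \<Longrightarrow>
    seminorm N (\<pi> g v) \<le> C * M * A ^ N * seminorm N v"
    using seminorm_translate[of N] by blast
  define A' where "A' = max A 1"
  have "seminorm N (\<pi> (inv (lie_exp G H)) v) \<le> (C * M * A' ^ N) * exp ((c + real N * d) * norm H) * seminorm N v"
    if H: "H \<in> a" and v: "v \<in> SV" for H v
  proof -
    have "seminorm N (\<pi> (inv (lie_exp G H)) v) \<le>
        C * (M * exp (c * norm H)) * (A' * exp (d * norm H)) ^ N * seminorm N v"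
    proof (rule C(2)[OF v])
      show "norm (\<pi> (inv (lie_exp G H)) w) \<le> M * exp (c * norm H) * norm w" for w
        using M(3)[OF subspace_neg[OF a_subspace H]] by (simp add: exp_minus)
      show "norm (Ad G (inv (inv (lie_exp G H))) Z) \<le> A' * exp (d * norm H) * norm Z" for Z
      proof -
        have "A * exp (d * norm H) * norm Z \<le> A' * exp (d * norm H) * norm Z"
          by (intro mult_right_mono) (auto simp: A'_def)
        with A(3)[OF H, of Z] have "norm (Ad G (lie_exp G H) Z) \<le> A' * exp (d * norm H) * norm Z"
          by (rule order_trans)
        then show ?thesis by simp
      qed
      have "1 * 1 \<le> A' * exp (d * norm H)" using A(2) by (intro mult_mono) (auto simp: A'_def)
      then show "1 \<le> A' * exp (d * norm H)" by simp
    qed (use M in auto)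
    also have "\<dots> = (C * M * A' ^ N) * (exp (c * norm H) * exp (d * norm H) ^ N) * seminorm N v"
      by (simp add: power_mult_distrib mult_ac)
    also have "exp (c * norm H) * exp (d * norm H) ^ N = exp ((c + real N * d) * norm H)"
      by (simp add: distrib_right mult.assoc flip: exp_add exp_of_nat_mult)
    finally show ?thesis .
  qed
  moreover have "C * M * A' ^ N \<ge> 0" "c + real N * d \<ge> 0" using C(1) M A by (auto simp: A'_def)
  ultimately show ?thesis using that by blast
qed

lemma seminorm_K_bound:
  obtains C where "C \<ge> 0"
    "\<And>k v. k \<in> K \<Longrightarrow> v \<in> SV \<Longrightarrow> seminorm N (\<pi> (inv k) v) \<le> C * seminorm N v"
proof -
  have subK: "subgroup K G" and compK: "compactin T K" using K by (auto simp: maximal_compact_subgroup_def)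
  obtain M where M: "M \<ge> 0" "\<And>k v. k \<in> K \<Longrightarrow> norm (\<pi> k v) \<le> M * norm v"
    using rep.action_compact_bound[OF compK] by blast
  obtain A where A: "A \<ge> 0" "\<And>k Z. k \<in> K \<Longrightarrow> norm (Ad G k Z) \<le> A * norm Z"
    using Ad.action_compact_bound[OF compK] by blast
  obtain C where C: "C > 0" "\<And>v g M A. v \<in> SV \<Longrightarrow> g \<in> carrier G \<Longrightarrow> M \<ge> 0 \<Longrightarrow> A \<ge> 1 \<Longrightarrow>
    (\<And>w. norm (\<pi> g w) \<le> M * norm w) \<Longrightarrow> (\<And>Z. norm (Ad G (inv g) Z) \<le> A * norm Z) \<Longrightarrow>
    seminorm N (\<pi> g v) \<le> C * M * A ^ N * seminorm N v"
    using seminorm_translate[of N] by blast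
  have "seminorm N (\<pi> (inv k) v) \<le> C * M * (max A 1) ^ N * seminorm N v" if k: "k \<in> K" and v: "v \<in> SV" for k v
  proof (rule C(2)[OF v])
    have kc: "k \<in> carrier G" using subgroup.subset[OF subK] k by blast
    show "inv k \<in> carrier G" using kc by simp
    show "norm (\<pi> (inv k) w) \<le> M * norm w" for w using M(2)[OF subgroup.m_inv_closed[OF subK k]] .
    show "norm (Ad G (inv (inv k)) Z) \<le> max A 1 * norm Z" for Z
    proof -
      have "A * norm Z \<le> max A 1 * norm Z" by (intro mult_right_mono) auto
      then show ?thesis using A(2)[OF k, of Z] kc by simp
    qed
  qed (use M in auto)
  moreover have "C * M * (max A 1) ^ N \<ge> 0" using C(1) M(1) by simp
  ultimately show ?thesis using that by blast
qed

text \<open>A root vector \<open>X\<close> is an eigenvector of \<open>Ad(exp H)\<close>. Inserting \<open>d\<pi>(X)\<close> therefore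
  gains a factor \<open>e\<^bsup>\<alpha>(H)\<^esup>\<close>.\<close>

lemma whittaker_root_iteration:
  assumes l: "l \<in> whittaker_functionals G (iwasawa_N G a P) \<psi> \<pi>"
    and \<alpha>: "\<alpha> \<in> simple_roots a P" and X: "X \<in> root_space G a \<alpha>"
    and nz: "character_derivative G \<psi> X \<noteq> 0" and H: "H \<in> a" and u: "u \<in> SV"
  shows "l (\<pi> (inv (lie_exp G H)) u) =
    (of_real (exp (\<alpha> H)) / character_derivative G \<psi> X) ^ m * l (\<pi> (inv (lie_exp G H)) (foldr d\<pi> (replicate m X) u))"
proof (induction m)
  case 0
  then show ?case by simp
next
  case (Suc m)
  let ?g = "inv (lie_exp G H)" and ?c = "character_derivative G \<psi> X"
  define w where "w = foldr d\<pi> (replicate m X) u"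
  have w: "w \<in> SV" unfolding w_def by (rule foldr_smooth[OF u])
  have g: "?g \<in> carrier G" by simp
  have scale: "l (c *\<^sub>C v) = c * l v" if "v \<in> SV" for c v
    using l that by (auto simp: whittaker_functionals_def)
  have "bracket G H X = \<alpha> H *\<^sub>R X" using X H by (auto simp: root_space_def)
  then have "Ad G (inv ?g) X = exp (\<alpha> H) *\<^sub>R X" using Ad_exp_eigenvector by simp
  then have "d\<pi> X (\<pi> ?g w) = \<pi> ?g (d\<pi> (exp (\<alpha> H) *\<^sub>R X) w)" by (simp add: derived_rep_conj[OF w g])
  also have "\<dots> = of_real (exp (\<alpha> H)) *\<^sub>C \<pi> ?g (d\<pi> X w)"
    using linear_scale[OF linear_derived_rep_left[OF w]] by (simp add: rep_scaleR flip: scaleR_scaleC)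
  finally have "l (d\<pi> X (\<pi> ?g w)) = of_real (exp (\<alpha> H)) * l (\<pi> ?g (d\<pi> X w))"
    using scale[OF smooth_vectors_rep[OF smooth_vectors_derived_rep[OF w] g]] by simp
  moreover have "l (d\<pi> X (\<pi> ?g w)) = ?c * l (\<pi> ?g w)"
    by (rule whittaker_functional_derived_rep[OF l exp_root_vector[OF \<alpha> X] smooth_vectors_rep[OF w g]])
  ultimately have "l (\<pi> ?g w) = of_real (exp (\<alpha> H)) / ?c * l (\<pi> ?g (d\<pi> X w))"
    using nz by (simp add: field_simps)
  then show ?case using Suc.IH by (simp add: w_def mult_ac)
qed

text \<open>The order \<open>N + m\<close> of the seminorm is the order \<open>N\<close> needed to bound \<open>l\<close> plus the number \<open>m\<close> of
  root vectors inserted. At \<open>H = 0\<close>, where no root is negative, the growth estimate suffices.\<close>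

lemma whittaker_coefficient_decay:
  assumes reg: "regular_character G a P \<psi>"
    and l: "l \<in> whittaker_functionals G (iwasawa_N G a P) \<psi> \<pi>"
    and \<Gamma>: "\<Gamma> \<subseteq> a" "closed \<Gamma>" "cone \<Gamma>" "\<Gamma> \<inter> (closure (positive_chamber a P) - {0}) = {}"
    and s: "s > 0"
  shows "\<exists>q. continuous_seminorm G \<pi> q \<and>
    (\<forall>v\<in>SV. \<forall>k\<in>K. \<forall>x\<in>lie_exp G ` \<Gamma>.
      norm (whittaker_coefficient G \<pi> l v (k \<otimes> x)) \<le> exp (- s * cartan_norm G \<theta> B (lie_log G a x)) * q v)"
proof -
  have lscale: "\<And>c v. v \<in> SV \<Longrightarrow> l (c *\<^sub>C v) = c * l v"
    and lcont: "continuous_map (smooth_topology G \<pi>) euclidean l"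
    using l unfolding whittaker_functionals_def by auto
  obtain N C1 where C1: "C1 > 0" "\<And>v. v \<in> SV \<Longrightarrow> norm (l v) \<le> C1 * seminorm N v"
    using continuous_functional_bound[OF lscale lcont] by blast
  obtain C2 \<kappa> where C2: "C2 \<ge> 0" "\<kappa> \<ge> 0"
    "\<And>H v. H \<in> a \<Longrightarrow> v \<in> SV \<Longrightarrow> seminorm N (\<pi> (inv (lie_exp G H)) v) \<le> C2 * exp (\<kappa> * norm H) * seminorm N v"
    using seminorm_a_growth by blast
  obtain A \<delta> where A: "finite A" "A \<subseteq> simple_roots a P" and \<delta>: "\<delta> > 0"
    and neg: "\<And>H. H \<in> \<Gamma> \<Longrightarrow> H \<noteq> 0 \<Longrightarrow> \<exists>\<alpha>\<in>A. \<alpha> H \<le> - \<delta> * norm H"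
    using cone_negative_roots[OF \<Gamma>] by blast
  obtain c0 where c0: "c0 \<ge> 0" "\<And>H. H \<in> a \<Longrightarrow> cartan_norm G \<theta> B H \<le> c0 * norm H"
    using cartan_norm_le by blast
  have "\<forall>\<alpha>. \<exists>X. \<alpha> \<in> simple_roots a P \<longrightarrow> X \<in> root_space G a \<alpha> \<and> character_derivative G \<psi> X \<noteq> 0"
    using reg unfolding regular_character_def by blast
  from choice[OF this] obtain X where
    X: "\<And>\<alpha>. \<alpha> \<in> simple_roots a P \<Longrightarrow> X \<alpha> \<in> root_space G a \<alpha> \<and> character_derivative G \<psi> (X \<alpha>) \<noteq> 0" by blast
  \<comment> \<open>So many factors \<open>e\<^bsup>\<alpha>(H)\<^esup>\<close> compensate the exponential growth and leave the required decay.\<close>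
  obtain m :: nat where "(\<kappa> + s * c0) / \<delta> < real m" using reals_Archimedean2 by blast
  then have m: "\<kappa> + s * c0 < real m * \<delta>" using \<delta> by (simp add: field_simps)
  obtain C3 where C3: "C3 \<ge> 0"
    "\<And>k v. k \<in> K \<Longrightarrow> v \<in> SV \<Longrightarrow> seminorm (N + m) (\<pi> (inv k) v) \<le> C3 * seminorm (N + m) v"
    using seminorm_K_bound by blast
  have "\<forall>\<alpha>. \<exists>C>0. \<forall>v\<in>SV. seminorm N (foldr d\<pi> (replicate m (X \<alpha>)) v) \<le> C * seminorm (N + m) v"
  proof
    fix \<alpha>
    obtain C where "C > 0" "\<And>v. v \<in> SV \<Longrightarrow> seminorm N (foldr d\<pi> (replicate m (X \<alpha>)) v) \<le>
        C * seminorm (N + length (replicate m (X \<alpha>))) v"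
      using seminorm_foldr by blast
    then show "\<exists>C>0. \<forall>v\<in>SV. seminorm N (foldr d\<pi> (replicate m (X \<alpha>)) v) \<le> C * seminorm (N + m) v" by auto
  qed
  from choice[OF this] obtain C4 where C4: "\<And>\<alpha>. C4 \<alpha> > 0"
    "\<And>\<alpha> v. v \<in> SV \<Longrightarrow> seminorm N (foldr d\<pi> (replicate m (X \<alpha>)) v) \<le> C4 \<alpha> * seminorm (N + m) v" by blast
  define D where "D \<alpha> = inverse (norm (character_derivative G \<psi> (X \<alpha>))) ^ m * C4 \<alpha>" for \<alpha>
  have D: "D \<alpha> \<ge> 0" for \<alpha> using C4(1)[of \<alpha>] by (simp add: D_def)
  define E where "E = 1 + (\<Sum>\<alpha>\<in>A. D \<alpha>)"
  have E: "E \<ge> 1" "\<And>\<alpha>. \<alpha> \<in> A \<Longrightarrow> D \<alpha> \<le> E"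
    using D A(1) by (auto simp: E_def sum_nonneg intro!: add_increasing member_le_sum)
  define Q where "Q = C1 * C2 * E * C3"
  have Q: "Q \<ge> 0" using C1 C2 C3 E by (simp add: Q_def)
  have grow: "norm (l (\<pi> (inv (lie_exp G H)) w)) \<le> C1 * C2 * exp (\<kappa> * norm H) * seminorm N w"
    if H: "H \<in> a" and w: "w \<in> SV" for H w
  proof -
    have "norm (l (\<pi> (inv (lie_exp G H)) w)) \<le> C1 * seminorm N (\<pi> (inv (lie_exp G H)) w)"
      by (rule C1(2)[OF smooth_vectors_rep[OF w]]) simp
    also have "\<dots> \<le> C1 * (C2 * exp (\<kappa> * norm H) * seminorm N w)"
      using C1(1) C2(3)[OF H w] by (intro mult_left_mono) auto
    finally show ?thesis by (simp add: mult.assoc)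
  qed
  have main: "norm (l (\<pi> (inv (lie_exp G H)) u)) \<le> C1 * C2 * E * exp (- s * (c0 * norm H)) * seminorm (N + m) u"
    if H: "H \<in> \<Gamma>" and u: "u \<in> SV" for H u
  proof (cases "H = 0")
    case True
    have "norm (l (\<pi> (inv (lie_exp G H)) u)) \<le> C1 * C2 * exp (\<kappa> * norm H) * seminorm N u"
      using H \<Gamma>(1) u by (intro grow) auto
    also have "\<dots> = C1 * C2 * 1 * seminorm N u" using True by simp
    also have "\<dots> \<le> C1 * C2 * E * seminorm (N + m) u"
      using C1(1) C2(1) E(1) seminorm_nonneg by (intro mult_mono seminorm_mono) auto
    finally show ?thesis using True by simp
  next
    case False
    then obtain \<alpha> where \<alpha>: "\<alpha> \<in> A" "\<alpha> H \<le> - \<delta> * norm H" using neg[OF H] by blast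
    have Ha: "H \<in> a" using H \<Gamma>(1) by blast
    have \<alpha>s: "\<alpha> \<in> simple_roots a P" using \<alpha>(1) A(2) by blast
    let ?w = "foldr d\<pi> (replicate m (X \<alpha>)) u" and ?c = "character_derivative G \<psi> (X \<alpha>)"
    have "norm (l (\<pi> (inv (lie_exp G H)) u)) =
        (exp (\<alpha> H) * inverse (norm ?c)) ^ m * norm (l (\<pi> (inv (lie_exp G H)) ?w))"
      using whittaker_root_iteration[OF l \<alpha>s _ _ Ha u, of "X \<alpha>" m] X[OF \<alpha>s]
      by (simp add: norm_mult norm_power norm_inverse divide_inverse)
    also have "\<dots> \<le> (exp (\<alpha> H) * inverse (norm ?c)) ^ m * (C1 * C2 * exp (\<kappa> * norm H) * (C4 \<alpha> * seminorm (N + m) u))"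
    proof (rule mult_left_mono)
      have "C1 * C2 * exp (\<kappa> * norm H) * seminorm N ?w \<le> C1 * C2 * exp (\<kappa> * norm H) * (C4 \<alpha> * seminorm (N + m) u)"
        using C1(1) C2(1) C4(2)[OF u] by (intro mult_left_mono) auto
      then show "norm (l (\<pi> (inv (lie_exp G H)) ?w)) \<le> C1 * C2 * exp (\<kappa> * norm H) * (C4 \<alpha> * seminorm (N + m) u)"
        using grow[OF Ha foldr_smooth[OF u]] order_trans by blast
    qed simp
    also have "\<dots> = (exp (\<alpha> H) ^ m * exp (\<kappa> * norm H)) * (C1 * C2 * D \<alpha> * seminorm (N + m) u)"
      by (simp add: D_def power_mult_distrib mult_ac)
    also have "\<dots> \<le> exp (- s * (c0 * norm H)) * (C1 * C2 * E * seminorm (N + m) u)"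
    proof (rule mult_mono)
      have "real m * \<alpha> H \<le> real m * (- \<delta> * norm H)" using \<alpha>(2) by (intro mult_left_mono) auto
      moreover have "(\<kappa> + s * c0) * norm H \<le> (real m * \<delta>) * norm H" using m by (intro mult_right_mono) auto
      ultimately have "real m * \<alpha> H + \<kappa> * norm H \<le> - s * (c0 * norm H)" by (simp add: algebra_simps)
      then show "exp (\<alpha> H) ^ m * exp (\<kappa> * norm H) \<le> exp (- s * (c0 * norm H))"
        by (simp add: exp_of_nat_mult[symmetric] exp_add[symmetric])
      show "C1 * C2 * D \<alpha> * seminorm (N + m) u \<le> C1 * C2 * E * seminorm (N + m) u"
        using C1(1) C2(1) E(2)[OF \<alpha>(1)] seminorm_nonneg by (intro mult_right_mono mult_left_mono) auto
      show "0 \<le> C1 * C2 * D \<alpha> * seminorm (N + m) u"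
        using C1(1) C2(1) D seminorm_nonneg by (intro mult_nonneg_nonneg) auto
    qed simp
    finally show ?thesis by (simp add: mult_ac)
  qed
  have subK: "subgroup K G" using K by (simp add: maximal_compact_subgroup_def)
  have "norm (whittaker_coefficient G \<pi> l v (k \<otimes> lie_exp G H)) \<le>
      exp (- s * cartan_norm G \<theta> B (lie_log G a (lie_exp G H))) * (Q * seminorm (N + m) v)"
    if v: "v \<in> SV" and k: "k \<in> K" and H: "H \<in> \<Gamma>" for v k H
  proof -
    have kc: "k \<in> carrier G" using subgroup.subset[OF subK] k by blast
    have Ha: "H \<in> a" using H \<Gamma>(1) by blast
    have u: "\<pi> (inv k) v \<in> SV" using kc by (intro smooth_vectors_rep[OF v]) simp
    have "whittaker_coefficient G \<pi> l v (k \<otimes> lie_exp G H) = l (\<pi> (inv (lie_exp G H)) (\<pi> (inv k) v))"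
      using kc by (simp add: whittaker_coefficient_def inv_mult_group rep_mult)
    then have "norm (whittaker_coefficient G \<pi> l v (k \<otimes> lie_exp G H)) \<le>
        C1 * C2 * E * exp (- s * (c0 * norm H)) * seminorm (N + m) (\<pi> (inv k) v)"
      using main[OF H u] by simp
    also have "\<dots> \<le> C1 * C2 * E * exp (- s * cartan_norm G \<theta> B H) * (C3 * seminorm (N + m) v)"
    proof (rule mult_mono)
      have "s * cartan_norm G \<theta> B H \<le> s * (c0 * norm H)" using c0(2)[OF Ha] s by (intro mult_left_mono) auto
      then show "C1 * C2 * E * exp (- s * (c0 * norm H)) \<le> C1 * C2 * E * exp (- s * cartan_norm G \<theta> B H)"
        using C1(1) C2(1) E(1) by (intro mult_left_mono) auto
      show "seminorm (N + m) (\<pi> (inv k) v) \<le> C3 * seminorm (N + m) v" by (rule C3(2)[OF k v])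
      show "0 \<le> C1 * C2 * E * exp (- s * cartan_norm G \<theta> B H)" using C1(1) C2(1) E(1) by simp
    qed (rule seminorm_nonneg)
    finally show ?thesis by (simp add: lie_log_exp[OF Ha] Q_def mult_ac)
  qed
  then show ?thesis
    by (intro exI[of _ "\<lambda>v. Q * seminorm (N + m) v"] conjI continuous_seminorm_seminorm[OF Q]) auto
qed

end

theorem corollary2p4:
  fixes G :: "('a, 'e::real_normed_vector) lie_group"
    and K :: "'a set" and \<theta> :: "'a \<Rightarrow> 'a" and B :: "'e \<Rightarrow> 'e \<Rightarrow> real"
    and a :: "'e set" and P :: "('e \<Rightarrow> real) set" and \<psi> :: "'a \<Rightarrow> complex"
    and \<pi> :: "'a \<Rightarrow> 'h::complex_hilbert_space \<Rightarrow> 'h" and l :: "'h \<Rightarrow> complex"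
    and \<Gamma> :: "'e set" and s :: real
  assumes "iwasawa G K \<theta> B a P"
    and "unitary_character G (iwasawa_N G a P) \<psi>"
    and "regular_character G a P \<psi>"
    and "continuous_rep G \<pi>" and "admissible K \<pi>" and "finite_length G \<pi>"
    and "l \<in> whittaker_functionals G (iwasawa_N G a P) \<psi> \<pi>"
    and "\<Gamma> \<subseteq> a" and "closed \<Gamma>" and "cone \<Gamma>"
    and "\<Gamma> \<inter> (closure (positive_chamber a P) - {0}) = {}"
    and "s > 0"
  shows "\<exists>q. continuous_seminorm G \<pi> q \<and>
    (\<forall>v\<in>smooth_vectors G \<pi>. \<forall>k\<in>K. \<forall>x\<in>lie_exp G ` \<Gamma>.
      norm (whittaker_coefficient G \<pi> l v (k \<otimes>\<^bsub>G\<^esub> x))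
        \<le> exp (- s * cartan_norm G \<theta> B (lie_log G a x)) * q v)"
proof -
  interpret iwasawa G K \<theta> B a P by fact
  interpret lie_rep G \<pi> by unfold_locales fact
  interpret iwasawa_rep G K \<theta> B a P \<pi> by unfold_locales
  show ?thesis by (rule whittaker_coefficient_decay) fact+
qed

end
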